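(* Let $1<p<\infty$, let $W:\mathbb{R}^d\to\mathcal{M}_n(\mathbb{C})$ be a matrix $A_p$ weight, and let $B:\mathbb{R}^d\to\mathcal{M}_n(\mathbb{C})$ be locally integrable. Then $B\in\mathrm{BMO}_W^p$ if and only if both $$\sup_{I\subset\mathbb{R}^d\text{ cube}}\frac1{|I|}\int_I\|W^{1/p}(x)(B(x)-m_IB)V_I^{-1}\|^p\,dx<\infty$$ and $$\sup_{I\subset\mathbb{R}^d\text{ cube}}\frac1{|I|}\int_I\|W^{-1/p}(x)(B^*(x)-m_IB^* )(V_I')^{-1}\|^{p'}\,dx<\infty$$ hold.
   Context: $n,d\ge 1$ are integers; $\mathcal{M}_n(\mathbb{C})$ is the algebra of $n\times n$ complex matrices with operator norm $\|\cdot\|$; $|\cdot|$ is the Euclidean norm on $\mathbb{C}^n$; cubes have sides parallel to the axes; $m_I F$ is the (entrywise) average of $F$ over $I$; $p'=p/(p-1)$. A measurable a.e. positive definite $W:\mathbb{R}^d\to\mathcal{M}_n(\mathbb{C})$ is a matrix $A_p$ weight if $$\|W\|_{A_p}:=\sup_{I\text{ cube}}\frac1{|I|}\int_I\Big(\frac1{|I|}\int_I\|W^{1/p}(x)W^{-1/p}(t)\|^{p'}dt\Big)^{p/p'}dx<\infty.$$ Reducing operators: for each cube $I$, $V_I$ and $V_I'$ are (any) positive definite matrices with $\rho(\vec e)\le|V_I\vec e|\le\sqrt n\,\rho(\vec e)$, $\rho(\vec e)=\big(\frac1{|I|}\int_I|W^{1/p}(x)\vec e|^p dx\big)^{1/p}$,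 and $\rho^*(\vec e)\le|V_I'\vec e|\le\sqrt n\,\rho^*(\vec e)$, $\rho^*(\vec e)=\big(\frac1{|I|}\int_I|W^{-1/p}(x)\vec e|^{p'}dx\big)^{1/p'}$, for all $\vec e\in\mathbb{C}^n$. $\mathrm{BMO}_W^p$ is by definition the space of locally integrable $B:\mathbb{R}^d\to\mathcal{M}_n(\mathbb{C})$ satisfying: if $2\le p<\infty$, the first of the two displayed conditions of the claim; if $1<p\le 2$, the second of them (for $p=2$ either one may be taken as the definition; the assertion is meant for either choice). *)

theory Defs
  imports "HOL-Analysis.Analysis"
begin

section \<open>Complex matrices\<close>

definition cadjoint :: "complex^'n^'m \<Rightarrow> complex^'m^'n" where
  "cadjoint A = (\<chi> i j. cnj (A $ j $ i))"

definition pos_def :: "complex^'n^'n \<Rightarrow> bool" where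
  "pos_def A \<longleftrightarrow> cadjoint A = A \<and>
     (\<forall>v. v \<noteq> 0 \<longrightarrow> 0 < Re (\<Sum>i\<in>UNIV. (A *v v) $ i * cnj (v $ i)))"

definition unitary :: "complex^'n^'n \<Rightarrow> bool" where
  "unitary U \<longleftrightarrow> U ** cadjoint U = mat 1 \<and> cadjoint U ** U = mat 1"

definition real_diag :: "('n \<Rightarrow> real) \<Rightarrow> complex^'n^'n" where
  "real_diag l = (\<chi> i j. if i = j then complex_of_real (l i) else 0)"

text \<open>The spectral power of a positive definite matrix: if \<open>A = U diag(l) U\<^sup>*\<close> with \<open>U\<close> unitary
  and all \<open>l i > 0\<close>, then \<open>mpow A s = U diag(l\<^sup>s) U\<^sup>*\<close>, which does not depend on the
  diagonalization (see \<open>mpow_eqI\<close> below). The value is unspecified if \<open>A\<close> is not positive definite.\<close>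

definition mpow :: "complex^'n^'n \<Rightarrow> real \<Rightarrow> complex^'n^'n" where
  "mpow A s = (THE X. \<exists>U l. unitary U \<and> (\<forall>i. 0 < l i) \<and>
      A = U ** real_diag l ** cadjoint U \<and>
      X = U ** real_diag (\<lambda>i. l i powr s) ** cadjoint U)"

lemma real_diag_mult_nth: "(M ** real_diag l) $ i $ j = M $ i $ j * complex_of_real (l j)"
proof -
  have "(M ** real_diag l) $ i $ j =
      (\<Sum>k\<in>UNIV. if k = j then M $ i $ k * complex_of_real (l k) else 0)"
    unfolding matrix_matrix_mult_def real_diag_def by (simp add: if_distrib cong: if_cong)
  then show ?thesis by simp
qed

lemma mult_real_diag_nth: "(real_diag l ** M) $ i $ j = complex_of_real (l i) * M $ i $ j"
proof -
  have "(real_diag l ** M) $ i $ j =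
      (\<Sum>k\<in>UNIV. if i = k then complex_of_real (l i) * M $ k $ j else 0)"
    unfolding matrix_matrix_mult_def real_diag_def
    by (simp add: if_distrib if_distribR cong: if_cong)
  then show ?thesis by simp
qed

lemma mpow_unique:
  assumes U: "unitary U" and V: "unitary V"
    and eq: "U ** real_diag l ** cadjoint U = V ** real_diag m ** cadjoint V"
  shows "U ** real_diag (\<lambda>i. l i powr s) ** cadjoint U =
         V ** real_diag (\<lambda>i. m i powr s) ** cadjoint V"
proof -
  define M where "M = cadjoint V ** U"
  have "M ** real_diag l = cadjoint V ** (U ** real_diag l ** cadjoint U) ** U"
    using U unfolding M_def unitary_def by (metis matrix_mul_assoc matrix_mul_rid)
  also have "\<dots> = real_diag m ** M"
    using V unfolding eq M_def unitary_def by (metis matrix_mul_assoc matrix_mul_lid)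
  finally have *: "M $ i $ j * complex_of_real (l j) = complex_of_real (m i) * M $ i $ j" for i j
    by (metis real_diag_mult_nth mult_real_diag_nth)
  have "M $ i $ j = 0 \<or> l j = m i" for i j
    using *[of i j] by (metis mult.commute mult_cancel_right of_real_eq_iff)
  then have "M ** real_diag (\<lambda>i. l i powr s) = real_diag (\<lambda>i. m i powr s) ** M"
    unfolding vec_eq_iff real_diag_mult_nth mult_real_diag_nth
    by (metis mult.commute mult_zero_left)
  then have "V ** (M ** real_diag (\<lambda>i. l i powr s)) ** cadjoint U =
      V ** (real_diag (\<lambda>i. m i powr s) ** M) ** cadjoint U" by simp
  then show ?thesis
    using U V unfolding M_def unitary_def by (metis matrix_mul_assoc matrix_mul_lid matrix_mul_rid)
qed

lemma mpow_eqI: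
  assumes "unitary U" "\<And>i. 0 < l i" "A = U ** real_diag l ** cadjoint U"
  shows "mpow A s = U ** real_diag (\<lambda>i. l i powr s) ** cadjoint U"
  unfolding mpow_def
proof (rule the_equality)
  show "\<exists>U' l'. unitary U' \<and> (\<forall>i. 0 < l' i) \<and> A = U' ** real_diag l' ** cadjoint U' \<and>
      U ** real_diag (\<lambda>i. l i powr s) ** cadjoint U =
      U' ** real_diag (\<lambda>i. l' i powr s) ** cadjoint U'"
    using assms by blast
next
  fix X
  assume "\<exists>U' l'. unitary U' \<and> (\<forall>i. 0 < l' i) \<and> A = U' ** real_diag l' ** cadjoint U' \<and>
      X = U' ** real_diag (\<lambda>i. l' i powr s) ** cadjoint U'"
  then show "X = U ** real_diag (\<lambda>i. l i powr s) ** cadjoint U"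
    using mpow_unique assms by metis
qed

text \<open>The norm on \<open>complex^'n\<close> is Euclidean, but the library's \<open>norm\<close> on \<open>complex^'n^'n\<close> is the
  Frobenius norm, so the operator norm is taken from \<open>onorm\<close>.\<close>

definition opnorm :: "complex^'n^'n \<Rightarrow> real" where
  "opnorm A = onorm (\<lambda>v. A *v v)"


section \<open>Cubes and averages\<close>

definition cubes :: "(real^'d) set set" where
  "cubes = {cbox a (a + (\<chi> i. l)) | a l. 0 < l}"

text \<open>Averages of nonnegative quantities are taken in \<open>[0,\<infinity>]\<close>, so that finiteness is a genuine
  condition and no integrability has to be presupposed.\<close>

definition ennavg :: "(real^'d) set \<Rightarrow> (real^'d \<Rightarrow> ennreal) \<Rightarrow> ennreal" where
  "ennavg I f = (\<integral>\<^sup>+x\<in>I. f x \<partial>lebesgue) / emeasure lebesgue I"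

definition epowr :: "ennreal \<Rightarrow> real \<Rightarrow> ennreal" where
  \<comment> \<open>used for positive exponents only\<close>
  "epowr x a = (if x = \<infinity> then \<infinity> else ennreal (enn2real x powr a))"

definition mavg :: "(real^'d) set \<Rightarrow> (real^'d \<Rightarrow> complex^'n^'n) \<Rightarrow> complex^'n^'n" where
  "mavg I F = (1 / measure lebesgue I) *\<^sub>R (LINT x:I|lebesgue. F x)"

definition locally_integrable :: "(real^'d \<Rightarrow> complex^'n^'n) \<Rightarrow> bool" where
  "locally_integrable F \<longleftrightarrow> (\<forall>K. compact K \<longrightarrow> F absolutely_integrable_on K)"

definition conj_exp :: "real \<Rightarrow> real" where
  "conj_exp p = p / (p - 1)"


section \<open>Matrix weights, reducing operators and weighted BMO\<close>

definition Ap_const :: "real \<Rightarrow> (real^'d \<Rightarrow> complex^'n^'n) \<Rightarrow> ennreal" where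
  "Ap_const p W = (SUP I\<in>cubes. ennavg I (\<lambda>x.
      epowr (ennavg I (\<lambda>t.
          ennreal (opnorm (mpow (W x) (1/p) ** mpow (W t) (- 1/p)) powr conj_exp p)))
        (p / conj_exp p)))"

definition matrix_Ap :: "real \<Rightarrow> (real^'d \<Rightarrow> complex^'n^'n) \<Rightarrow> bool" where
  "matrix_Ap p W \<longleftrightarrow> W \<in> borel_measurable lebesgue \<and> (AE x in lebesgue. pos_def (W x)) \<and>
     Ap_const p W < \<infinity>"

definition avg_norm :: "(real^'d \<Rightarrow> complex^'n^'n) \<Rightarrow> real \<Rightarrow> (real^'d) set \<Rightarrow> complex^'n \<Rightarrow> ennreal" where
  "avg_norm A q I e = epowr (ennavg I (\<lambda>x. ennreal (norm (A x *v e) powr q))) (1/q)"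

definition reducing_operator ::
    "(real^'d \<Rightarrow> complex^'n^'n) \<Rightarrow> real \<Rightarrow> (real^'d) set \<Rightarrow> complex^'n^'n \<Rightarrow> bool" where
  "reducing_operator A q I R \<longleftrightarrow> pos_def R \<and>
     (\<forall>e. avg_norm A q I e \<le> ennreal (norm (R *v e)) \<and>
          ennreal (norm (R *v e)) \<le> ennreal (sqrt (real CARD('n))) * avg_norm A q I e)"

definition bmo_cond :: "real \<Rightarrow> (real^'d \<Rightarrow> complex^'n^'n) \<Rightarrow> ((real^'d) set \<Rightarrow> complex^'n^'n) \<Rightarrow>
    (real^'d \<Rightarrow> complex^'n^'n) \<Rightarrow> bool" where
  "bmo_cond p W V B \<longleftrightarrow> (SUP I\<in>cubes. ennavg I (\<lambda>x.
      ennreal (opnorm (mpow (W x) (1/p) ** (B x - mavg I B) ** matrix_inv (V I)) powr p))) < \<infinity>"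

definition bmo_dual_cond :: "real \<Rightarrow> (real^'d \<Rightarrow> complex^'n^'n) \<Rightarrow>
    ((real^'d) set \<Rightarrow> complex^'n^'n) \<Rightarrow> (real^'d \<Rightarrow> complex^'n^'n) \<Rightarrow> bool" where
  "bmo_dual_cond p W V' B \<longleftrightarrow> (SUP I\<in>cubes. ennavg I (\<lambda>x.
      ennreal (opnorm (mpow (W x) (- 1/p) **
          (cadjoint (B x) - mavg I (\<lambda>y. cadjoint (B y))) ** matrix_inv (V' I)) powr conj_exp p))) < \<infinity>"

text \<open>For \<open>p = 2\<close> either condition may serve as the definition; the flag \<open>primal\<close> records the choice
  and is irrelevant for \<open>p \<noteq> 2\<close>.\<close>

definition BMO_W :: "bool \<Rightarrow> real \<Rightarrow> (real^'d \<Rightarrow> complex^'n^'n) \<Rightarrow> ((real^'d) set \<Rightarrow> complex^'n^'n) \<Rightarrow>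
    ((real^'d) set \<Rightarrow> complex^'n^'n) \<Rightarrow> (real^'d \<Rightarrow> complex^'n^'n) set" where
  "BMO_W primal p W V V' = {B. locally_integrable B \<and>
     (if 2 < p \<or> (p = 2 \<and> primal) then bmo_cond p W V B else bmo_dual_cond p W V' B)}"

end

theory Submission
  imports Defs
begin

text \<open>
  Both conditions are equivalent to one and the same unweighted condition, that the averages over
  cubes \<open>J\<close> of \<open>|V\<^sub>J (B - m\<^sub>J B) V\<^sub>J\<^sup>-\<^sup>1|\<close> are bounded. So each of the two conditions implies
  the other for every exponent, and it does not matter which of them defines the space.

  The unweighted condition is self-dual. For an \<open>A\<^sub>p\<close> weight the products \<open>V\<^sub>J V'\<^sub>J\<close> are bounded
  uniformly in \<open>J\<close> (\<open>reducing_operators_product_bound\<close>), and their inverses always are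
  (\<open>norm_inverse_product_le\<close>). Hence \<open>V'\<^sub>J\<close> may be replaced by the inverse of \<open>V\<^sub>J\<close>, and taking adjoints
  turns the condition for \<open>(V, B)\<close> into that for \<open>(V', B\<^sup>*)\<close> (\<open>dual_osc_bound\<close>). A weighted condition
  implies the unweighted one by Hoelder's inequality (\<open>osc_bound_of_weighted_osc_bound\<close>).

  The substance is the converse, an inequality of John--Nirenberg type (\<open>john_nirenberg\<close>). It rests on
  two facts. A Calderon--Zygmund decomposition of the scalar function \<open>|V\<^sub>J (B - m\<^sub>J B) V\<^sub>J\<^sup>-\<^sup>1|\<close> gives
  stopping cubes that fill at most half of \<open>J\<close> (\<open>calderon_zygmund\<close>). And for each vector \<open>u\<close> the scalar
  weight \<open>|W\<^sup>1\<^sup>/\<^sup>p u|\<^sup>p\<close> satisfies an \<open>A\<^sub>\<infinity>\<close> condition with a constant that does not depend on \<open>u\<close>, so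
  it loses a fixed proportion when passing from \<open>J\<close> to the union of the stopping cubes
  (\<open>weight_decay\<close>). Iterating the decomposition with \<open>u\<close> fixed therefore produces a geometric series.

  Measurability of the spectral powers of \<open>W\<close> needs an argument of its own: positive definite
  matrices are diagonalized, and their powers are pointwise limits of polynomials in the matrix.
\<close>

section \<open>Complex matrices and their adjoints\<close>

definition cinner :: "complex^'n \<Rightarrow> complex^'n \<Rightarrow> complex" where
  "cinner v w = (\<Sum>i\<in>UNIV. v $ i * cnj (w $ i))"

lemma Re_cinner: "Re (cinner v w) = inner v w"
  by (simp add: cinner_def inner_vec_def inner_complex_def)

lemma cinner_self: "cinner v v = complex_of_real ((norm v)\<^sup>2)"
proof (rule complex_eqI)
  show "Re (cinner v v) = Re (complex_of_real ((norm v)\<^sup>2))"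
    by (simp add: Re_cinner power2_norm_eq_inner)
  show "Im (cinner v v) = Im (complex_of_real ((norm v)\<^sup>2))"
    by (simp add: cinner_def)
qed

lemma cinner_commute: "cinner v w = cnj (cinner w v)"
  by (simp add: cinner_def mult.commute)

lemma cinner_simps:
  "cinner (v + w) z = cinner v z + cinner w z"
  "cinner (v - w) z = cinner v z - cinner w z"
  "cinner (r *\<^sub>R v) z = complex_of_real r * cinner v z"
  "cinner z (r *\<^sub>R v) = complex_of_real r * cinner z v"
  "cinner 0 z = 0"
  by (simp_all add: cinner_def sum.distrib sum_subtractf sum_distrib_left algebra_simps)
    (simp_all add: scaleR_conv_of_real sum_distrib_left algebra_simps)

lemma norm_cinner_le: "norm (cinner v w) \<le> norm v * norm w"
proof -
  have "norm (cinner v w) \<le> (\<Sum>i\<in>UNIV. \<bar>norm (v $ i)\<bar> * \<bar>norm (w $ i)\<bar>)"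
    unfolding cinner_def by (rule order_trans[OF norm_sum]) (simp add: norm_mult)
  also have "\<dots> \<le> norm v * norm w"
    unfolding norm_vec_def by (rule L2_set_mult_ineq)
  finally show ?thesis .
qed

lemma cinner_adjoint: "cinner (A *v v) w = cinner v (cadjoint A *v w)"
  unfolding cinner_def cadjoint_def matrix_vector_mult_def
  by (simp add: sum_distrib_left sum_distrib_right) (subst sum.swap, simp add: mult_ac)

lemma cadjoint_nth [simp]: "cadjoint A $ i $ j = cnj (A $ j $ i)"
  by (simp add: cadjoint_def)

lemma cadjoint_simps [simp]:
  "cadjoint (cadjoint A) = A"
  "cadjoint (A + B) = cadjoint A + cadjoint B"
  "cadjoint (A - B) = cadjoint A - cadjoint B"
  "cadjoint (r *\<^sub>R A) = r *\<^sub>R cadjoint A"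
  "cadjoint (mat 1) = mat 1"
  "cadjoint (real_diag l) = real_diag l"
  by (auto simp: vec_eq_iff mat_def real_diag_def)

lemma cadjoint_mult: "cadjoint (A ** B) = cadjoint B ** cadjoint A"
  by (simp add: vec_eq_iff matrix_matrix_mult_def mult.commute)

lemma norm_cadjoint [simp]: "norm (cadjoint A) = norm A"
proof -
  have "(norm (cadjoint A))\<^sup>2 = (norm A)\<^sup>2"
    unfolding norm_vec_def L2_set_def
    by (simp add: sum_nonneg) (rule sum.swap)
  then show ?thesis by (simp add: power2_eq_iff_nonneg)
qed

lemma norm_matrix_vector_le: "norm (A *v v) \<le> norm A * norm v"
  for A :: "complex^'n^'m"
proof -
  have "norm ((A *v v) $ i) \<le> norm (A $ i) * norm v" for i
  proof -
    have "norm ((A *v v) $ i) \<le> (\<Sum>j\<in>UNIV. \<bar>norm (A $ i $ j)\<bar> * \<bar>norm (v $ j)\<bar>)"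
      unfolding matrix_vector_mult_def by (simp, rule order_trans[OF norm_sum]) (simp add: norm_mult)
    also have "\<dots> \<le> norm (A $ i) * norm v"
      unfolding norm_vec_def by (rule L2_set_mult_ineq)
    finally show ?thesis .
  qed
  then have "norm (A *v v) \<le> L2_set (\<lambda>i. norm (A $ i) * norm v) UNIV"
    unfolding norm_vec_def[of "A *v v"] by (intro L2_set_mono) auto
  also have "\<dots> = norm A * norm v"
    by (simp add: norm_vec_def[of A] L2_set_left_distrib)
  finally show ?thesis .
qed

text \<open>The estimates are made in the Frobenius norm, which is the library norm on matrices. It is
  submultiplicative and invariant under adjoints, and unlike the operator norm it comes with
  continuity and measurability for free.\<close>

lemma norm_matrix_mult_le: "norm (A ** B) \<le> norm A * norm B"
  for A :: "complex^'n^'m" and B :: "complex^'k^'n"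
proof -
  have "norm ((A ** B) $ i) \<le> norm (A $ i) * norm B" for i
  proof -
    have "(A ** B) $ i = (\<Sum>k\<in>UNIV. A $ i $ k *s B $ k)"
      by (simp add: vec_eq_iff matrix_matrix_mult_def)
    also have "norm \<dots> \<le> (\<Sum>k\<in>UNIV. \<bar>norm (A $ i $ k)\<bar> * \<bar>norm (B $ k)\<bar>)"
    proof (rule order_trans[OF norm_sum], rule sum_mono)
      fix k
      have "norm (c *s x) = norm c * norm x" for c and x :: "complex^'k"
        by (simp add: norm_vec_def norm_mult L2_set_right_distrib)
      then show "norm (A $ i $ k *s B $ k) \<le> \<bar>norm (A $ i $ k)\<bar> * \<bar>norm (B $ k)\<bar>" by simp
    qed
    also have "\<dots> \<le> norm (A $ i) * norm B"
      unfolding norm_vec_def[of "A $ i"] norm_vec_def[of B] by (rule L2_set_mult_ineq)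
    finally show ?thesis .
  qed
  then have "norm (A ** B) \<le> L2_set (\<lambda>i. norm (A $ i) * norm B) UNIV"
    unfolding norm_vec_def[of "A ** B"] by (intro L2_set_mono) auto
  also have "\<dots> = norm A * norm B"
    by (simp add: norm_vec_def[of A] L2_set_left_distrib)
  finally show ?thesis .
qed

text \<open>Controlling the columns of a matrix controls the matrix up to a dimensional constant; this turns
  estimates for vectors into estimates for matrices.\<close>

lemma norm_matrix_le_columns: "norm A \<le> (\<Sum>j\<in>UNIV. norm (A *v axis j 1))"
  for A :: "complex^'n^'m"
proof -
  have "norm A = norm (cadjoint A)" by simp
  also have "\<dots> \<le> (\<Sum>j\<in>UNIV. norm (cadjoint A $ j))"
    unfolding norm_vec_def[of "cadjoint A"] by (rule L2_set_le_sum) simp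
  also have "\<dots> = (\<Sum>j\<in>UNIV. norm (A *v axis j 1))"
  proof (rule sum.cong[OF refl])
    fix j :: 'n
    have "(A *v axis j 1) $ i = A $ i $ j" for i
      by (simp add: matrix_vector_mult_def axis_def if_distrib cong: if_cong)
    then show "norm (cadjoint A $ j) = norm (A *v axis j 1)" by (simp add: norm_vec_def)
  qed
  finally show ?thesis .
qed

lemma norm_le_opnorm: "norm (A *v v) \<le> opnorm A * norm v"
  unfolding opnorm_def by (rule onorm) (rule matrix_vector_mul_bounded_linear)

lemma opnorm_nonneg [simp]: "0 \<le> opnorm A"
  unfolding opnorm_def by (rule onorm_pos_le) (rule matrix_vector_mul_bounded_linear)

lemma opnorm_le_norm: "opnorm A \<le> norm A"
  unfolding opnorm_def by (rule onorm_le) (rule norm_matrix_vector_le)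

lemma norm_axis_complex: "norm (axis j (1::complex)) = 1"
  by (simp add: norm_vec_def axis_def L2_set_def if_distrib[of norm] if_distrib[of "\<lambda>x. x\<^sup>2"]
      cong: if_cong)

lemma norm_le_card_opnorm: "norm A \<le> real CARD('n) * opnorm A" for A :: "complex^'n^'n"
proof -
  have "norm A \<le> (\<Sum>j\<in>UNIV. norm (A *v axis j 1))" by (rule norm_matrix_le_columns)
  also have "\<dots> \<le> (\<Sum>j\<in>(UNIV::'n set). opnorm A)"
  proof (rule sum_mono)
    fix j :: 'n
    show "norm (A *v axis j 1) \<le> opnorm A"
      using norm_le_opnorm[of A "axis j 1"] by (simp add: norm_axis_complex)
  qed
  finally show ?thesis by simp
qed

lemma opnorm_cadjoint_le: "opnorm (cadjoint A) \<le> opnorm A"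
  unfolding opnorm_def[of "cadjoint A"]
proof (rule onorm_le)
  fix v
  have "(norm (cadjoint A *v v))\<^sup>2 = norm (cinner (cadjoint A *v v) (cadjoint A *v v))"
    by (simp add: cinner_self norm_power)
  also have "\<dots> = norm (cinner v (A *v (cadjoint A *v v)))"
    by (simp add: cinner_adjoint)
  also have "\<dots> \<le> norm v * (opnorm A * norm (cadjoint A *v v))"
    by (intro order_trans[OF norm_cinner_le] mult_left_mono norm_le_opnorm norm_ge_zero)
  finally show "norm (cadjoint A *v v) \<le> opnorm A * norm v"
    by (cases "cadjoint A *v v = 0") (auto simp: power2_eq_square mult_ac)
qed

lemma opnorm_cadjoint [simp]: "opnorm (cadjoint A) = opnorm A"
  using opnorm_cadjoint_le[of A] opnorm_cadjoint_le[of "cadjoint A"] by simp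

lemma bounded_bilinear_matrix_mult:
  "bounded_bilinear ((**) :: complex^'n^'m \<Rightarrow> complex^'k^'n \<Rightarrow> complex^'k^'m)"
proof
  show "\<exists>K. \<forall>a b. norm ((a::complex^'n^'m) ** (b::complex^'k^'n)) \<le> norm a * norm b * K"
    by (rule exI[of _ 1]) (simp add: norm_matrix_mult_le)
qed (simp_all add: vec_eq_iff matrix_matrix_mult_def sum.distrib algebra_simps scaleR_sum_right)

lemma bounded_linear_cadjoint: "bounded_linear (cadjoint :: complex^'n^'m \<Rightarrow> complex^'m^'n)"
  by (rule bounded_linear_intro[where K = 1]) simp_all

lemma borel_measurable_matrix_mult [measurable]:
  fixes f :: "'a \<Rightarrow> complex^'n^'m" and g :: "'a \<Rightarrow> complex^'k^'n"
  assumes "f \<in> borel_measurable M" "g \<in> borel_measurable M"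
  shows "(\<lambda>x. f x ** g x) \<in> borel_measurable M"
  by (rule borel_measurable_continuous_Pair[OF assms])
    (intro bounded_bilinear.continuous_on[OF bounded_bilinear_matrix_mult] continuous_intros)

lemma borel_measurable_matrix_vector [measurable]:
  fixes f :: "'a \<Rightarrow> complex^'n^'m"
  assumes "f \<in> borel_measurable M"
  shows "(\<lambda>x. f x *v v) \<in> borel_measurable M"
proof -
  have "bounded_linear (\<lambda>A::complex^'n^'m. A *v v)"
  proof (rule bounded_linear_intro[where K = "norm v"])
    show "norm (A *v v) \<le> norm A * norm v" for A :: "complex^'n^'m"
      by (rule norm_matrix_vector_le)
  qed (simp_all add: vec_eq_iff matrix_vector_mult_def sum.distrib distrib_right scaleR_sum_right)
  from borel_measurable_continuous_on[OF linear_continuous_on[OF this] assms] show ?thesis .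
qed

lemma borel_measurable_cadjoint [measurable]:
  fixes f :: "'a \<Rightarrow> complex^'n^'m"
  assumes "f \<in> borel_measurable M"
  shows "(\<lambda>x. cadjoint (f x)) \<in> borel_measurable M"
  by (rule borel_measurable_continuous_on[OF linear_continuous_on[OF bounded_linear_cadjoint] assms])

lemma matrix_inv_both:
  fixes A B :: "complex^'n^'n"
  assumes "B ** A = mat 1"
  shows "matrix_inv A ** A = mat 1" "A ** matrix_inv A = mat 1"
proof -
  have "A ** B = mat 1" using assms matrix_left_right_inverse by blast
  then have "invertible A" using assms by (auto simp: invertible_def)
  then show "matrix_inv A ** A = mat 1" "A ** matrix_inv A = mat 1"
    unfolding invertible_def matrix_inv_def by (metis (mono_tags, lifting) someI_ex)+
qed

lemma pos_def_inverse:
  fixes A :: "complex^'n^'n"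
  assumes "pos_def A"
  shows "matrix_inv A ** A = mat 1" "A ** matrix_inv A = mat 1"
proof -
  have "\<forall>v. A *v v = 0 \<longrightarrow> v = 0"
    using assms unfolding pos_def_def by force
  then obtain B where "B ** A = mat 1"
    using matrix_left_invertible_ker[of A] by blast
  then show "matrix_inv A ** A = mat 1" "A ** matrix_inv A = mat 1"
    using matrix_inv_both by blast+
qed

lemma cadjoint_matrix_inv:
  fixes A :: "complex^'n^'n"
  assumes "pos_def A"
  shows "cadjoint (matrix_inv A) = matrix_inv A"
proof -
  have "cadjoint A = A" using assms by (simp add: pos_def_def)
  then have "A ** cadjoint (matrix_inv A) = mat 1"
    using arg_cong[OF pos_def_inverse(1)[OF assms], of cadjoint] by (simp add: cadjoint_mult)
  then show ?thesis
    using pos_def_inverse(1)[OF assms] by (metis matrix_mul_assoc matrix_mul_lid matrix_mul_rid)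
qed

section \<open>Diagonalization of Hermitian matrices\<close>

text \<open>Eigenvectors are produced one at a time: on the unit sphere of the orthogonal complement of
  those already found, the Rayleigh quotient attains its maximum by compactness, and the first-order
  condition at a maximum point says that it is an eigenvector.\<close>

lemma hermitian_eigenvector_in_complement:
  fixes A :: "complex^'n^'n" and u :: "'n \<Rightarrow> complex^'n"
  assumes herm: "cadjoint A = A" and k: "k \<notin> S"
    and eig: "\<And>i. i \<in> S \<Longrightarrow> A *v u i = \<mu> i *\<^sub>R u i"
  obtains v l where "norm v = 1" "\<And>i. i \<in> S \<Longrightarrow> cinner v (u i) = 0" "A *v v = l *\<^sub>R v"
proof -
  define T where "T = {v. \<forall>i\<in>S. cinner v (u i) = 0}"
  define M :: "complex^'n^'n" where "M = (\<chi> i j. if i \<in> S then cnj (u i $ j) else 0)"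
  have M_nth: "(M *v v) $ i = (if i \<in> S then cinner v (u i) else 0)" for v i
    by (simp add: M_def matrix_vector_mult_def cinner_def mult.commute)
  \<comment> \<open>The orthogonality conditions form a square system whose row \<open>k\<close> is zero, hence it is singular.\<close>
  have "\<exists>v\<in>T. v \<noteq> 0"
  proof (rule ccontr)
    assume "\<not> ?thesis"
    moreover have "v \<in> T" if "M *v v = 0" for v
      unfolding T_def
    proof (intro CollectI ballI)
      fix i assume "i \<in> S"
      then show "cinner v (u i) = 0" using M_nth[of v i] that by simp
    qed
    ultimately have "\<forall>v. M *v v = 0 \<longrightarrow> v = 0" by blast
    then obtain N where "N ** M = mat 1"
      using matrix_left_invertible_ker[of M] by blast
    then have "M ** N = mat 1" using matrix_left_right_inverse by blast
    then have "(M ** N) $ k $ k = 1" by (simp add: mat_def)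
    moreover have "(M ** N) $ k $ k = 0"
      using k by (simp add: matrix_matrix_mult_def M_def)
    ultimately show False by simp
  qed
  then obtain w where w: "w \<in> T" "w \<noteq> 0" by blast
  have T_lin: "a *\<^sub>R x + b *\<^sub>R y \<in> T" if "x \<in> T" "y \<in> T" for x y a b
    using that by (simp add: T_def cinner_simps)
  have T_scale: "a *\<^sub>R x \<in> T" if "x \<in> T" for x a
    using T_lin[OF that that, of a 0] by simp
  have T_A: "A *v x \<in> T" if "x \<in> T" for x
    using that eig by (simp add: T_def cinner_adjoint herm cinner_simps)
  have cont: "continuous_on UNIV (\<lambda>v. cinner v z)" for z :: "complex^'n"
    unfolding cinner_def by (intro continuous_intros)
  have "closed (\<Inter>i\<in>S. {v. cinner v (u i) = 0})"
    by (intro closed_INT ballI closed_Collect_eq cont continuous_on_const)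
  also have "(\<Inter>i\<in>S. {v. cinner v (u i) = 0}) = T" by (auto simp: T_def)
  finally have "closed T" .
  then have comp: "compact (T \<inter> sphere 0 1)" by (simp add: closed_Int_compact)
  have ne: "T \<inter> sphere 0 1 \<noteq> {}"
    using T_scale[OF w(1), of "1 / norm w"] w(2) by auto
  have "continuous_on (T \<inter> sphere 0 1) (\<lambda>v. (A *v v) \<bullet> v)"
    by (intro continuous_intros linear_continuous_on matrix_vector_mul_bounded_linear)
  from continuous_attains_sup[OF comp ne this] obtain v0 where
    v0: "v0 \<in> T" "norm v0 = 1" and
    max: "\<And>v. v \<in> T \<Longrightarrow> norm v = 1 \<Longrightarrow> (A *v v) \<bullet> v \<le> (A *v v0) \<bullet> v0" by auto
  define m where "m = (A *v v0) \<bullet> v0"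
  have A_lin: "A *v (x + y) = A *v x + A *v y" "A *v (a *\<^sub>R x) = a *\<^sub>R (A *v x)" for x y a
    using matrix_vector_mul_bounded_linear[of A]
    by (simp_all add: bounded_linear_def linear_add linear_scale)
  have sym: "(A *v x) \<bullet> y = x \<bullet> (A *v y)" for x y
    by (metis Re_cinner cinner_adjoint herm)
  have Q: "0 \<le> m * (v \<bullet> v) - (A *v v) \<bullet> v" if "v \<in> T" for v
  proof (cases "v = 0")
    case False
    have "(A *v ((1 / norm v) *\<^sub>R v)) \<bullet> ((1 / norm v) *\<^sub>R v) \<le> m"
      unfolding m_def by (rule max) (use that False T_scale in auto)
    then have "(A *v v) \<bullet> v / (norm v)\<^sup>2 \<le> m"
      by (simp add: A_lin power2_eq_square)
    then show ?thesis
      using False by (simp add: divide_le_eq power2_norm_eq_inner)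
  qed simp
  define g where "g = m *\<^sub>R v0 - A *v v0"
  have "g \<in> T" using T_lin[OF v0(1) T_A[OF v0(1)], of m "-1"] by (simp add: g_def)
  define q where "q = m * (g \<bullet> g) - (A *v g) \<bullet> g"
  have v0v0: "v0 \<bullet> v0 = 1" using v0(2) by (simp add: norm_eq_1)
  \<comment> \<open>The form \<open>m |v|\<^sup>2 - A v \<bullet> v\<close> is nonnegative on \<open>T\<close> and vanishes at \<open>v0\<close>, so its derivative at
    \<open>v0\<close> in the direction of the residual \<open>g\<close> must vanish; that derivative is \<open>2 (g \<bullet> g)\<close>.\<close>
  have expand: "0 \<le> 2 * t * (g \<bullet> g) + t\<^sup>2 * q" for t
  proof -
    have "0 \<le> m * ((v0 + t *\<^sub>R g) \<bullet> (v0 + t *\<^sub>R g)) - (A *v (v0 + t *\<^sub>R g)) \<bullet> (v0 + t *\<^sub>R g)"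
      by (rule Q) (use T_lin[OF v0(1) \<open>g \<in> T\<close>, of 1 t] in simp)
    also have "\<dots> = (m * (v0 \<bullet> v0) - (A *v v0) \<bullet> v0) + 2 * t * (m * (v0 \<bullet> g) - (A *v v0) \<bullet> g) + t\<^sup>2 * q"
      by (simp add: A_lin inner_simps q_def power2_eq_square algebra_simps inner_commute sym)
        (use sym[of g v0] in \<open>simp add: inner_commute\<close>)
    also have "m * (v0 \<bullet> g) - (A *v v0) \<bullet> g = g \<bullet> g"
      by (simp add: g_def flip: inner_scaleR_left inner_diff_left)
    finally show ?thesis by (simp add: v0v0 m_def)
  qed
  have "g \<bullet> g = 0"
  proof (rule ccontr)
    assume "g \<bullet> g \<noteq> 0"
    then have pos: "0 < g \<bullet> g" by simp
    define s where "s = (g \<bullet> g) / (\<bar>q\<bar> + 1)"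
    have s: "0 < s" using pos by (simp add: s_def add_nonneg_pos)
    have "s * q < 2 * (g \<bullet> g)"
    proof -
      have "s * q \<le> s * (\<bar>q\<bar> + 1)" using s by (intro mult_left_mono) auto
      also have "\<dots> = g \<bullet> g" unfolding s_def by (simp add: add_nonneg_eq_0_iff)
      finally show ?thesis using pos by linarith
    qed
    then have "s * (s * q) < s * (2 * (g \<bullet> g))" using s by simp
    then show False using expand[of "- s"] by (simp add: power2_eq_square algebra_simps)
  qed
  then have "A *v v0 = m *\<^sub>R v0" by (simp add: g_def)
  then show ?thesis using that v0 by (auto simp: T_def)
qed

lemma hermitian_orthonormal_eigenvectors:
  fixes A :: "complex^'n^'n" and S :: "'n set"
  assumes herm: "cadjoint A = A"
  shows "\<exists>u \<mu>. (\<forall>i\<in>S. A *v u i = \<mu> i *\<^sub>R u i) \<and>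
    (\<forall>i\<in>S. \<forall>j\<in>S. cinner (u i) (u j) = (if i = j then 1 else 0))"
proof (induction rule: finite_induct[OF finite[of S]])
  case (2 k S)
  then obtain u \<mu> where u: "\<And>i. i \<in> S \<Longrightarrow> A *v u i = \<mu> i *\<^sub>R u i"
    "\<And>i j. i \<in> S \<Longrightarrow> j \<in> S \<Longrightarrow> cinner (u i) (u j) = (if i = j then 1 else 0)" by blast
  obtain v l where v: "norm v = 1" "\<And>i. i \<in> S \<Longrightarrow> cinner v (u i) = 0" "A *v v = l *\<^sub>R v"
    using hermitian_eigenvector_in_complement[where u = u and \<mu> = \<mu>, OF herm \<open>k \<notin> S\<close> u(1)] by blast
  have "cinner (u i) v = 0" if "i \<in> S" for i
    using v(2)[OF that] cinner_commute[of "u i" v] by simp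
  then show ?case
    using 2 u v by (intro exI[of _ "u(k := v)"] exI[of _ "\<mu>(k := l)"]) (auto simp: cinner_self[of v])
qed simp

theorem pos_def_diagonalizable:
  fixes A :: "complex^'n^'n"
  assumes "pos_def A"
  obtains U :: "complex^'n^'n" and l :: "'n \<Rightarrow> real" where "unitary U" "\<And>i. 0 < l i" "A = U ** real_diag l ** cadjoint U"
proof -
  have herm: "cadjoint A = A" using assms by (simp add: pos_def_def)
  obtain u :: "'n \<Rightarrow> complex^'n" and \<mu> where "(\<forall>i\<in>UNIV. A *v u i = \<mu> i *\<^sub>R u i) \<and>
      (\<forall>i\<in>UNIV. \<forall>j\<in>UNIV. cinner (u i) (u j) = (if i = j then 1 else 0))"
    using hermitian_orthonormal_eigenvectors[OF herm, of UNIV] by metis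
  then have u: "A *v u i = \<mu> i *\<^sub>R u i"
    and on: "cinner (u i) (u j) = (if i = j then 1 else 0)" for i j by auto
  define U :: "complex^'n^'n" where "U = (\<chi> j i. u i $ j)"
  have "(cadjoint U ** U) $ i $ j = mat 1 $ i $ j" for i j
  proof -
    have "(cadjoint U ** U) $ i $ j = cinner (u j) (u i)"
      by (simp add: U_def matrix_matrix_mult_def cinner_def mult.commute)
    then show ?thesis by (auto simp: on mat_def)
  qed
  then have 1: "cadjoint U ** U = mat 1" by (simp add: vec_eq_iff)
  then have 2: "U ** cadjoint U = mat 1" using matrix_left_right_inverse by blast
  have "(A ** U) $ j $ i = (U ** real_diag \<mu>) $ j $ i" for i j
  proof -
    have "(A ** U) $ j $ i = (A *v u i) $ j"
      by (simp add: U_def matrix_matrix_mult_def matrix_vector_mult_def)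
    then show ?thesis
      by (simp add: u real_diag_mult_nth U_def) (simp add: scaleR_conv_of_real mult.commute)
  qed
  then have "A ** U = U ** real_diag \<mu>" by (simp add: vec_eq_iff)
  then have "A = U ** real_diag \<mu> ** cadjoint U"
    using 2 by (metis matrix_mul_assoc matrix_mul_rid)
  moreover have "0 < \<mu> i" for i
  proof -
    have "u i \<noteq> 0" using on[of i i] by (auto simp: cinner_simps)
    then have "0 < Re (cinner (A *v u i) (u i))"
      using assms by (simp add: pos_def_def cinner_def)
    then show ?thesis using on[of i i] by (simp add: u cinner_simps)
  qed
  ultimately show ?thesis using that 1 2 by (auto simp: unitary_def)
qed

section \<open>Spectral powers\<close>

lemma real_diag_nth: "real_diag l $ i $ j = (if i = j then complex_of_real (l i) else 0)"
  by (simp add: real_diag_def)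

lemma cadjoint_mpow:
  fixes A :: "complex^'n^'n"
  assumes "pos_def A"
  shows "cadjoint (mpow A s) = mpow A s"
proof -
  obtain U and l :: "'n \<Rightarrow> real"
    where U: "unitary U" "\<And>i. 0 < l i" "A = U ** real_diag l ** cadjoint U"
    using pos_def_diagonalizable[OF assms] by blast
  show ?thesis unfolding mpow_eqI[where l = l, OF U] by (simp add: cadjoint_mult matrix_mul_assoc)
qed

lemma mpow_mult_minus:
  fixes A :: "complex^'n^'n"
  assumes "pos_def A"
  shows "mpow A s ** mpow A (- s) = mat 1"
proof -
  obtain U and l :: "'n \<Rightarrow> real"
    where U: "unitary U" "\<And>i. 0 < l i" "A = U ** real_diag l ** cadjoint U"
    using pos_def_diagonalizable[OF assms] by blast
  let ?D = "\<lambda>s. real_diag (\<lambda>i. l i powr s) :: complex^'n^'n"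
  have D: "?D s ** ?D (- s) = mat 1"
  proof -
    have "l i powr s * l i powr (- s) = 1" for i
      using U(2)[of i] by (simp flip: powr_add)
    then have "complex_of_real (l i powr s) * complex_of_real (l i powr (- s)) = 1" for i
      by (metis of_real_1 of_real_mult)
    then show ?thesis
      by (auto simp: vec_eq_iff mult_real_diag_nth mat_def real_diag_nth)
  qed
  have "mpow A s ** mpow A (- s) = U ** ?D s ** (cadjoint U ** U) ** ?D (- s) ** cadjoint U"
    unfolding mpow_eqI[where l = l, OF U] by (simp only: matrix_mul_assoc)
  also have "\<dots> = U ** (?D s ** ?D (- s)) ** cadjoint U"
    using U(1) by (simp add: unitary_def matrix_mul_assoc)
  finally show ?thesis using U(1) by (simp add: D unitary_def)
qed

primrec matrix_power :: "complex^'n^'n \<Rightarrow> nat \<Rightarrow> complex^'n^'n" where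
  "matrix_power A 0 = mat 1"
| "matrix_power A (Suc k) = A ** matrix_power A k"

lemma matrix_power_diagonalized:
  fixes A U :: "complex^'n^'n"
  assumes "unitary U" "A = U ** real_diag l ** cadjoint U"
  shows "matrix_power A k = U ** real_diag (\<lambda>i. l i ^ k) ** cadjoint U"
proof (induction k)
  case 0
  have "real_diag (\<lambda>i. 1) = (mat 1 :: complex^'n^'n)" by (simp add: vec_eq_iff real_diag_def mat_def)
  then show ?case using assms(1) by (simp add: unitary_def)
next
  case (Suc k)
  have D: "real_diag l ** real_diag (\<lambda>i. l i ^ k) = real_diag (\<lambda>i. l i ^ Suc k)"
    by (auto simp: vec_eq_iff mult_real_diag_nth real_diag_nth)
  have "matrix_power A (Suc k) =
      U ** real_diag l ** (cadjoint U ** U) ** real_diag (\<lambda>i. l i ^ k) ** cadjoint U"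
    unfolding matrix_power.simps Suc unfolding assms(2) by (simp only: matrix_mul_assoc)
  also have "\<dots> = U ** (real_diag l ** real_diag (\<lambda>i. l i ^ k)) ** cadjoint U"
    using assms(1) by (simp add: unitary_def matrix_mul_assoc)
  finally show ?case unfolding D .
qed

lemma conj_real_diag_nth:
  "(U ** real_diag l ** cadjoint U) $ i $ j =
    (\<Sum>k\<in>UNIV. U $ i $ k * complex_of_real (l k) * cnj (U $ j $ k))"
  by (subst matrix_matrix_mult_def) (simp add: real_diag_mult_nth)

text \<open>A spectral power is a pointwise limit of polynomials of the matrix: the \<open>N\<close>-th polynomial
  approximates \<open>t\<^sup>s\<close> uniformly on \<open>[1/(N+1), N+1]\<close>, and these intervals eventually contain the spectrum of
  any given positive definite matrix. Hence spectral powers of a measurable field are measurable.\<close>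

lemma powr_polynomial_approximation:
  obtains a :: "nat \<Rightarrow> nat \<Rightarrow> real" and d :: "nat \<Rightarrow> nat"
  where "\<And>t. 0 < t \<Longrightarrow> (\<lambda>N. \<Sum>k\<le>d N. a N k * t ^ k) \<longlonglongrightarrow> t powr s"
proof -
  have "\<exists>a n. \<forall>t\<in>{1 / real (Suc N)..real (Suc N)}. \<bar>t powr s - (\<Sum>k\<le>n. a k * t ^ k)\<bar> < 1 / real (Suc N)"
    for N
  proof -
    have pos: "t \<noteq> 0" if "t \<in> {1 / real (Suc N)..real (Suc N)}" for t
      using that by (auto simp: divide_le_eq)
    have cont: "continuous_on {1 / real (Suc N)..real (Suc N)} (\<lambda>t. t powr s)"
      using pos by (intro continuous_intros) auto
    obtain g where "real_polynomial_function g"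
      "\<And>t. t \<in> {1 / real (Suc N)..real (Suc N)} \<Longrightarrow> \<bar>t powr s - g t\<bar> < 1 / real (Suc N)"
      using Stone_Weierstrass_real_polynomial_function[OF compact_Icc cont, of "1 / real (Suc N)"] by auto
    then show ?thesis unfolding real_polynomial_function_iff_sum by blast
  qed
  then obtain a d where ad: "\<And>N t. t \<in> {1 / real (Suc N)..real (Suc N)} \<Longrightarrow>
      \<bar>t powr s - (\<Sum>k\<le>d N. a N k * t ^ k)\<bar> < 1 / real (Suc N)"
    by metis
  show ?thesis
  proof (rule that)
    fix t :: real assume t: "0 < t"
    obtain N0 :: nat where N0: "max t (1 / t) \<le> real N0" using real_arch_simple by blast
    have "eventually (\<lambda>N. \<bar>(\<Sum>k\<le>d N. a N k * t ^ k) - t powr s\<bar> \<le> 1 / real (Suc N)) sequentially"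
    proof (rule eventually_sequentiallyI[of N0])
      fix N assume "N0 \<le> N"
      then have N: "t \<le> real (Suc N)" "1 / t \<le> real (Suc N)" using N0 by auto
      then have "1 / real (Suc N) \<le> t" using t by (simp add: divide_le_eq mult.commute)
      with N(1) ad[of t N] show "\<bar>(\<Sum>k\<le>d N. a N k * t ^ k) - t powr s\<bar> \<le> 1 / real (Suc N)"
        by (simp add: abs_minus_commute)
    qed
    then have "(\<lambda>N. (\<Sum>k\<le>d N. a N k * t ^ k) - t powr s) \<longlonglongrightarrow> 0"
      unfolding real_norm_def[symmetric]
      by (rule Lim_null_comparison[OF _ LIMSEQ_Suc[OF lim_1_over_n[where 'a = real]]])
    then show "(\<lambda>N. \<Sum>k\<le>d N. a N k * t ^ k) \<longlonglongrightarrow> t powr s"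
      by (simp add: LIM_zero_iff)
  qed
qed

lemma mpow_polynomial_limit:
  obtains P :: "nat \<Rightarrow> complex^'n^'n \<Rightarrow> complex^'n^'n"
  where "\<And>N. P N \<in> borel_measurable borel"
    "\<And>A. pos_def A \<Longrightarrow> (\<lambda>N. P N A) \<longlonglongrightarrow> mpow A s"
proof -
  obtain a d where ad: "\<And>t. 0 < t \<Longrightarrow> (\<lambda>N. \<Sum>k\<le>d N. a N k * t ^ k) \<longlonglongrightarrow> t powr s"
    using powr_polynomial_approximation[of s] by blast
  define P :: "nat \<Rightarrow> complex^'n^'n \<Rightarrow> complex^'n^'n"
    where "P N A = (\<Sum>k\<le>d N. a N k *\<^sub>R matrix_power A k)" for N A
  have [measurable]: "(\<lambda>A. matrix_power A k) \<in> borel_measurable (borel :: (complex^'n^'n) measure)" for k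
    by (induction k) simp_all
  have "P N \<in> borel_measurable borel" for N unfolding P_def by measurable
  moreover have "(\<lambda>N. P N A) \<longlonglongrightarrow> mpow A s" if A: "pos_def A" for A
  proof -
    obtain U and l :: "'n \<Rightarrow> real" where U: "unitary U" "\<And>i. 0 < l i" "A = U ** real_diag l ** cadjoint U"
      using pos_def_diagonalizable[OF A] by blast
    have "P N A $ i $ j =
        (\<Sum>m\<in>UNIV. U $ i $ m * complex_of_real (\<Sum>k\<le>d N. a N k * l m ^ k) * cnj (U $ j $ m))" for N i j
      unfolding P_def matrix_power_diagonalized[OF U(1,3)]
      by (simp add: conj_real_diag_nth scaleR_sum_right)
        (subst sum.swap, simp add: scaleR_conv_of_real sum_distrib_left sum_distrib_right mult_ac)
    moreover have "(\<lambda>N. \<Sum>m\<in>UNIV. U $ i $ m * complex_of_real (\<Sum>k\<le>d N. a N k * l m ^ k) * cnj (U $ j $ m))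
        \<longlonglongrightarrow> mpow A s $ i $ j" for i j
      unfolding mpow_eqI[where l = l, OF U] conj_real_diag_nth by (intro tendsto_intros ad U(2))
    ultimately show ?thesis by (intro vec_tendstoI) simp
  qed
  ultimately show ?thesis using that by blast
qed

lemma borel_measurable_lebesgue_cong_AE:
  fixes f g :: "'a::euclidean_space \<Rightarrow> 'b::topological_space"
  assumes g: "g \<in> borel_measurable lebesgue" and eq: "AE x in lebesgue. f x = g x"
  shows "f \<in> borel_measurable lebesgue"
proof (rule measurableI)
  fix S :: "'b set" assume "S \<in> sets borel"
  then have gS: "g -` S \<in> sets lebesgue" using measurable_sets[OF g] by simp
  have "AE x in lebesgue. x \<in> g -` S \<longleftrightarrow> x \<in> f -` S"
    using eq by eventually_elim simp
  then have "f -` S \<in> sets lebesgue"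
    by (rule completion.in_sets_AE) (simp_all add: gS)
  then show "f -` S \<inter> space lebesgue \<in> sets lebesgue" by simp
qed simp

lemma borel_measurable_mpow:
  fixes W :: "'a::euclidean_space \<Rightarrow> complex^'n^'n"
  assumes W: "W \<in> borel_measurable lebesgue" and pos: "AE x in lebesgue. pos_def (W x)"
  shows "(\<lambda>x. mpow (W x) s) \<in> borel_measurable lebesgue"
proof -
  obtain P :: "nat \<Rightarrow> complex^'n^'n \<Rightarrow> complex^'n^'n"
    where P: "\<And>N. P N \<in> borel_measurable borel"
      "\<And>A. pos_def A \<Longrightarrow> (\<lambda>N. P N A) \<longlonglongrightarrow> mpow A s"
    using mpow_polynomial_limit[of s] by blast
  obtain N where N: "{x. \<not> pos_def (W x)} \<subseteq> N" "N \<in> null_sets lebesgue"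
    using pos by (auto elim!: AE_E simp: null_sets_def)
  have "(\<lambda>x. if x \<in> N then 0 else mpow (W x) s) \<in> borel_measurable lebesgue"
  proof (rule borel_measurable_LIMSEQ_metric)
    show "(\<lambda>x. if x \<in> N then 0 else P k (W x)) \<in> borel_measurable lebesgue" for k
      using measurable_compose[OF W P(1)] N(2) by (intro measurable_If_set) auto
    show "(\<lambda>k. if x \<in> N then 0 else P k (W x)) \<longlonglongrightarrow> (if x \<in> N then 0 else mpow (W x) s)" for x
      using P(2) N(1) by auto
  qed
  moreover have "AE x in lebesgue. mpow (W x) s = (if x \<in> N then 0 else mpow (W x) s)"
    using AE_not_in[OF N(2)] by eventually_elim auto
  ultimately show ?thesis
    by (rule borel_measurable_lebesgue_cong_AE)
qed

section \<open>The Calderon--Zygmund decomposition\<close>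

text \<open>Half-open cubes have genuinely disjoint dyadic subcubes and differ from closed ones by null
  sets only.\<close>

definition half_cube :: "real^'d \<Rightarrow> real \<Rightarrow> (real^'d) set" where
  "half_cube a l = {x. \<forall>i. a $ i \<le> x $ i \<and> x $ i < a $ i + l}"

definition half_cubes :: "(real^'d) set set" where
  "half_cubes = {half_cube a l | a l. 0 < l}"

lemma half_cube_between:
  "box a (a + (\<chi> i. l)) \<subseteq> half_cube a l" "half_cube a l \<subseteq> cbox a (a + (\<chi> i. l))"
  by (auto simp: half_cube_def mem_box_cart less_imp_le)

lemma AE_half_cube_iff: "AE x in lebesgue. x \<in> half_cube a l \<longleftrightarrow> x \<in> cbox a (a + (\<chi> i. l))"
proof -
  have "cbox a (a + (\<chi> i. l)) - box a (a + (\<chi> i. l)) \<in> null_sets lebesgue"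
    using negligible_frontier_interval negligible_iff_null_sets by blast
  from AE_not_in[OF this] show ?thesis
    by eventually_elim (use half_cube_between[of a l] in blast)
qed

lemma half_cube_sets [measurable]: "half_cube a l \<in> sets lebesgue"
proof (rule completion.in_sets_AE)
  show "AE x in lebesgue. x \<in> cbox a (a + (\<chi> i. l)) \<longleftrightarrow> x \<in> half_cube a l"
    using AE_half_cube_iff[of a l] by eventually_elim simp
qed auto

lemma emeasure_half_cube:
  fixes a :: "real^'d"
  assumes "0 < l"
  shows "emeasure lebesgue (half_cube a l) = ennreal (l ^ CARD('d))"
proof -
  have "emeasure lebesgue (half_cube a l) = emeasure lebesgue (cbox a (a + (\<chi> i. l)))"
    using AE_half_cube_iff by (rule emeasure_eq_AE) auto
  also have "\<dots> = ennreal (measure lborel (cbox a (a + (\<chi> i. l))))"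
  proof -
    have "emeasure lborel (cbox a (a + (\<chi> i. l))) \<noteq> top"
      using emeasure_lborel_cbox_finite by (metis infinity_ennreal_def less_irrefl)
    then show ?thesis by (simp add: emeasure_eq_ennreal_measure)
  qed
  also have "measure lborel (cbox a (a + (\<chi> i. l))) = l ^ CARD('d)"
    using assms content_cbox_cart[of a "a + (\<chi> i. l)"]
    by (simp add: interval_eq_empty_cart not_less)
  finally show ?thesis .
qed

text \<open>Every summation over a family of stopping cubes below is an instance of this comparison, which
  hides the countable sum.\<close>

lemma set_nn_integral_Union_mono:
  assumes S: "countable S" "disjoint S" "S \<subseteq> sets M"
    and [measurable]: "f \<in> borel_measurable M" "g \<in> borel_measurable M"
    and le: "\<And>I. I \<in> S \<Longrightarrow> (\<integral>\<^sup>+x\<in>I. f x \<partial>M) \<le> (\<integral>\<^sup>+x\<in>I. g x \<partial>M)"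
  shows "(\<integral>\<^sup>+x\<in>\<Union>S. f x \<partial>M) \<le> (\<integral>\<^sup>+x\<in>\<Union>S. g x \<partial>M)"
proof -
  have U: "\<Union>S \<in> sets M" using S by (simp add: sets.countable_Union)
  have eq: "(\<integral>\<^sup>+x\<in>\<Union>S. h x \<partial>M) = (\<integral>\<^sup>+I. (\<integral>\<^sup>+x\<in>I. h x \<partial>M) \<partial>count_space S)"
    if [measurable]: "h \<in> borel_measurable M" for h
  proof -
    have "(\<integral>\<^sup>+x\<in>\<Union>S. h x \<partial>M) = emeasure (density M h) (\<Union>S)"
      by (subst emeasure_density) (use U in auto)
    also have "\<dots> = emeasure (density M h) (\<Union>((\<lambda>I. I) ` S))" by simp
    also have "\<dots> = (\<integral>\<^sup>+I. emeasure (density M h) I \<partial>count_space S)"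
      by (rule emeasure_UN_countable)
        (use S in \<open>auto simp: disjoint_family_on_def disjoint_def\<close>)
    also have "\<dots> = (\<integral>\<^sup>+I. (\<integral>\<^sup>+x\<in>I. h x \<partial>M) \<partial>count_space S)"
      by (intro nn_integral_cong emeasure_density) (use S in auto)
    finally show ?thesis .
  qed
  show ?thesis
    unfolding eq[OF assms(4)] eq[OF assms(5)] by (rule nn_integral_mono) (simp add: le)
qed

text \<open>The dyadic grid of a cube with corner \<open>a\<close> and side \<open>l\<close>: two points lie in the same cell of
  generation \<open>k\<close> when they have the same integer address. Nesting of the grids is then the
  statement that an address determines all earlier ones.\<close>

definition address :: "real^'d \<Rightarrow> real \<Rightarrow> nat \<Rightarrow> real^'d \<Rightarrow> 'd \<Rightarrow> int" where
  "address a l k x = (\<lambda>i. \<lfloor>2 ^ k * (x $ i - a $ i) / l\<rfloor>)"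

definition cell :: "real^'d \<Rightarrow> real \<Rightarrow> nat \<Rightarrow> real^'d \<Rightarrow> (real^'d) set" where
  "cell a l k x = {y. address a l k y = address a l k x}"

lemma mem_cell_self [simp]: "x \<in> cell a l k x"
  by (simp add: cell_def)

lemma cell_eq: "y \<in> cell a l k x \<Longrightarrow> cell a l k y = cell a l k x"
  by (auto simp: cell_def)

lemma address_Suc: "address a l k x i = address a l (Suc k) x i div 2"
proof -
  have "2 ^ k * (x $ i - a $ i) / l = (2 ^ Suc k * (x $ i - a $ i) / l) / real_of_int 2" by simp
  then show ?thesis unfolding address_def by (metis floor_divide_real_eq_div zero_le_numeral)
qed

lemma cell_Suc_subset: "cell a l (Suc k) x \<subseteq> cell a l k x"
  by (auto simp: cell_def fun_eq_iff address_Suc[of a l k])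

lemma cell_antimono: "j \<le> k \<Longrightarrow> cell a l k x \<subseteq> cell a l j x"
  by (rule lift_Suc_antimono_le[where f = "\<lambda>k. cell a l k x"]) (rule cell_Suc_subset)

lemma cell_eq_half_cube:
  assumes "0 < l"
  shows "cell a l k x = half_cube (\<chi> i. a $ i + l / 2 ^ k * address a l k x i) (l / 2 ^ k)"
proof -
  have "address a l k y i = z \<longleftrightarrow> a $ i + l / 2 ^ k * z \<le> y $ i \<and> y $ i < a $ i + l / 2 ^ k * z + l / 2 ^ k"
    for y i z
    using assms by (simp add: address_def floor_eq_iff field_simps)
  then show ?thesis by (auto simp: cell_def half_cube_def fun_eq_iff)
qed

lemma cell_0:
  assumes "0 < l" "x \<in> half_cube a l"
  shows "cell a l 0 x = half_cube a l"
proof -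
  have "address a l 0 x = (\<lambda>i. 0)"
    using assms by (auto simp: address_def half_cube_def floor_eq_iff field_simps)
  then show ?thesis using cell_eq_half_cube[OF assms(1), of a 0 x] by simp
qed

lemma emeasure_cell:
  fixes a :: "real^'d"
  assumes "0 < l"
  shows "emeasure lebesgue (cell a l k x) = ennreal ((l / 2 ^ k) ^ CARD('d))"
  unfolding cell_eq_half_cube[OF assms] by (rule emeasure_half_cube) (simp add: assms)

lemma cell_subset_open:
  fixes a :: "real^'d"
  assumes l: "0 < l" and U: "open U" "x \<in> U"
  shows "\<exists>k. cell a l k x \<subseteq> U"
proof -
  obtain e where e: "0 < e" "ball x e \<subseteq> U" using U openE by blast
  obtain k :: nat where "real CARD('d) * l / e < 2 ^ k"
    using real_arch_pow[of 2] by auto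
  then have k: "real CARD('d) * (l / 2 ^ k) < e" using e by (simp add: field_simps)
  have "y \<in> ball x e" if "y \<in> cell a l k x" for y
  proof -
    have "\<bar>(x - y) $ i\<bar> \<le> l / 2 ^ k" for i
    proof -
      have "y \<in> cell a l k x" "x \<in> cell a l k x" using that by simp_all
      then show ?thesis unfolding cell_eq_half_cube[OF l] half_cube_def
        by (auto simp: abs_le_iff dest!: spec[of _ i])
    qed
    then have "(\<Sum>i\<in>UNIV. \<bar>(x - y) $ i\<bar>) \<le> of_nat CARD('d) * (l / 2 ^ k)"
      by (intro sum_bounded_above) auto
    with k norm_le_l1_cart[of "x - y"] show ?thesis by (simp add: dist_norm)
  qed
  then show ?thesis using e(2) by blast
qed

text \<open>Choosing for every point the first generation whose cell has a given property yields disjoint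
  cells, because the cells are nested.\<close>

lemma first_cells:
  fixes a :: "real^'d" and P :: "(real^'d) set \<Rightarrow> bool"
  assumes l: "0 < l" and ex: "\<And>x. x \<in> Z \<Longrightarrow> \<exists>k. P (cell a l k x)"
  defines "n \<equiv> \<lambda>x. LEAST k. P (cell a l k x)"
  defines "S \<equiv> (\<lambda>x. cell a l (n x) x) ` Z"
  shows "countable S" "disjoint S" "S \<subseteq> half_cubes" "Z \<subseteq> \<Union>S"
proof -
  have "S \<subseteq> range (\<lambda>(k, z :: 'd \<Rightarrow> int). {y. address a l k y = z})"
    by (auto simp: S_def cell_def)
  then show "countable S" by (rule countable_subset) simp
  show "Z \<subseteq> \<Union>S" by (auto simp: S_def)
  show "S \<subseteq> half_cubes"
    using l by (auto simp: S_def half_cubes_def cell_eq_half_cube intro!: exI)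
  have *: "cell a l (n y) y = cell a l (n x) x"
    if "x \<in> Z" "y \<in> Z" "z \<in> cell a l (n x) x" "z \<in> cell a l (n y) y" "n x \<le> n y" for x y z
  proof -
    have "z \<in> cell a l (n x) y" using that cell_antimono by blast
    then have eq: "cell a l (n x) y = cell a l (n x) x" using that(3) cell_eq by metis
    moreover have "P (cell a l (n x) x)" unfolding n_def by (rule LeastI_ex) (rule ex[OF that(1)])
    ultimately have "n y \<le> n x" unfolding n_def by (simp add: Least_le)
    with that(5) eq show ?thesis by simp
  qed
  show "disjoint S"
  proof (rule disjointI)
    fix A B assume "A \<in> S" "B \<in> S" "A \<noteq> B"
    then obtain x y where xy: "x \<in> Z" "y \<in> Z" "A = cell a l (n x) x" "B = cell a l (n y) y"
      by (auto simp: S_def)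
    show "A \<inter> B = {}"
    proof (rule ccontr)
      assume "A \<inter> B \<noteq> {}"
      then obtain z where z: "z \<in> A" "z \<in> B" by blast
      show False
      proof (cases "n x \<le> n y")
        case True
        with *[of x y z] xy z \<open>A \<noteq> B\<close> show False by simp
      next
        case False
        with *[of y x z] xy z \<open>A \<noteq> B\<close> show False by simp
      qed
    qed
  qed
qed

text \<open>The stopping cubes are the maximal dyadic subcubes on which the average of \<open>f\<close> exceeds \<open>2 c\<close>.
  Since \<open>2 c\<close> times their total measure is at most the integral of \<open>f\<close>, they fill at most half
  of \<open>J\<close>; the parent of a stopping cube was not selected, which costs the factor \<open>2\<^sup>d\<close> in the upper
  bound for the averages. The bound off the stopping cubes comes from outer regularity of Lebesgue
  measure instead of the differentiation theorem.\<close>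

theorem calderon_zygmund:
  fixes J :: "(real^'d) set" and f :: "real^'d \<Rightarrow> ennreal"
  assumes J: "J \<in> half_cubes" and f [measurable]: "f \<in> borel_measurable lebesgue"
    and c: "0 < c" and avg: "(\<integral>\<^sup>+x\<in>J. f x \<partial>lebesgue) \<le> ennreal c * emeasure lebesgue J"
  obtains S where "countable S" "disjoint S" "S \<subseteq> half_cubes"
    "\<And>I. I \<in> S \<Longrightarrow> I \<subseteq> J"
    "\<And>I. I \<in> S \<Longrightarrow> (\<integral>\<^sup>+x\<in>I. f x \<partial>lebesgue) \<le> ennreal (2 ^ CARD('d) * (2 * c)) * emeasure lebesgue I"
    "2 * emeasure lebesgue (\<Union>S) \<le> emeasure lebesgue J"
    "AE x in lebesgue. x \<in> J - \<Union>S \<longrightarrow> f x \<le> ennreal (2 * c)"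
proof -
  obtain a l where l: "0 < l" and J_eq: "J = half_cube a l" using J by (auto simp: half_cubes_def)
  have J_fin: "emeasure lebesgue J < \<infinity>" unfolding J_eq emeasure_half_cube[OF l] by simp
  have sets_hc: "I \<in> sets lebesgue" if "I \<in> half_cubes" for I :: "(real^'d) set"
    using that by (auto simp: half_cubes_def)
  have J_sets [measurable]: "J \<in> sets lebesgue" by (rule sets_hc[OF J])
  let ?lam = "ennreal (2 * c)"
  define heavy where "heavy I \<longleftrightarrow> ?lam * emeasure lebesgue I < (\<integral>\<^sup>+x\<in>I. f x \<partial>lebesgue)"
    for I :: "(real^'d) set"
  define E where "E = {x \<in> J. \<exists>k. heavy (cell a l k x)}"
  define n where "n x = (LEAST k. heavy (cell a l k x))" for x
  define S where "S = (\<lambda>x. cell a l (n x) x) ` E"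
  have "\<exists>k. heavy (cell a l k x)" if "x \<in> E" for x using that by (simp add: E_def)
  note S = first_cells[OF l this, of E, folded n_def, folded S_def, simplified]
  have J_light: "\<not> heavy J"
  proof -
    have "ennreal c * emeasure lebesgue J \<le> ?lam * emeasure lebesgue J"
      by (intro mult_right_mono ennreal_leI) (use c in auto)
    then show ?thesis unfolding heavy_def not_less by (rule order_trans[OF avg])
  qed
  have cell_J: "cell a l k x \<subseteq> J" if "x \<in> J" for k x
    using cell_antimono[of 0 k a l x] cell_0[OF l, of x a] that by (simp add: J_eq)
  have S_J: "I \<subseteq> J" if "I \<in> S" for I
    using that cell_J by (auto simp: S_def E_def)
  have heavy_S: "heavy I" if I: "I \<in> S" for I
  proof -
    obtain x where x: "x \<in> E" "I = cell a l (n x) x" using I by (auto simp: S_def)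
    then show ?thesis unfolding n_def using LeastI_ex[of "\<lambda>k. heavy (cell a l k x)"] by (auto simp: E_def)
  qed
  have S_sets: "S \<subseteq> sets lebesgue" using S(3) sets_hc by blast
  have US: "\<Union>S \<in> sets lebesgue" using S(1) S_sets by (simp add: sets.countable_Union)
  have S_avg: "(\<integral>\<^sup>+x\<in>I. f x \<partial>lebesgue) \<le> ennreal (2 ^ CARD('d) * (2 * c)) * emeasure lebesgue I" if I: "I \<in> S" for I
  proof -
    obtain x where x: "x \<in> E" "I = cell a l (n x) x" using I by (auto simp: S_def)
    have "n x \<noteq> 0"
    proof
      assume "n x = 0"
      then have "I = J" using x cell_0[OF l, of x a] by (simp add: E_def J_eq)
      with heavy_S[OF I] J_light show False by simp
    qed
    then obtain m where m: "n x = Suc m" using not0_implies_Suc by blast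
    then have "\<not> heavy (cell a l m x)" 
      using not_less_Least[of m "\<lambda>k. heavy (cell a l k x)"] n_def[of x] by simp
    then have "(\<integral>\<^sup>+x\<in>cell a l m x. f x \<partial>lebesgue) \<le> ?lam * emeasure lebesgue (cell a l m x)"
      by (simp add: heavy_def not_less)
    moreover have "(\<integral>\<^sup>+x\<in>I. f x \<partial>lebesgue) \<le> (\<integral>\<^sup>+x\<in>cell a l m x. f x \<partial>lebesgue)"
      by (intro nn_integral_mono mult_left_mono)
        (use cell_Suc_subset[of a l m x] in \<open>auto simp: x m split: split_indicator\<close>)
    moreover have "?lam * emeasure lebesgue (cell a l m x) = ennreal (2 ^ CARD('d) * (2 * c)) * emeasure lebesgue I"
      unfolding x m emeasure_cell[OF l] using l c
      by (simp add: power_divide power_mult_distrib flip: ennreal_mult) 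
    ultimately show ?thesis by simp
  qed
  have half: "2 * emeasure lebesgue (\<Union>S) \<le> emeasure lebesgue J"
  proof -
    have "?lam * emeasure lebesgue (\<Union>S) = (\<integral>\<^sup>+x\<in>\<Union>S. ?lam \<partial>lebesgue)"
      by (rule nn_integral_cmult_indicator[symmetric]) (rule US)
    also have "\<dots> \<le> (\<integral>\<^sup>+x\<in>\<Union>S. f x \<partial>lebesgue)"
    proof (rule set_nn_integral_Union_mono[OF S(1,2) S_sets])
      fix I assume I: "I \<in> S"
      then have "(\<integral>\<^sup>+x\<in>I. ?lam \<partial>lebesgue) = ?lam * emeasure lebesgue I"
        using S_sets by (intro nn_integral_cmult_indicator) auto
      also have "\<dots> \<le> (\<integral>\<^sup>+x\<in>I. f x \<partial>lebesgue)" using heavy_S[OF I] by (simp add: heavy_def)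
      finally show "(\<integral>\<^sup>+x\<in>I. ?lam \<partial>lebesgue) \<le> (\<integral>\<^sup>+x\<in>I. f x \<partial>lebesgue)" .
    qed auto
    also have "\<dots> \<le> (\<integral>\<^sup>+x\<in>J. f x \<partial>lebesgue)"
      by (intro nn_integral_mono mult_left_mono) (use S_J in \<open>auto split: split_indicator\<close>)
    also note avg
    finally have "ennreal (1 / c) * (?lam * emeasure lebesgue (\<Union>S)) \<le> ennreal (1 / c) * (ennreal c * emeasure lebesgue J)"
      by (rule mult_left_mono) simp
    moreover have "ennreal (1 / c) * ?lam = 2" "ennreal (1 / c) * ennreal c = 1"
      using c by (simp_all flip: ennreal_mult)
    ultimately show ?thesis by (simp flip: mult.assoc)
  qed
  define Z where "Z = {x \<in> J - \<Union>S. ?lam < f x}"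
  have Z [measurable]: "Z \<in> sets lebesgue"
  proof -
    have "{x \<in> space lebesgue. ?lam < f x} \<in> sets lebesgue" by measurable
    then have "(J - \<Union>S) \<inter> {x. ?lam < f x} \<in> sets lebesgue" using US by auto
    moreover have "(J - \<Union>S) \<inter> {x. ?lam < f x} = Z" by (auto simp: Z_def)
    ultimately show ?thesis by simp
  qed
  have Z_fin: "emeasure lebesgue Z < \<infinity>"
    using emeasure_mono[of Z J lebesgue] J_fin by (auto simp: Z_def intro: le_less_trans)
  have light: "\<not> heavy (cell a l k x)" if "x \<in> Z" for k x
    using that S(4) by (auto simp: Z_def E_def)
  \<comment> \<open>No cell around a point of \<open>Z\<close> is heavy, so covering \<open>Z\<close> by such cells inside an open set
    that is barely larger shows that \<open>f\<close> is at most \<open>2 * c\<close> on average over \<open>Z\<close>.\<close>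
  have cover: "(\<integral>\<^sup>+x\<in>Z. f x \<partial>lebesgue) \<le> ?lam * emeasure lebesgue U" if U: "open U" "Z \<subseteq> U" for U
  proof -
    define T where "T = (\<lambda>x. cell a l (LEAST k. cell a l k x \<subseteq> U) x) ` Z"
    have ex: "\<exists>k. cell a l k x \<subseteq> U" if "x \<in> Z" for x
      using cell_subset_open[OF l U(1)] that U(2) by blast
    note T = first_cells[where P = "\<lambda>I. I \<subseteq> U", OF l ex, of Z, folded T_def, simplified]
    have T_sets: "T \<subseteq> sets lebesgue" using T(3) sets_hc by blast
    have "\<Union>T \<subseteq> U" using LeastI_ex[OF ex] by (auto simp: T_def)
    have UT: "\<Union>T \<in> sets lebesgue" using T(1) T_sets by (simp add: sets.countable_Union)
    have "(\<integral>\<^sup>+x\<in>Z. f x \<partial>lebesgue) \<le> (\<integral>\<^sup>+x\<in>\<Union>T. f x \<partial>lebesgue)"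
      by (intro nn_integral_mono mult_left_mono) (use T(4) in \<open>auto split: split_indicator\<close>)
    also have "\<dots> \<le> (\<integral>\<^sup>+x\<in>\<Union>T. ?lam \<partial>lebesgue)"
    proof (rule set_nn_integral_Union_mono[OF T(1,2) T_sets])
      fix I assume I: "I \<in> T"
      have "(\<integral>\<^sup>+x\<in>I. f x \<partial>lebesgue) \<le> ?lam * emeasure lebesgue I"
        using I light by (auto simp: T_def heavy_def not_less)
      also have "\<dots> = (\<integral>\<^sup>+x\<in>I. ?lam \<partial>lebesgue)"
        using T_sets I by (intro nn_integral_cmult_indicator[symmetric]) auto
      finally show "(\<integral>\<^sup>+x\<in>I. f x \<partial>lebesgue) \<le> (\<integral>\<^sup>+x\<in>I. ?lam \<partial>lebesgue)" .
    qed auto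
    also have "\<dots> = ?lam * emeasure lebesgue (\<Union>T)"
      by (rule nn_integral_cmult_indicator) (rule UT)
    also have "\<dots> \<le> ?lam * emeasure lebesgue U"
      using \<open>\<Union>T \<subseteq> U\<close> U(1) by (intro mult_left_mono emeasure_mono) auto
    finally show ?thesis .
  qed
  have "(\<integral>\<^sup>+x\<in>Z. f x \<partial>lebesgue) \<le> ?lam * emeasure lebesgue Z"
  proof (rule ennreal_le_epsilon)
    fix e :: real assume e: "0 < e"
    then have e': "0 < e / (2 * c)" using c by simp
    obtain U where U: "open U" "Z \<subseteq> U" "emeasure lebesgue (U - Z) < ennreal (e / (2 * c))"
      using sets_lebesgue_outer_open[OF Z e'] by blast
    have "emeasure lebesgue U = emeasure lebesgue (Z \<union> (U - Z))"
      using U(2) by (simp add: Un_absorb1)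
    also have "\<dots> \<le> emeasure lebesgue Z + emeasure lebesgue (U - Z)"
      using U(1) by (intro emeasure_subadditive) auto
    also have "\<dots> \<le> emeasure lebesgue Z + ennreal (e / (2 * c))"
      using U(3) by (intro add_left_mono) simp
    finally have "?lam * emeasure lebesgue U \<le> ?lam * (emeasure lebesgue Z + ennreal (e / (2 * c)))"
      by (rule mult_left_mono) simp
    also have "\<dots> = ?lam * emeasure lebesgue Z + ennreal e"
      using c e by (simp add: distrib_left flip: ennreal_mult)
    finally show "(\<integral>\<^sup>+x\<in>Z. f x \<partial>lebesgue) \<le> ?lam * emeasure lebesgue Z + ennreal e"
      using cover[OF U(1,2)] by (rule order_trans[rotated])
  qed
  moreover have "(\<integral>\<^sup>+x\<in>Z. f x \<partial>lebesgue) = ?lam * emeasure lebesgue Z + (\<integral>\<^sup>+x\<in>Z. (f x - ?lam) \<partial>lebesgue)"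
  proof -
    have "(\<integral>\<^sup>+x\<in>Z. f x \<partial>lebesgue) = (\<integral>\<^sup>+x. ?lam * indicator Z x + (f x - ?lam) * indicator Z x \<partial>lebesgue)"
      by (intro nn_integral_cong)
        (auto simp: Z_def add.commute[of ?lam] diff_add_cancel_ennreal split: split_indicator)
    also have "\<dots> = (\<integral>\<^sup>+x\<in>Z. ?lam \<partial>lebesgue) + (\<integral>\<^sup>+x\<in>Z. (f x - ?lam) \<partial>lebesgue)"
      by (rule nn_integral_add) auto
    finally show ?thesis by (simp add: nn_integral_cmult_indicator)
  qed
  moreover have "?lam * emeasure lebesgue Z < \<infinity>" using Z_fin by (simp add: ennreal_mult_less_top)
  ultimately have "(\<integral>\<^sup>+x\<in>Z. (f x - ?lam) \<partial>lebesgue) = 0"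
    using ennreal_add_left_cancel_le[of "?lam * emeasure lebesgue Z" _ 0]
    by (auto simp del: emeasure_completion)
  then have "AE x in lebesgue. (f x - ?lam) * indicator Z x = 0"
    by (subst (asm) nn_integral_0_iff_AE) auto
  then have "AE x in lebesgue. x \<in> J - \<Union>S \<longrightarrow> f x \<le> ?lam"
    by eventually_elim (auto simp: Z_def indicator_def diff_eq_0_iff_ennreal split: if_splits)
  then show ?thesis using that S S_J S_avg half by blast
qed

section \<open>Power inequalities\<close>

text \<open>Convexity of the power with weights \<open>1 - s\<close> and \<open>s\<close>. As \<open>s\<close> tends to \<open>1\<close> the factor of the second
  summand tends to \<open>1\<close>, so that an iteration can absorb it; the triangle inequality with the
  factor \<open>2\<^sup>p\<^sup>-\<^sup>1\<close> would not do.\<close>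

lemma powr_add_le:
  fixes a b p s :: real
  assumes "0 \<le> a" "0 \<le> b" "1 \<le> p" "0 < s" "s < 1"
  shows "(a + b) powr p \<le> (1 - s) powr (1 - p) * a powr p + s powr (1 - p) * b powr p"
proof -
  have ge1: "t powr p \<le> r powr (1 - p) * t powr p" if "0 < r" "r < 1" for r t :: real
  proof -
    have "r powr 0 \<le> r powr (1 - p)"
      using that assms by (intro powr_mono') auto
    then show ?thesis using that by (simp add: mult_le_cancel_right1)
  qed
  consider "a = 0" | "b = 0" | "0 < a" "0 < b" using assms by linarith
  then show ?thesis
  proof cases
    case 3
    have resc: "r * (t / r) powr p = r powr (1 - p) * t powr p" if "0 < r" "0 < t" for r t :: real
      using that by (simp add: powr_divide powr_diff)
    have "((1 - s) *\<^sub>R (a / (1 - s)) + s *\<^sub>R (b / s)) powr p \<le>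
        (1 - s) * (a / (1 - s)) powr p + s * (b / s) powr p"
      using assms 3 by (intro convex_onD[OF powr_convex]) auto
    then show ?thesis using assms 3 by (simp add: resc)
  qed (use ge1[of s b] ge1[of "1 - s" a] assms in \<open>auto intro: order_trans\<close>)
qed

lemma young_powr:
  fixes a b p q :: real
  assumes "0 \<le> a" "0 \<le> b" "1 < p" "1 < q" "1 / p + 1 / q = 1"
  shows "a * b \<le> a powr p / p + b powr q / q"
proof (cases "a = 0 \<or> b = 0")
  case True
  then show ?thesis using assms by auto
next
  case False
  then have pos: "0 < a" "0 < b" using assms by auto
  have q: "1 - 1 / p = 1 / q" using assms(5) by simp
  have "exp ((1 - 1 / p) *\<^sub>R (q * ln b) + (1 / p) *\<^sub>R (p * ln a)) \<le>
      (1 - 1 / p) * exp (q * ln b) + (1 / p) * exp (p * ln a)"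
    using assms by (intro convex_onD[OF exp_convex]) auto
  moreover have "exp ((1 - 1 / p) *\<^sub>R (q * ln b) + (1 / p) *\<^sub>R (p * ln a)) = a * b"
    using assms pos by (simp add: q exp_add)
  ultimately show ?thesis
    using assms pos by (simp add: powr_def q add.commute)
qed

text \<open>The integrals are bounded by real numbers \<open>X\<close> and \<open>Y\<close>, so that roots are taken of reals only. If
  both are positive, Young's inequality is applied to the functions normalized by them.\<close>

lemma set_nn_integral_Holder:
  fixes f g :: "'a \<Rightarrow> real"
  assumes [measurable]: "f \<in> borel_measurable M" "g \<in> borel_measurable M" "S \<in> sets M"
    and nn: "\<And>x. 0 \<le> f x" "\<And>x. 0 \<le> g x"
    and pq: "1 < p" "1 < q" "1 / p + 1 / q = 1"
    and X: "0 \<le> X" "(\<integral>\<^sup>+x\<in>S. ennreal (f x powr p) \<partial>M) \<le> ennreal X"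
    and Y: "0 \<le> Y" "(\<integral>\<^sup>+x\<in>S. ennreal (g x powr q) \<partial>M) \<le> ennreal Y"
  shows "(\<integral>\<^sup>+x\<in>S. ennreal (f x * g x) \<partial>M) \<le> ennreal (X powr (1 / p) * Y powr (1 / q))"
proof (cases "X = 0 \<or> Y = 0")
  case True
  have zero: "AE x in M. x \<in> S \<longrightarrow> h x = 0"
    if "(\<integral>\<^sup>+x\<in>S. ennreal (h x powr r) \<partial>M) \<le> ennreal 0" "\<And>x. 0 \<le> h x"
      and [measurable]: "h \<in> borel_measurable M" for h :: "'a \<Rightarrow> real" and r
  proof -
    have "(\<integral>\<^sup>+x\<in>S. ennreal (h x powr r) \<partial>M) = 0" using that(1) by simp
    then have "AE x in M. ennreal (h x powr r) * indicator S x = 0"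
      by (subst (asm) nn_integral_0_iff_AE) auto
    then show ?thesis
      by eventually_elim (use that(2) in \<open>auto simp: indicator_def split: if_splits\<close>)
  qed
  have "AE x in M. x \<in> S \<longrightarrow> f x * g x = 0"
    using True
  proof
    assume "X = 0"
    then have "AE x in M. x \<in> S \<longrightarrow> f x = 0" using X(2) nn by (intro zero[of f p]) auto
    then show ?thesis by eventually_elim auto
  next
    assume "Y = 0"
    then have "AE x in M. x \<in> S \<longrightarrow> g x = 0" using Y(2) nn by (intro zero[of g q]) auto
    then show ?thesis by eventually_elim auto
  qed
  then have "AE x in M. ennreal (f x * g x) * indicator S x = 0"
    by eventually_elim (auto simp: indicator_def)
  then have "(\<integral>\<^sup>+x\<in>S. ennreal (f x * g x) \<partial>M) = 0"
    by (subst nn_integral_0_iff_AE) auto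
  then show ?thesis by simp
next
  case False
  then have pos: "0 < X" "0 < Y" using X Y by auto
  define H where "H = X powr (1 / p) * Y powr (1 / q)"
  have H: "0 < H" using pos by (simp add: H_def)
  have le: "f x * g x \<le> H / (p * X) * f x powr p + H / (q * Y) * g x powr q" for x
  proof -
    have "f x / X powr (1 / p) * (g x / Y powr (1 / q)) \<le>
        (f x / X powr (1 / p)) powr p / p + (g x / Y powr (1 / q)) powr q / q"
      using nn pq by (intro young_powr) auto
    also have "\<dots> = f x powr p / (p * X) + g x powr q / (q * Y)"
      using pos pq nn by (simp add: powr_divide powr_powr mult.commute)
    finally have "H * (f x / X powr (1 / p) * (g x / Y powr (1 / q))) \<le>
        H * (f x powr p / (p * X) + g x powr q / (q * Y))"
      using H by (intro mult_left_mono) auto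
    moreover have "H * (f x / X powr (1 / p) * (g x / Y powr (1 / q))) = f x * g x"
      using pos by (simp add: H_def)
    ultimately show ?thesis by (simp add: distrib_left mult_ac)
  qed
  have "(\<integral>\<^sup>+x\<in>S. ennreal (f x * g x) \<partial>M) \<le>
      (\<integral>\<^sup>+x. ennreal (H / (p * X)) * (ennreal (f x powr p) * indicator S x) +
         ennreal (H / (q * Y)) * (ennreal (g x powr q) * indicator S x) \<partial>M)"
  proof (rule nn_integral_mono)
    fix x
    have "ennreal (f x * g x) \<le> ennreal (H / (p * X)) * ennreal (f x powr p) +
        ennreal (H / (q * Y)) * ennreal (g x powr q)"
      using le[of x] H pq pos by (simp add: ennreal_leI flip: ennreal_mult ennreal_plus)
    then show "ennreal (f x * g x) * indicator S x \<le> ennreal (H / (p * X)) * (ennreal (f x powr p) * indicator S x) +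
         ennreal (H / (q * Y)) * (ennreal (g x powr q) * indicator S x)"
      by (auto split: split_indicator)
  qed
  also have "\<dots> = ennreal (H / (p * X)) * (\<integral>\<^sup>+x\<in>S. ennreal (f x powr p) \<partial>M) +
      ennreal (H / (q * Y)) * (\<integral>\<^sup>+x\<in>S. ennreal (g x powr q) \<partial>M)"
    by (subst nn_integral_add) (auto simp: nn_integral_cmult)
  also have "\<dots> \<le> ennreal (H / (p * X)) * ennreal X + ennreal (H / (q * Y)) * ennreal Y"
    by (intro add_mono mult_left_mono X Y) auto
  also have "\<dots> = ennreal (H / p + H / q)"
    using H pq pos by (simp flip: ennreal_mult ennreal_plus)
  also have "H / p + H / q = H * (1 / p + 1 / q)" by (simp add: distrib_left)
  finally show ?thesis unfolding pq(3) by (simp add: H_def)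
qed

lemma norm_matrix_powr_le_columns:
  fixes T :: "complex^'n^'n"
  assumes "1 \<le> p"
  shows "norm T powr p \<le> real CARD('n) powr p * (\<Sum>i\<in>UNIV. norm (T *v axis i 1) powr p)"
proof -
  obtain i where i: "\<And>j. norm (T *v axis j 1) \<le> norm (T *v axis i 1)"
  proof -
    have "finite (range (\<lambda>j. norm (T *v axis j 1)))" "range (\<lambda>j. norm (T *v axis j 1)) \<noteq> {}" by auto
    from Max_in[OF this] obtain i where "Max (range (\<lambda>j. norm (T *v axis j 1))) = norm (T *v axis i 1)"
      by (rule rangeE)
    with Max_ge[of "range (\<lambda>j. norm (T *v axis j 1))"]
    have "norm (T *v axis j 1) \<le> norm (T *v axis i 1)" for j by auto
    then show ?thesis using that by blast
  qed
  have "norm T \<le> (\<Sum>j\<in>UNIV. norm (T *v axis j 1))" by (rule norm_matrix_le_columns)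
  also have "\<dots> \<le> real CARD('n) * norm (T *v axis i 1)"
    using i by (intro sum_bounded_above) auto
  finally have "norm T powr p \<le> (real CARD('n) * norm (T *v axis i 1)) powr p"
    using assms by (intro powr_mono2) auto
  also have "\<dots> = real CARD('n) powr p * norm (T *v axis i 1) powr p" by (simp add: powr_mult)
  also have "\<dots> \<le> real CARD('n) powr p * (\<Sum>i\<in>UNIV. norm (T *v axis i 1) powr p)"
    by (intro mult_left_mono member_le_sum) auto
  finally show ?thesis .
qed

lemma set_nn_integral_matrix_le_columns:
  fixes T :: "'a \<Rightarrow> complex^'n^'n"
  assumes "1 \<le> p" and [measurable]: "T \<in> borel_measurable M" "S \<in> sets M"
    and le: "\<And>i. (\<integral>\<^sup>+x\<in>S. ennreal (norm (T x *v axis i 1) powr p) \<partial>M) \<le> ennreal X"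
    and X: "0 \<le> X"
  shows "(\<integral>\<^sup>+x\<in>S. ennreal (norm (T x) powr p) \<partial>M) \<le> ennreal (real CARD('n) powr p * real CARD('n) * X)"
proof -
  have "(\<integral>\<^sup>+x\<in>S. ennreal (norm (T x) powr p) \<partial>M) \<le>
      (\<integral>\<^sup>+x. ennreal (real CARD('n) powr p) *
        (\<Sum>i\<in>UNIV. ennreal (norm (T x *v axis i 1) powr p) * indicator S x) \<partial>M)"
  proof (rule nn_integral_mono)
    fix x
    have "ennreal (norm (T x) powr p) \<le>
        ennreal (real CARD('n) powr p) * (\<Sum>i\<in>UNIV. ennreal (norm (T x *v axis i 1) powr p))"
      using norm_matrix_powr_le_columns[OF assms(1), of "T x"]
      by (simp add: ennreal_leI sum_nonneg flip: ennreal_mult)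
    then show "ennreal (norm (T x) powr p) * indicator S x \<le> ennreal (real CARD('n) powr p) *
        (\<Sum>i\<in>UNIV. ennreal (norm (T x *v axis i 1) powr p) * indicator S x)"
      by (auto split: split_indicator)
  qed
  also have "\<dots> = ennreal (real CARD('n) powr p) *
      (\<Sum>i\<in>UNIV. (\<integral>\<^sup>+x\<in>S. ennreal (norm (T x *v axis i 1) powr p) \<partial>M))"
  proof -
    have "(\<integral>\<^sup>+x. (\<Sum>i\<in>UNIV. ennreal (norm (T x *v axis i 1) powr p) * indicator S x) \<partial>M) =
        (\<Sum>i\<in>UNIV. (\<integral>\<^sup>+x\<in>S. ennreal (norm (T x *v axis i 1) powr p) \<partial>M))"
      by (rule nn_integral_sum) measurable
    then show ?thesis by (subst nn_integral_cmult) simp_all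
  qed
  also have "\<dots> \<le> ennreal (real CARD('n) powr p) * (\<Sum>i\<in>(UNIV::'n set). ennreal X)"
    by (intro mult_left_mono sum_mono le) auto
  also have "\<dots> = ennreal (real CARD('n) powr p * real CARD('n) * X)"
    using X by (simp add: ennreal_of_nat_eq_real_of_nat mult.assoc flip: ennreal_mult)
  finally show ?thesis .
qed

section \<open>Averages\<close>

lemma half_cube_facts:
  fixes J :: "(real^'d) set"
  assumes "J \<in> half_cubes"
  shows "J \<in> sets lebesgue" "emeasure lebesgue J = ennreal (measure lebesgue J)" "0 < measure lebesgue J"
proof -
  obtain a l where l: "0 < l" "J = half_cube a l" using assms by (auto simp: half_cubes_def)
  then have e: "emeasure lebesgue J = ennreal (l ^ CARD('d))" by (simp only: emeasure_half_cube)
  then have m: "measure lebesgue J = l ^ CARD('d)" using l(1) by (simp only: measure_def) simp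
  show "J \<in> sets lebesgue" using l by simp
  show "emeasure lebesgue J = ennreal (measure lebesgue J)" "0 < measure lebesgue J"
    unfolding e m using l by simp_all
qed

text \<open>With \<open>L\<close> the conjugation by \<open>V J\<close> and \<open>C\<close> the average over a larger cube \<open>J\<close>, this bounds the jump
  between the averages over \<open>I\<close> and \<open>J\<close> by the oscillation over \<open>I\<close>.\<close>

lemma norm_mavg_le:
  fixes B :: "real^'d \<Rightarrow> complex^'n^'n" and L :: "complex^'n^'n \<Rightarrow> complex^'n^'n"
  assumes I: "I \<in> half_cubes" and B: "set_integrable lebesgue I B" and L: "bounded_linear L"
  shows "ennreal (norm (L (mavg I B - C)) * measure lebesgue I) \<le>
    (\<integral>\<^sup>+x\<in>I. ennreal (norm (L (B x - C))) \<partial>lebesgue)"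
proof -
  note I' = half_cube_facts[OF I]
  define G where "G x = indicator I x *\<^sub>R (B x - C)" for x
  have int1: "integrable lebesgue (\<lambda>x. indicator I x *\<^sub>R B x)"
    using B by (simp add: set_integrable_def)
  have int2: "integrable lebesgue (\<lambda>x. indicator I x *\<^sub>R C)"
    using I' by (intro integrable_indicator) (auto simp: less_top[symmetric] simp del: emeasure_completion)
  have "integrable lebesgue G"
    unfolding G_def scaleR_diff_right using int1 int2 by (rule Bochner_Integration.integrable_diff)
  have "integral\<^sup>L lebesgue G =
      (\<integral>x. indicator I x *\<^sub>R B x \<partial>lebesgue) - (\<integral>x. indicator I x *\<^sub>R C \<partial>lebesgue)"
    unfolding G_def scaleR_diff_right by (rule Bochner_Integration.integral_diff[OF int1 int2])
  also have "(\<integral>x. indicator I x *\<^sub>R C \<partial>lebesgue) = measure lebesgue I *\<^sub>R C"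
  proof -
    have "integrable lebesgue (indicator I :: _ \<Rightarrow> real)"
      using I' by (intro integrable_real_indicator) (auto simp del: emeasure_completion)
    then show ?thesis by (subst integral_scaleR_left) auto
  qed
  also have "(\<integral>x. indicator I x *\<^sub>R B x \<partial>lebesgue) = (LINT x:I|lebesgue. B x)"
    by (simp add: set_lebesgue_integral_def)
  also have "(LINT x:I|lebesgue. B x) - measure lebesgue I *\<^sub>R C = measure lebesgue I *\<^sub>R (mavg I B - C)"
    using I'(3) by (simp add: mavg_def scaleR_diff_right)
  finally have "measure lebesgue I *\<^sub>R L (mavg I B - C) = L (integral\<^sup>L lebesgue G)"
    using L by (simp add: linear_simps)
  also have "\<dots> = (\<integral>x. L (G x) \<partial>lebesgue)"
    by (rule integral_bounded_linear[OF L \<open>integrable lebesgue G\<close>, symmetric])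
  finally have eq: "norm (L (mavg I B - C)) * measure lebesgue I = norm (\<integral>x. L (G x) \<partial>lebesgue)"
    by (metis abs_of_pos I'(3) mult.commute norm_scaleR)
  have "integrable lebesgue (\<lambda>x. L (G x))"
    using \<open>integrable lebesgue G\<close> by (rule integrable_bounded_linear[OF L])
  from integral_norm_bound_ennreal[OF this] have "ennreal (norm (L (mavg I B - C)) * measure lebesgue I) \<le>
      (\<integral>\<^sup>+x. ennreal (norm (L (G x))) \<partial>lebesgue)"
    unfolding eq .
  also have "\<dots> = (\<integral>\<^sup>+x\<in>I. ennreal (norm (L (B x - C))) \<partial>lebesgue)"
    by (intro nn_integral_cong) (auto simp: G_def linear_simps[OF L] split: split_indicator)
  finally show ?thesis .
qed

lemma mavg_cadjoint:
  fixes B :: "real^'d \<Rightarrow> complex^'n^'n"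
  assumes "set_integrable lebesgue I B"
  shows "mavg I (\<lambda>x. cadjoint (B x)) = cadjoint (mavg I B)"
proof -
  have "(LINT x:I|lebesgue. cadjoint (B x)) = (\<integral>x. cadjoint (indicator I x *\<^sub>R B x) \<partial>lebesgue)"
    by (simp add: set_lebesgue_integral_def)
  also have "\<dots> = cadjoint (LINT x:I|lebesgue. B x)"
    unfolding set_lebesgue_integral_def
    by (rule integral_bounded_linear[OF bounded_linear_cadjoint]) (use assms in \<open>simp add: set_integrable_def\<close>)
  finally show ?thesis by (simp add: mavg_def)
qed

lemma set_integrable_cadjoint:
  fixes B :: "real^'d \<Rightarrow> complex^'n^'n"
  assumes "set_integrable lebesgue I B"
  shows "set_integrable lebesgue I (\<lambda>x. cadjoint (B x))"
  using integrable_bounded_linear[OF bounded_linear_cadjoint, of lebesgue "\<lambda>x. indicator I x *\<^sub>R B x"] assms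
  by (simp add: set_integrable_def)

section \<open>Dual pairs of weights\<close>

text \<open>The hypotheses extracted from an \<open>A\<^sub>p\<close> weight, with \<open>A = W\<^sup>1\<^sup>/\<^sup>p\<close> and \<open>A' = A\<^sup>-\<^sup>1\<close>. They are
  symmetric under exchanging \<open>(A, p, V)\<close> with \<open>(A', q, V')\<close>, so each estimate is proved for one side
  and read off for the other. The \<open>A\<^sub>p\<close> condition itself enters only as the uniform bound on the
  products \<open>V J ** V' J\<close>; \<open>r\<close> is the constant lost when a norm average is recovered from its reducing
  operator.\<close>

locale reducing_pair =
  fixes A A' :: "real^'d \<Rightarrow> complex^'n^'n" and p q M r :: real
    and V V' :: "(real^'d) set \<Rightarrow> complex^'n^'n"
  assumes p: "1 < p" and q: "1 < q" and pq: "1 / p + 1 / q = 1"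
    and A_meas [measurable]: "A \<in> borel_measurable lebesgue"
    and A'_meas [measurable]: "A' \<in> borel_measurable lebesgue"
    and A_self: "AE x in lebesgue. cadjoint (A x) = A x"
    and A'_self: "AE x in lebesgue. cadjoint (A' x) = A' x"
    and AA': "AE x in lebesgue. A x ** A' x = mat 1"
    and V: "\<And>J. J \<in> half_cubes \<Longrightarrow> pos_def (V J)"
    and V': "\<And>J. J \<in> half_cubes \<Longrightarrow> pos_def (V' J)"
    and r: "0 \<le> r"
    and V_upper: "\<And>J u. J \<in> half_cubes \<Longrightarrow>
      (\<integral>\<^sup>+x\<in>J. ennreal (norm (A x *v u) powr p) \<partial>lebesgue) \<le> ennreal (measure lebesgue J * norm (V J *v u) powr p)"
    and V_lower: "\<And>J u. J \<in> half_cubes \<Longrightarrow>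
      ennreal (measure lebesgue J * norm (V J *v u) powr p) \<le> ennreal r * (\<integral>\<^sup>+x\<in>J. ennreal (norm (A x *v u) powr p) \<partial>lebesgue)"
    and V'_upper: "\<And>J u. J \<in> half_cubes \<Longrightarrow>
      (\<integral>\<^sup>+x\<in>J. ennreal (norm (A' x *v u) powr q) \<partial>lebesgue) \<le> ennreal (measure lebesgue J * norm (V' J *v u) powr q)"
    and V'_lower: "\<And>J u. J \<in> half_cubes \<Longrightarrow>
      ennreal (measure lebesgue J * norm (V' J *v u) powr q) \<le> ennreal r * (\<integral>\<^sup>+x\<in>J. ennreal (norm (A' x *v u) powr q) \<partial>lebesgue)"
    and M: "1 \<le> M" and VV': "\<And>J. J \<in> half_cubes \<Longrightarrow> norm (V J ** V' J) \<le> M"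
begin

lemma dual: "reducing_pair A' A q p M r V' V"
proof
  show "AE x in lebesgue. A' x ** A x = mat 1"
    using AA' by eventually_elim (use matrix_left_right_inverse in blast)
  show "norm (V' J ** V J) \<le> M" if "J \<in> half_cubes" for J
  proof -
    have "V' J ** V J = cadjoint (V J ** V' J)"
      using V[OF that] V'[OF that] by (simp add: cadjoint_mult pos_def_def)
    then show ?thesis using VV'[OF that] by simp
  qed
  show "1 / q + 1 / p = 1" using pq by simp
qed (fact p q A_meas A'_meas A_self A'_self V V' r V_upper V_lower V'_upper V'_lower M)+

lemma V_inverse:
  assumes "J \<in> half_cubes"
  shows "matrix_inv (V J) ** V J = mat 1" "V J ** matrix_inv (V J) = mat 1"
    "matrix_inv (V' J) ** V' J = mat 1" "V' J ** matrix_inv (V' J) = mat 1"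
  using pos_def_inverse V V' assms by blast+

lemma V_cancel:
  assumes "J \<in> half_cubes"
  shows "V J *v (matrix_inv (V J) *v u) = u" "V' J *v (matrix_inv (V' J) *v u) = u"
  by (simp_all add: matrix_vector_mul_assoc V_inverse[OF assms])

lemma V_self: "J \<in> half_cubes \<Longrightarrow> cadjoint (V J) = V J" "J \<in> half_cubes \<Longrightarrow> cadjoint (V' J) = V' J"
  using V V' by (auto simp: pos_def_def)

definition weight :: "complex^'n \<Rightarrow> (real^'d) set \<Rightarrow> ennreal" where
  "weight u S = (\<integral>\<^sup>+x\<in>S. ennreal (norm (A x *v u) powr p) \<partial>lebesgue)"

lemma weight_eq_emeasure:
  "S \<in> sets lebesgue \<Longrightarrow> weight u S = emeasure (density lebesgue (\<lambda>x. ennreal (norm (A x *v u) powr p))) S"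
  unfolding weight_def by (subst emeasure_density) auto

lemma weight_mono: "S \<subseteq> T \<Longrightarrow> weight u S \<le> weight u T"
  unfolding weight_def by (intro nn_integral_mono mult_left_mono) (auto split: split_indicator)

lemma weight_finite:
  assumes "J \<in> half_cubes" "S \<subseteq> J"
  shows "weight u S < \<infinity>"
proof -
  have "weight u S \<le> weight u J" by (rule weight_mono[OF assms(2)])
  also have "\<dots> \<le> ennreal (measure lebesgue J * norm (V J *v u) powr p)"
    unfolding weight_def by (rule V_upper[OF assms(1)])
  finally show ?thesis by (simp add: le_less_trans)
qed

text \<open>The pointwise identity \<open>\<langle>u, v\<rangle> = \<langle>A u, A' v\<rangle>\<close> is integrated over \<open>F\<close> with Hoelder's inequality.
  Read as a lower bound for the weight of \<open>u\<close> on \<open>F\<close>, it yields the \<open>A\<^sub>\<infinity>\<close> property.\<close>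

lemma pairing:
  assumes J: "J \<in> half_cubes" and F: "F \<in> sets lebesgue" "F \<subseteq> J"
    and X: "0 \<le> X" "weight u F \<le> ennreal X"
  shows "measure lebesgue F * norm (cinner u v) \<le>
    X powr (1 / p) * (measure lebesgue J powr (1 / q) * norm (V' J *v v))"
proof -
  note J' = half_cube_facts[OF J]
  have F_fin: "emeasure lebesgue F = ennreal (measure lebesgue F)"
  proof (rule emeasure_eq_ennreal_measure)
    have "emeasure lebesgue F \<le> emeasure lebesgue J" using F J' by (intro emeasure_mono) auto
    also have "\<dots> < top" unfolding J'(2) by simp
    finally show "emeasure lebesgue F \<noteq> top" by simp
  qed
  define Y where "Y = measure lebesgue J * norm (V' J *v v) powr q"
  have [measurable]: "F \<in> sets lebesgue" by (rule F(1))
  have le: "AE x in lebesgue. norm (cinner u v) \<le> norm (A x *v u) * norm (A' x *v v)"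
    using AA' A_self
  proof eventually_elim
    case (elim x)
    have "cinner u v = cinner (A x *v u) (A' x *v v)"
      by (simp add: cinner_adjoint elim matrix_vector_mul_assoc)
    then show ?case using norm_cinner_le by metis
  qed
  have "ennreal (norm (cinner u v)) * emeasure lebesgue F = (\<integral>\<^sup>+x\<in>F. ennreal (norm (cinner u v)) \<partial>lebesgue)"
    by (rule nn_integral_cmult_indicator[symmetric]) (rule F(1))
  also have "\<dots> \<le> (\<integral>\<^sup>+x\<in>F. ennreal (norm (A x *v u) * norm (A' x *v v)) \<partial>lebesgue)"
    by (rule nn_integral_mono_AE) (use le in eventually_elim, auto simp: ennreal_leI split: split_indicator)
  also have "\<dots> \<le> ennreal (X powr (1 / p) * Y powr (1 / q))"
  proof (rule set_nn_integral_Holder)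
    show "(\<integral>\<^sup>+x\<in>F. ennreal (norm (A x *v u) powr p) \<partial>lebesgue) \<le> ennreal X"
      using X(2) by (simp add: weight_def)
    have "(\<integral>\<^sup>+x\<in>F. ennreal (norm (A' x *v v) powr q) \<partial>lebesgue) \<le>
        (\<integral>\<^sup>+x\<in>J. ennreal (norm (A' x *v v) powr q) \<partial>lebesgue)"
      by (intro nn_integral_mono mult_left_mono) (use F(2) in \<open>auto split: split_indicator\<close>)
    also have "\<dots> \<le> ennreal Y" unfolding Y_def by (rule V'_upper[OF J])
    finally show "(\<integral>\<^sup>+x\<in>F. ennreal (norm (A' x *v v) powr q) \<partial>lebesgue) \<le> ennreal Y" .
    show "0 \<le> Y" by (simp add: Y_def)
  qed (use p q pq X in auto)
  also have "Y powr (1 / q) = measure lebesgue J powr (1 / q) * norm (V' J *v v)"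
    using q by (simp add: Y_def powr_mult powr_powr)
  finally show ?thesis
    unfolding F_fin using q by (simp add: mult.commute flip: ennreal_mult)
qed

text \<open>Taking \<open>F = J\<close> in the pairing bounds \<open>\<langle>u, v\<rangle>\<close> by \<open>|V u| |V' v|\<close>. Hence the inverse of \<open>V V'\<close> is
  bounded as well, and \<open>V'\<close> is comparable to the inverse of \<open>V\<close>.\<close>

lemma norm_inverse_product_le:
  assumes J: "J \<in> half_cubes"
  shows "norm (matrix_inv (V' J) ** matrix_inv (V J)) \<le> real CARD('n)"
proof -
  note J' = half_cube_facts[OF J]
  let ?T = "matrix_inv (V' J) ** matrix_inv (V J)"
  have "opnorm ?T \<le> 1"
    unfolding opnorm_def
  proof (rule onorm_le)
    fix a
    define b where "b = ?T *v a"
    define u where "u = matrix_inv (V J) *v a"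
    define v where "v = matrix_inv (V' J) *v b"
    have Vu: "V J *v u = a" and Vv: "V' J *v v = b"
      by (simp_all add: u_def v_def V_cancel[OF J])
    have "cinner u v = cinner u (cadjoint (matrix_inv (V' J)) *v b)"
      by (simp add: v_def cadjoint_matrix_inv[OF V'[OF J]])
    also have "\<dots> = cinner (matrix_inv (V' J) *v u) b" by (simp only: cinner_adjoint)
    also have "matrix_inv (V' J) *v u = b" by (simp add: u_def b_def matrix_vector_mul_assoc)
    finally have uv: "norm (cinner u v) = (norm b)\<^sup>2" by (simp add: cinner_self norm_power)
    have "weight u J \<le> ennreal (measure lebesgue J * norm a powr p)"
      using V_upper[OF J, of u] by (simp add: weight_def Vu)
    from pairing[OF J J'(1) order_refl _ this, of v]
    have "measure lebesgue J * (norm b)\<^sup>2 \<le>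
        (measure lebesgue J * norm a powr p) powr (1 / p) * (measure lebesgue J powr (1 / q) * norm b)"
      using J'(3) by (simp add: uv Vv)
    also have "\<dots> = measure lebesgue J powr (1 / p + 1 / q) * (norm a * norm b)"
      using p J'(3) by (simp add: powr_mult powr_powr powr_add)
    finally have "(norm b)\<^sup>2 \<le> norm a * norm b" using J'(3) by (simp add: pq)
    then show "norm (?T *v a) \<le> 1 * norm a"
      unfolding b_def[symmetric] by (cases "b = 0") (auto simp: power2_eq_square)
  qed
  then show ?thesis using norm_le_card_opnorm[of ?T] by (smt (verit) mult_left_le of_nat_0_le_iff)
qed

text \<open>The scalar weights \<open>|A u|\<^sup>p\<close> satisfy an \<open>A\<^sub>\<infinity>\<close> condition uniformly in \<open>u\<close>: testing the pairing
  against the vector dual to \<open>u\<close> shows that a subset of at least half the measure carries a fixed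
  proportion of the weight.\<close>

lemma weight_half:
  assumes J: "J \<in> half_cubes" and F: "F \<in> sets lebesgue" "F \<subseteq> J"
    and half: "measure lebesgue J \<le> 2 * measure lebesgue F"
  shows "weight u J \<le> ennreal ((2 * M) powr p) * weight u F"
proof -
  note J' = half_cube_facts[OF J]
  define X where "X = enn2real (weight u F)"
  have X: "weight u F = ennreal X" "0 \<le> X"
    using weight_finite[OF J F(2), of u] by (auto simp: X_def ennreal_enn2real_if)
  \<comment> \<open>The vector \<open>v\<close> is chosen to have \<open>\<langle>u, v\<rangle> = |z|\<^sup>2\<close> and \<open>|V' v| = |z|\<close>, so that the pairing bounds \<open>|z|\<close>;
    the bound on \<open>V V'\<close> then controls \<open>V u = V V' z\<close>.\<close>
  define z where "z = matrix_inv (V' J) *v u"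
  define v where "v = matrix_inv (V' J) *v z"
  have z: "V' J *v v = z" "V' J *v z = u"
    by (simp_all add: v_def z_def V_cancel[OF J])
  have "cinner u v = cinner (V' J *v z) v" by (simp only: z)
  also have "\<dots> = cinner z z" by (simp only: cinner_adjoint V_self(2)[OF J] z(1))
  finally have "norm (cinner u v) = (norm z)\<^sup>2" by (simp add: cinner_self norm_power)
  with pairing[OF J F X(2) eq_refl[OF X(1)], of v]
  have *: "measure lebesgue F * (norm z)\<^sup>2 \<le> X powr (1 / p) * measure lebesgue J powr (1 / q) * norm z"
    by (simp add: z mult.assoc)
  have "measure lebesgue J * norm z \<le> 2 * (X powr (1 / p) * measure lebesgue J powr (1 / q))"
  proof (cases "z = 0")
    case False
    then have "measure lebesgue F * norm z \<le> X powr (1 / p) * measure lebesgue J powr (1 / q)"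
      using * by (simp add: power2_eq_square)
    moreover have "measure lebesgue J * norm z \<le> 2 * measure lebesgue F * norm z"
      using half by (intro mult_right_mono) auto
    ultimately show ?thesis by linarith
  qed simp
  then have "(measure lebesgue J * norm z) powr p \<le> (2 * (X powr (1 / p) * measure lebesgue J powr (1 / q))) powr p"
    using p J'(3) by (intro powr_mono2) auto
  also have "\<dots> = 2 powr p * (X * measure lebesgue J powr (p / q))"
    using p X(2) by (simp add: powr_mult powr_powr)
  finally have "measure lebesgue J powr p * norm z powr p \<le> 2 powr p * (X * measure lebesgue J powr (p / q))"
    by (simp add: powr_mult)
  moreover have "measure lebesgue J powr p = measure lebesgue J powr (p / q) * measure lebesgue J"
  proof -
    have "p = p * (1 / p + 1 / q)" using pq by simp
    also have "\<dots> = p / q + 1" using p by (simp add: distrib_left)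
    finally show ?thesis using J'(3) by (metis less_imp_le powr_add powr_one)
  qed
  ultimately have "measure lebesgue J * norm z powr p \<le> 2 powr p * X"
    using J'(3) by (simp add: mult_ac)
  moreover have "norm (V J *v u) \<le> M * norm z"
  proof -
    have "V J *v u = (V J ** V' J) *v z" by (simp add: z flip: matrix_vector_mul_assoc)
    also have "norm \<dots> \<le> norm (V J ** V' J) * norm z" by (rule norm_matrix_vector_le)
    also have "\<dots> \<le> M * norm z" using VV'[OF J] by (intro mult_right_mono) auto
    finally show ?thesis .
  qed
  then have "norm (V J *v u) powr p \<le> M powr p * norm z powr p"
    using p by (metis less_imp_le less_trans norm_ge_zero powr_mono2 powr_mult zero_less_one)
  ultimately have "measure lebesgue J * norm (V J *v u) powr p \<le> M powr p * (2 powr p * X)"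
    using J'(3) by (smt (verit, ccfv_SIG) mult.left_commute mult_left_mono powr_ge_zero)
  then have "measure lebesgue J * norm (V J *v u) powr p \<le> (2 * M) powr p * X"
    using M by (simp add: powr_mult mult_ac)
  then have "weight u J \<le> ennreal ((2 * M) powr p * X)"
    unfolding weight_def by (intro order_trans[OF V_upper[OF J]] ennreal_leI)
  then show ?thesis using X by (simp add: ennreal_mult)
qed

text \<open>The proportion of the weight that is left for a set of at most half the measure, once its
  complement has received its share.\<close>

definition decay :: real where "decay = 1 - 1 / (2 * M) powr p"

lemma decay: "0 < decay" "decay < 1"
proof -
  have "1 < (2 * M) powr p" using M p by (intro gr_one_powr) auto
  then show "0 < decay" "decay < 1" unfolding decay_def using M by (simp_all add: divide_less_eq)
qed

lemma weight_decay:
  assumes J: "J \<in> half_cubes" and E: "E \<in> sets lebesgue" "E \<subseteq> J"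
    and half: "2 * emeasure lebesgue E \<le> emeasure lebesgue J"
  shows "weight u E \<le> ennreal decay * weight u J"
proof -
  note J' = half_cube_facts[OF J]
  have E_le: "emeasure lebesgue E \<le> emeasure lebesgue J" using E J' by (intro emeasure_mono) auto
  then have E_fin: "emeasure lebesgue E = ennreal (measure lebesgue E)"
    unfolding J'(2) by (intro emeasure_eq_ennreal_measure) (auto simp: top_unique)
  have "2 * measure lebesgue E \<le> measure lebesgue J"
    using half J'(3) unfolding E_fin J'(2) by (simp flip: ennreal_numeral ennreal_mult)
  moreover have "measure lebesgue (J - E) = measure lebesgue J - measure lebesgue E"
    using E J' by (intro measure_Diff) (auto simp del: emeasure_completion)
  ultimately have "measure lebesgue J \<le> 2 * measure lebesgue (J - E)" by simp
  then have wh: "weight u J \<le> ennreal ((2 * M) powr p) * weight u (J - E)"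
    using E J' by (intro weight_half[OF J]) auto
  have sum: "weight u J = weight u E + weight u (J - E)"
  proof -
    have "weight u E + weight u (J - E) =
        emeasure (density lebesgue (\<lambda>x. ennreal (norm (A x *v u) powr p))) (E \<union> (J - E))"
      unfolding weight_eq_emeasure[OF E(1)] weight_eq_emeasure[OF sets.Diff[OF J'(1) E(1)]]
      by (rule plus_emeasure) (use E J' in auto)
    also have "E \<union> (J - E) = J" using E by auto
    finally show ?thesis unfolding weight_eq_emeasure[OF J'(1)] by simp
  qed
  obtain a b where ab: "weight u E = ennreal a" "weight u (J - E) = ennreal b" "0 \<le> a" "0 \<le> b"
    using weight_finite[OF J] E by (metis Diff_subset ennreal_cases less_irrefl infinity_ennreal_def)
  let ?R = "(2 * M) powr p"
  have R: "0 < ?R" using M by simp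
  have "a + b \<le> ?R * b"
    using wh unfolding sum ab(1,2) using ab(3,4) R by (simp flip: ennreal_plus ennreal_mult)
  then have "(a + b) / ?R \<le> b" using R by (simp add: divide_le_eq mult.commute)
  then have "a \<le> decay * (a + b)" by (simp add: decay_def algebra_simps)
  then have "ennreal a \<le> ennreal (decay * (a + b))" by (rule ennreal_leI)
  also have "\<dots> = ennreal decay * (ennreal a + ennreal b)"
    using ab(3,4) decay(1) by (simp add: ennreal_mult ennreal_plus)
  finally show ?thesis unfolding sum ab(1,2) .
qed

lemma matrix_weight_le:
  fixes T :: "complex^'n^'n"
  assumes J: "J \<in> half_cubes"
  shows "(\<integral>\<^sup>+x\<in>J. ennreal (norm (A x ** T) powr p) \<partial>lebesgue) \<le>
    ennreal (real CARD('n) powr p * real CARD('n) * (measure lebesgue J * norm (V J ** T) powr p))"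
proof (rule set_nn_integral_matrix_le_columns)
  fix i
  have "norm (V J *v (T *v axis i 1)) \<le> norm (V J ** T) * norm (axis i (1::complex))"
    using norm_matrix_vector_le[of "V J ** T" "axis i 1"] by (simp add: matrix_vector_mul_assoc)
  then have le: "norm (V J *v (T *v axis i 1)) powr p \<le> norm (V J ** T) powr p"
    using p by (intro powr_mono2) (auto simp: norm_axis_complex)
  have "(\<integral>\<^sup>+x\<in>J. ennreal (norm ((A x ** T) *v axis i 1) powr p) \<partial>lebesgue) \<le>
      ennreal (measure lebesgue J * norm (V J *v (T *v axis i 1)) powr p)"
    using V_upper[OF J, of "T *v axis i 1"] by (simp add: matrix_vector_mul_assoc)
  also have "\<dots> \<le> ennreal (measure lebesgue J * norm (V J ** T) powr p)"
    by (intro ennreal_leI mult_left_mono le) auto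
  finally show "(\<integral>\<^sup>+x\<in>J. ennreal (norm ((A x ** T) *v axis i 1) powr p) \<partial>lebesgue) \<le>
      ennreal (measure lebesgue J * norm (V J ** T) powr p)" .
qed (use p half_cube_facts[OF J] in auto)

end

section \<open>Iterated stopping cubes\<close>

text \<open>When every cube \<open>J\<close> carries a family \<open>S J\<close> of stopping cubes, \<open>residual S k J\<close> is what \<open>k\<close>
  rounds of stopping inside \<open>J\<close> leave over. Working off this set makes the a priori bound needed
  for an absorption argument available: on \<open>J - residual S k J\<close> there are only \<open>k\<close> steps to sum.\<close>

primrec residual :: "('a set \<Rightarrow> 'a set set) \<Rightarrow> nat \<Rightarrow> 'a set \<Rightarrow> 'a set" where
  "residual S 0 J = J"
| "residual S (Suc k) J = (\<Union>I\<in>S J. residual S k I)"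

locale stopping_family =
  fixes S :: "(real^'d) set \<Rightarrow> (real^'d) set set"
  assumes S_countable: "J \<in> half_cubes \<Longrightarrow> countable (S J)"
    and S_disjoint: "J \<in> half_cubes \<Longrightarrow> disjoint (S J)"
    and S_half_cubes: "J \<in> half_cubes \<Longrightarrow> S J \<subseteq> half_cubes"
    and S_subset: "J \<in> half_cubes \<Longrightarrow> I \<in> S J \<Longrightarrow> I \<subseteq> J"
    and S_half: "J \<in> half_cubes \<Longrightarrow> 2 * emeasure lebesgue (\<Union>(S J)) \<le> emeasure lebesgue J"
begin

lemma S_sets: "J \<in> half_cubes \<Longrightarrow> S J \<subseteq> sets lebesgue"
  using S_half_cubes half_cube_facts(1) by blast

lemma Union_S_sets: "J \<in> half_cubes \<Longrightarrow> \<Union>(S J) \<in> sets lebesgue"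
  using S_countable S_sets by (simp add: sets.countable_Union)

lemma residual_sets: "J \<in> half_cubes \<Longrightarrow> residual S k J \<in> sets lebesgue"
proof (induction k arbitrary: J)
  case (Suc k)
  have "residual S k I \<in> sets lebesgue" if "I \<in> S J" for I
    using Suc.IH S_half_cubes[OF Suc.prems] that by blast
  then show ?case using S_countable[OF Suc.prems] unfolding residual.simps by (intro sets.countable_UN'')
qed (simp add: half_cube_facts)

lemma residual_subset: "J \<in> half_cubes \<Longrightarrow> residual S k J \<subseteq> J"
proof (induction k arbitrary: J)
  case (Suc k)
  have "residual S k I \<subseteq> J" if "I \<in> S J" for I
    using Suc.IH[of I] S_half_cubes[OF Suc.prems] S_subset[OF Suc.prems that] that by blast
  then show ?case by auto
qed simp

lemma residual_Suc_subset: "J \<in> half_cubes \<Longrightarrow> residual S (Suc k) J \<subseteq> residual S k J"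
proof (induction k arbitrary: J)
  case 0
  then show ?case using S_subset by auto
next
  case (Suc k)
  have "residual S (Suc k) I \<subseteq> residual S k I" if "I \<in> S J" for I
    using Suc.IH[of I] S_half_cubes[OF Suc.prems] that by blast
  then show ?case by (subst (1 2) residual.simps(2)) (rule UN_mono, auto)
qed

lemma mem_residual_Suc_iff:
  assumes J: "J \<in> half_cubes" and I: "I \<in> S J" and x: "x \<in> I"
  shows "x \<in> residual S (Suc k) J \<longleftrightarrow> x \<in> residual S k I"
proof
  assume "x \<in> residual S (Suc k) J"
  then obtain I' where I': "I' \<in> S J" "x \<in> residual S k I'" by auto
  then have "x \<in> I'" using residual_subset[of I' k] S_half_cubes[OF J] by blast
  then have "I' = I" using S_disjoint[OF J] I I'(1) x by (auto simp: disjoint_def)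
  then show "x \<in> residual S k I" using I'(2) by simp
qed (use I in auto)

lemma emeasure_residual:
  "J \<in> half_cubes \<Longrightarrow> 2 ^ k * emeasure lebesgue (residual S k J) \<le> emeasure lebesgue J"
proof (induction k arbitrary: J)
  case (Suc k)
  note J = Suc.prems
  let ?E = "residual S (Suc k) J"
  have E: "?E \<in> sets lebesgue" by (rule residual_sets[OF J])
  have E_sub: "?E \<subseteq> \<Union>(S J)"
    using residual_subset S_half_cubes[OF J] by fastforce
  have "2 ^ k * emeasure lebesgue ?E = (\<integral>\<^sup>+x\<in>\<Union>(S J). (2 ^ k * indicator ?E x) \<partial>lebesgue)"
  proof -
    have "indicator ?E x * indicator (\<Union>(S J)) x = (indicator ?E x :: ennreal)" for x
      using E_sub by (metis indicator_inter_arith inf.absorb1)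
    then show ?thesis by (simp only: mult.assoc nn_integral_cmult_indicator[OF E])
  qed
  also have "\<dots> \<le> (\<integral>\<^sup>+x\<in>\<Union>(S J). 1 \<partial>lebesgue)"
  proof (rule set_nn_integral_Union_mono[OF S_countable[OF J] S_disjoint[OF J] S_sets[OF J]])
    show "(\<lambda>x. 2 ^ k * indicator ?E x :: ennreal) \<in> borel_measurable lebesgue"
      by (intro borel_measurable_times_ennreal borel_measurable_const borel_measurable_indicator E)
    fix I assume I: "I \<in> S J"
    then have I': "I \<in> half_cubes" using S_half_cubes[OF J] by blast
    have "(\<integral>\<^sup>+x\<in>I. (2 ^ k * indicator ?E x) \<partial>lebesgue) = (\<integral>\<^sup>+x\<in>residual S k I. 2 ^ k \<partial>lebesgue)"
      using residual_subset[OF I', of k] mem_residual_Suc_iff[OF J I]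
      by (intro nn_integral_cong) (auto simp del: residual.simps split: split_indicator)
    also have "\<dots> = 2 ^ k * emeasure lebesgue (residual S k I)"
      by (rule nn_integral_cmult_indicator) (rule residual_sets[OF I'])
    also have "\<dots> \<le> emeasure lebesgue I" by (rule Suc.IH[OF I'])
    also have "\<dots> = (\<integral>\<^sup>+x\<in>I. 1 \<partial>lebesgue)"
      using half_cube_facts(1)[OF I'] by (simp del: emeasure_completion)
    finally show "(\<integral>\<^sup>+x\<in>I. (2 ^ k * indicator ?E x) \<partial>lebesgue) \<le> (\<integral>\<^sup>+x\<in>I. 1 \<partial>lebesgue)" .
  qed simp
  also have "\<dots> = emeasure lebesgue (\<Union>(S J))"
    using Union_S_sets[OF J] by (simp del: emeasure_completion)
  finally have "2 * (2 ^ k * emeasure lebesgue ?E) \<le> 2 * emeasure lebesgue (\<Union>(S J))"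
    by (rule mult_left_mono) simp
  also have "\<dots> \<le> emeasure lebesgue J" by (rule S_half[OF J])
  finally show ?case by (simp add: mult.assoc del: residual.simps emeasure_completion)
qed simp

lemma residual_null:
  assumes J: "J \<in> half_cubes"
  shows "(\<Inter>k. residual S k J) \<in> null_sets lebesgue"
proof -
  note J' = half_cube_facts[OF J]
  let ?N = "\<Inter>k. residual S k J"
  have N: "?N \<in> sets lebesgue" using residual_sets[OF J] by (intro sets.countable_INT'') auto
  have le: "2 ^ k * emeasure lebesgue ?N \<le> ennreal (measure lebesgue J)" for k
  proof -
    have "2 ^ k * emeasure lebesgue ?N \<le> 2 ^ k * emeasure lebesgue (residual S k J)"
      using residual_sets[OF J] by (intro mult_left_mono emeasure_mono) auto
    also have "\<dots> \<le> emeasure lebesgue J" by (rule emeasure_residual[OF J])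
    finally show ?thesis unfolding J'(2) .
  qed
  have "emeasure lebesgue ?N \<noteq> top" using le[of 0] by (auto simp: top_unique)
  then obtain m where m: "emeasure lebesgue ?N = ennreal m" "0 \<le> m" by (metis ennreal_cases)
  have "2 ^ k * m \<le> measure lebesgue J" for k
    using le[of k] m(2) J'(3) unfolding m(1)
    by (simp add: ennreal_power flip: ennreal_numeral ennreal_mult)
  have "m = 0"
  proof (rule ccontr)
    assume "m \<noteq> 0"
    then obtain k :: nat where "measure lebesgue J / m < 2 ^ k" using real_arch_pow[of 2] by auto
    then have "measure lebesgue J < 2 ^ k * m" using m(2) \<open>m \<noteq> 0\<close> by (simp add: divide_less_eq)
    then show False using \<open>2 ^ k * m \<le> measure lebesgue J\<close> by simp
  qed
  then show ?thesis using N m(1) by (intro null_setsI) auto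
qed

end

section \<open>The John--Nirenberg inequality\<close>

text \<open>The two oscillations to be compared: conjugated by the constant matrix \<open>V J\<close> and taken in \<open>L\<^sup>1\<close>,
  or weighted by \<open>A\<close> and taken in \<open>L\<^sup>p\<close>.\<close>

definition osc_bound :: "((real^'d) set \<Rightarrow> complex^'n^'n) \<Rightarrow> (real^'d \<Rightarrow> complex^'n^'n) \<Rightarrow> real \<Rightarrow> bool" where
  "osc_bound V B c \<longleftrightarrow> (\<forall>J\<in>half_cubes.
     (\<integral>\<^sup>+x\<in>J. ennreal (norm (V J ** (B x - mavg J B) ** matrix_inv (V J))) \<partial>lebesgue)
       \<le> ennreal (c * measure lebesgue J))"

definition weighted_osc_bound :: "(real^'d \<Rightarrow> complex^'n^'n) \<Rightarrow> real \<Rightarrow>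
    ((real^'d) set \<Rightarrow> complex^'n^'n) \<Rightarrow> (real^'d \<Rightarrow> complex^'n^'n) \<Rightarrow> real \<Rightarrow> bool" where
  "weighted_osc_bound A p V B K \<longleftrightarrow> (\<forall>J\<in>half_cubes.
     (\<integral>\<^sup>+x\<in>J. ennreal (norm (A x ** (B x - mavg J B) ** matrix_inv (V J)) powr p) \<partial>lebesgue)
       \<le> ennreal (K * measure lebesgue J))"

lemma osc_bound_mono: "osc_bound V B c \<Longrightarrow> c \<le> c' \<Longrightarrow> osc_bound V B c'"
  unfolding osc_bound_def by (meson ennreal_leI measure_nonneg mult_right_mono order_trans)

lemma weighted_osc_bound_mono:
  "weighted_osc_bound A p V B K \<Longrightarrow> K \<le> K' \<Longrightarrow> weighted_osc_bound A p V B K'"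
  unfolding weighted_osc_bound_def by (meson ennreal_leI measure_nonneg mult_right_mono order_trans)

context reducing_pair
begin

lemma norm_transport_le:
  assumes J: "J \<in> half_cubes"
  shows "norm (A x *v (X *v u)) \<le>
    norm (A x ** matrix_inv (V J)) * (norm (V J ** X ** matrix_inv (V J)) * norm (V J *v u))"
proof -
  have "A x *v (X *v u) = (A x ** (matrix_inv (V J) ** V J) ** X ** (matrix_inv (V J) ** V J)) *v u"
    by (simp add: V_inverse[OF J] matrix_vector_mul_assoc)
  also have "\<dots> = (A x ** matrix_inv (V J)) *v ((V J ** X ** matrix_inv (V J)) *v (V J *v u))"
    by (simp add: matrix_vector_mul_assoc matrix_mul_assoc)
  also have "norm \<dots> \<le> norm (A x ** matrix_inv (V J)) * norm ((V J ** X ** matrix_inv (V J)) *v (V J *v u))"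
    by (rule norm_matrix_vector_le)
  also have "\<dots> \<le> norm (A x ** matrix_inv (V J)) * (norm (V J ** X ** matrix_inv (V J)) * norm (V J *v u))"
    by (intro mult_left_mono norm_matrix_vector_le) auto
  finally show ?thesis .
qed

lemma bounded_linear_conjugation: "bounded_linear (\<lambda>X. P ** X ** Q)"
  for P Q :: "complex^'n^'n"
  using bounded_linear_compose[OF bounded_bilinear.bounded_linear_left[OF bounded_bilinear_matrix_mult, of Q]
      bounded_bilinear.bounded_linear_right[OF bounded_bilinear_matrix_mult, of P]]
  by simp

text \<open>A majorant for \<open>|A X u|\<^sup>p\<close> whenever \<open>X\<close> conjugated by \<open>V J\<close> has norm at most \<open>lam\<close>. Its integral
  over \<open>J\<close> is a multiple of the weight of \<open>u\<close>, which keeps the recursion of the John--Nirenberg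
  argument in terms of weights.\<close>

definition dominant :: "real \<Rightarrow> (real^'d) set \<Rightarrow> complex^'n \<Rightarrow> real^'d \<Rightarrow> ennreal" where
  "dominant lam J u x = ennreal ((lam * norm (V J *v u)) powr p) *
     ennreal (norm (A x ** matrix_inv (V J)) powr p)"

lemma dominant_measurable [measurable]: "dominant lam J u \<in> borel_measurable lebesgue"
  unfolding dominant_def by measurable

lemma dominant_bound:
  assumes J: "J \<in> half_cubes" and lam: "0 \<le> lam"
  shows "(\<integral>\<^sup>+x\<in>J. dominant lam J u x \<partial>lebesgue) \<le>
    ennreal (lam powr p * (real CARD('n) powr p * real CARD('n) * norm (mat 1 :: complex^'n^'n) powr p) * r) * weight u J"
proof -
  note J' = half_cube_facts[OF J]
  let ?C = "real CARD('n) powr p * real CARD('n) * norm (mat 1 :: complex^'n^'n) powr p"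
  have [measurable]: "J \<in> sets lebesgue" by (rule J'(1))
  have "(\<integral>\<^sup>+x\<in>J. dominant lam J u x \<partial>lebesgue) = ennreal ((lam * norm (V J *v u)) powr p) *
      (\<integral>\<^sup>+x\<in>J. ennreal (norm (A x ** matrix_inv (V J)) powr p) \<partial>lebesgue)"
    unfolding dominant_def mult.assoc by (rule nn_integral_cmult) measurable
  also have "\<dots> \<le> ennreal ((lam * norm (V J *v u)) powr p) * ennreal (?C * measure lebesgue J)"
    using matrix_weight_le[OF J, of "matrix_inv (V J)"]
    by (intro mult_left_mono) (simp_all add: V_inverse[OF J] mult_ac)
  also have "\<dots> = ennreal (lam powr p * ?C) * ennreal (measure lebesgue J * norm (V J *v u) powr p)"
    using lam by (simp add: powr_mult mult_ac flip: ennreal_mult)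
  also have "\<dots> \<le> ennreal (lam powr p * ?C) * (ennreal r * weight u J)"
    unfolding weight_def by (intro mult_left_mono V_lower[OF J]) simp
  also have "\<dots> = ennreal (lam powr p * ?C * r) * weight u J"
    using r lam by (simp add: mult.assoc[symmetric] flip: ennreal_mult)
  finally show ?thesis .
qed

lemma dominant_ge:
  assumes J: "J \<in> half_cubes" and X: "norm (V J ** X ** matrix_inv (V J)) \<le> lam"
  shows "ennreal (norm (A x *v (X *v u)) powr p) \<le> dominant lam J u x"
proof -
  have "norm (A x *v (X *v u)) \<le> norm (A x ** matrix_inv (V J)) * (lam * norm (V J *v u))"
    by (intro order_trans[OF norm_transport_le[OF J]] mult_left_mono mult_right_mono X) auto
  then have "norm (A x *v (X *v u)) powr p \<le> (norm (A x ** matrix_inv (V J)) * (lam * norm (V J *v u))) powr p"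
    using p by (intro powr_mono2) auto
  also have "\<dots> = (lam * norm (V J *v u)) powr p * norm (A x ** matrix_inv (V J)) powr p"
    using norm_ge_zero[of "V J ** X ** matrix_inv (V J)"] X by (subst powr_mult) auto
  finally show ?thesis unfolding dominant_def by (simp add: ennreal_leI flip: ennreal_mult)
qed

text \<open>Stop at the maximal subcubes where the conjugated oscillation is large. Off the stopping cubes
  the integrand is bounded by the majorant above. On a stopping cube \<open>I\<close> write
  \<open>B - m\<^sub>J B = (m\<^sub>I B - m\<^sub>J B) + (B - m\<^sub>I B)\<close>: the constant jump is again majorized, and the remainder
  is the same problem on \<open>I\<close>. Repeating this reproduces the constant \<open>K\<close> times the weight of the
  union of the stopping cubes, which by the \<open>A\<^sub>\<infinity>\<close> property is at most the proportion \<open>decay < 1\<close> of the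
  weight of \<open>J\<close>. Keeping the vector \<open>u\<close> fixed is essential: passing from \<open>V J\<close> to \<open>V I\<close> in every round would
  cost a constant that the decay cannot absorb.\<close>

theorem john_nirenberg:
  assumes B_meas [measurable]: "B \<in> borel_measurable lebesgue"
    and B_int: "\<And>J. J \<in> half_cubes \<Longrightarrow> set_integrable lebesgue J B"
    and c: "0 < c" "osc_bound V B c"
  obtains K where "0 \<le> K" "\<And>J u. J \<in> half_cubes \<Longrightarrow>
    (\<integral>\<^sup>+x\<in>J. ennreal (norm (A x *v ((B x - mavg J B) *v u)) powr p) \<partial>lebesgue) \<le> ennreal K * weight u J"
proof -
  define osc where "osc J x = ennreal (norm (V J ** (B x - mavg J B) ** matrix_inv (V J)))" for J x
  have [measurable]: "osc J \<in> borel_measurable lebesgue" for J unfolding osc_def by measurable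
  define lam where "lam = 2 ^ CARD('d) * (2 * c)"
  have lam: "2 * c \<le> lam" "0 < lam"
    using c(1) mult_right_mono[of 1 "2 ^ CARD('d)" "2 * c"] by (auto simp: lam_def)
  have "\<forall>J\<in>half_cubes. \<exists>T. countable T \<and> disjoint T \<and> T \<subseteq> half_cubes \<and> (\<forall>I\<in>T. I \<subseteq> J) \<and>
      (\<forall>I\<in>T. (\<integral>\<^sup>+x\<in>I. osc J x \<partial>lebesgue) \<le> ennreal lam * emeasure lebesgue I) \<and>
      2 * emeasure lebesgue (\<Union>T) \<le> emeasure lebesgue J \<and>
      (AE x in lebesgue. x \<in> J - \<Union>T \<longrightarrow> osc J x \<le> ennreal (2 * c))"
  proof
    fix J :: "(real^'d) set" assume J: "J \<in> half_cubes"
    have "(\<integral>\<^sup>+x\<in>J. osc J x \<partial>lebesgue) \<le> ennreal c * emeasure lebesgue J"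
      using c J unfolding osc_bound_def osc_def half_cube_facts(2)[OF J]
      by (simp flip: ennreal_mult)
    from calderon_zygmund[OF J _ c(1) this] obtain T where "countable T" "disjoint T" "T \<subseteq> half_cubes"
      "\<And>I. I \<in> T \<Longrightarrow> I \<subseteq> J"
      "\<And>I. I \<in> T \<Longrightarrow> (\<integral>\<^sup>+x\<in>I. osc J x \<partial>lebesgue) \<le> ennreal (2 ^ CARD('d) * (2 * c)) * emeasure lebesgue I"
      "2 * emeasure lebesgue (\<Union>T) \<le> emeasure lebesgue J"
      "AE x in lebesgue. x \<in> J - \<Union>T \<longrightarrow> osc J x \<le> ennreal (2 * c)"
      by auto
    then show "\<exists>T. countable T \<and> disjoint T \<and> T \<subseteq> half_cubes \<and> (\<forall>I\<in>T. I \<subseteq> J) \<and>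
      (\<forall>I\<in>T. (\<integral>\<^sup>+x\<in>I. osc J x \<partial>lebesgue) \<le> ennreal lam * emeasure lebesgue I) \<and>
      2 * emeasure lebesgue (\<Union>T) \<le> emeasure lebesgue J \<and>
      (AE x in lebesgue. x \<in> J - \<Union>T \<longrightarrow> osc J x \<le> ennreal (2 * c))"
      unfolding lam_def by blast
  qed
  from bchoice[OF this] obtain S where S: "\<forall>J\<in>half_cubes. countable (S J) \<and> disjoint (S J) \<and>
      S J \<subseteq> half_cubes \<and> (\<forall>I\<in>S J. I \<subseteq> J) \<and>
      (\<forall>I\<in>S J. (\<integral>\<^sup>+x\<in>I. osc J x \<partial>lebesgue) \<le> ennreal lam * emeasure lebesgue I) \<and>
      2 * emeasure lebesgue (\<Union>(S J)) \<le> emeasure lebesgue J \<and>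
      (AE x in lebesgue. x \<in> J - \<Union>(S J) \<longrightarrow> osc J x \<le> ennreal (2 * c))" by blast
  have S_props: "countable (S J)" "disjoint (S J)" "S J \<subseteq> half_cubes" "\<forall>I\<in>S J. I \<subseteq> J"
    "2 * emeasure lebesgue (\<Union>(S J)) \<le> emeasure lebesgue J" if J: "J \<in> half_cubes" for J
    using bspec[OF S J] by blast+
  interpret stopping_family S
  proof
    show "I \<subseteq> J" if "J \<in> half_cubes" "I \<in> S J" for I J using S_props(4)[OF that(1)] that(2) by blast
  qed (fact S_props(1) S_props(2) S_props(3) S_props(5))+
  have S_avg: "(\<integral>\<^sup>+x\<in>I. osc J x \<partial>lebesgue) \<le> ennreal lam * emeasure lebesgue I"
    if "J \<in> half_cubes" "I \<in> S J" for I J using S that by blast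
  have S_off: "AE x in lebesgue. x \<in> J - \<Union>(S J) \<longrightarrow> osc J x \<le> ennreal (2 * c)"
    if "J \<in> half_cubes" for J using S that by blast
  have S_jump: "norm (V J ** (mavg I B - mavg J B) ** matrix_inv (V J)) \<le> lam"
    if J: "J \<in> half_cubes" and I: "I \<in> S J" for I J
  proof -
    have I': "I \<in> half_cubes" using S_half_cubes[OF J] I by blast
    have "ennreal (norm (V J ** (mavg I B - mavg J B) ** matrix_inv (V J)) * measure lebesgue I) \<le>
        (\<integral>\<^sup>+x\<in>I. osc J x \<partial>lebesgue)"
      unfolding osc_def by (rule norm_mavg_le[OF I' B_int[OF I'] bounded_linear_conjugation])
    also have "\<dots> \<le> ennreal lam * emeasure lebesgue I" by (rule S_avg[OF J I])
    finally show ?thesis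
      using half_cube_facts(3)[OF I'] lam(2) unfolding half_cube_facts(2)[OF I']
      by (simp flip: ennreal_mult)
  qed
  define h where "h J u x = ennreal (norm (A x *v ((B x - mavg J B) *v u)) powr p)" for J u x
  have [measurable]: "h J u \<in> borel_measurable lebesgue" for J u
    unfolding h_def matrix_vector_mul_assoc by measurable
  \<comment> \<open>The exponent makes the constant in front of the inductive term equal to \<open>decay powr (- 1/2)\<close>,
    which the decay of the weight still beats.\<close>
  define s where "s = decay powr (1 / (2 * (p - 1)))"
  have s: "0 < s" "s < 1"
    using decay p powr_less_mono2[of "1 / (2 * (p - 1))" decay 1] by (auto simp: s_def)
  define a where "a = (1 - s) powr (1 - p)"
  define b where "b = s powr (1 - p)"
  define t where "t = decay powr (1 / 2)"
  have bt: "b * decay = t"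
  proof -
    have "1 / (2 * (p - 1)) * (1 - p) = - (1 / 2)" using p by (simp add: field_simps)
    then have "b = decay powr (- (1 / 2))" by (simp add: b_def s_def powr_powr)
    then have "b * decay = decay powr (- (1 / 2)) * decay powr 1" using decay by simp
    also have "\<dots> = decay powr (- (1 / 2) + 1)" by (simp only: powr_add)
    finally show ?thesis by (simp add: t_def)
  qed
  have t: "0 < t" "t < 1" using decay powr_less_mono2[of "1 / 2" decay 1] by (auto simp: t_def)
  define G where "G = lam powr p * (real CARD('n) powr p * real CARD('n) * norm (mat 1 :: complex^'n^'n) powr p) * r"
  have G: "0 \<le> G" using r lam by (simp add: G_def)
  have ab: "0 \<le> a" "0 \<le> b" by (simp_all add: a_def b_def)
  define K where "K = (a + 1) * G / (1 - t)"
  have K: "0 \<le> K" "(a + 1) * G + t * K = K"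
    using t G ab by (auto simp: K_def field_simps)
  have step: "(\<integral>\<^sup>+x\<in>J - residual S k J. h J u x \<partial>lebesgue) \<le> ennreal K * weight u J"
    if "J \<in> half_cubes" for J u k
    using that
  proof (induction k arbitrary: J)
    case (Suc k)
    note J = Suc.prems
    let ?E = "residual S (Suc k) J" and ?U = "\<Union>(S J)"
    note [measurable] = half_cube_facts(1)[OF J] residual_sets[OF J, of "Suc k"] Union_S_sets[OF J]
    have dom: "(\<integral>\<^sup>+x\<in>T. dominant lam J u x \<partial>lebesgue) \<le> ennreal G * weight u J" if "T \<subseteq> J" for T
    proof -
      have "(\<integral>\<^sup>+x\<in>T. dominant lam J u x \<partial>lebesgue) \<le> (\<integral>\<^sup>+x\<in>J. dominant lam J u x \<partial>lebesgue)"
        by (intro nn_integral_mono mult_left_mono) (use that in \<open>auto split: split_indicator\<close>)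
      also have "\<dots> \<le> ennreal G * weight u J"
        unfolding G_def using lam by (intro dominant_bound[OF J]) simp
      finally show ?thesis .
    qed
    have U_sub: "?U \<subseteq> J" using S_subset[OF J] by blast
    have off: "(\<integral>\<^sup>+x\<in>J - ?U. h J u x \<partial>lebesgue) \<le> ennreal G * weight u J"
    proof -
      have "AE x in lebesgue. h J u x * indicator (J - ?U) x \<le> dominant lam J u x * indicator (J - ?U) x"
        using S_off[OF J]
      proof eventually_elim
        case (elim x)
        show ?case
        proof (cases "x \<in> J - ?U")
          case True
          then have "norm (V J ** (B x - mavg J B) ** matrix_inv (V J)) \<le> lam"
            using elim lam c(1) by (simp add: osc_def ennreal_le_iff)
          then show ?thesis using True dominant_ge[OF J] by (simp add: h_def)
        qed simp
      qed
      then have "(\<integral>\<^sup>+x\<in>J - ?U. h J u x \<partial>lebesgue) \<le> (\<integral>\<^sup>+x\<in>J - ?U. dominant lam J u x \<partial>lebesgue)"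
        by (rule nn_integral_mono_AE)
      also have "\<dots> \<le> ennreal G * weight u J" by (rule dom) auto
      finally show ?thesis .
    qed
    define g where "g x = ennreal a * dominant lam J u x + ennreal (b * K) * ennreal (norm (A x *v u) powr p)" for x
    have [measurable]: "g \<in> borel_measurable lebesgue" unfolding g_def by measurable
    have g_int: "(\<integral>\<^sup>+x\<in>T. g x \<partial>lebesgue) =
        ennreal a * (\<integral>\<^sup>+x\<in>T. dominant lam J u x \<partial>lebesgue) + ennreal (b * K) * weight u T"
      if [measurable]: "T \<in> sets lebesgue" for T
      unfolding g_def weight_def distrib_right mult.assoc
      by (subst nn_integral_add, measurable) (subst (1 2) nn_integral_cmult; measurable)
    have "(\<integral>\<^sup>+x\<in>?U. (h J u x * indicator (- ?E) x) \<partial>lebesgue) \<le> (\<integral>\<^sup>+x\<in>?U. g x \<partial>lebesgue)"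
    proof (rule set_nn_integral_Union_mono[OF S_countable[OF J] S_disjoint[OF J] S_sets[OF J]])
      fix I assume I: "I \<in> S J"
      then have I': "I \<in> half_cubes" using S_half_cubes[OF J] by blast
      note [measurable] = half_cube_facts(1)[OF I'] residual_sets[OF I', of k]
      have "(\<integral>\<^sup>+x\<in>I. (h J u x * indicator (- ?E) x) \<partial>lebesgue) \<le>
          (\<integral>\<^sup>+x. ennreal a * (dominant lam J u x * indicator I x) +
            ennreal b * (h I u x * indicator (I - residual S k I) x) \<partial>lebesgue)"
      proof (rule nn_integral_mono)
        fix x
        show "h J u x * indicator (- ?E) x * indicator I x \<le> ennreal a * (dominant lam J u x * indicator I x) +
            ennreal b * (h I u x * indicator (I - residual S k I) x)"
        proof (cases "x \<in> I \<and> x \<notin> ?E")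
          case True
          then have x: "x \<in> I - residual S k I" using mem_residual_Suc_iff[OF J I] by blast
          let ?y = "A x *v ((mavg I B - mavg J B) *v u)" and ?z = "A x *v ((B x - mavg I B) *v u)"
          have "A x *v ((B x - mavg J B) *v u) = ?y + ?z"
            by (simp flip: matrix_vector_right_distrib matrix_vector_mult_add_rdistrib)
          then have "norm (A x *v ((B x - mavg J B) *v u)) powr p \<le> (norm ?y + norm ?z) powr p"
            using p by (intro powr_mono2) (auto simp: norm_triangle_ineq)
          also have "\<dots> \<le> a * norm ?y powr p + b * norm ?z powr p"
            unfolding a_def b_def using p s by (intro powr_add_le) auto
          finally have "h J u x \<le> ennreal a * ennreal (norm ?y powr p) + ennreal b * h I u x"
            using ab unfolding h_def by (simp add: ennreal_leI flip: ennreal_mult ennreal_plus)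
          also have "\<dots> \<le> ennreal a * dominant lam J u x + ennreal b * h I u x"
            by (intro add_mono mult_left_mono dominant_ge[OF J S_jump[OF J I]]) auto
          finally show ?thesis using True x by simp
        qed (auto split: split_indicator)
      qed
      also have "\<dots> = ennreal a * (\<integral>\<^sup>+x\<in>I. dominant lam J u x \<partial>lebesgue) +
          ennreal b * (\<integral>\<^sup>+x\<in>I - residual S k I. h I u x \<partial>lebesgue)"
        by (subst nn_integral_add, measurable) (subst (1 2) nn_integral_cmult; measurable)
      also have "\<dots> \<le> ennreal a * (\<integral>\<^sup>+x\<in>I. dominant lam J u x \<partial>lebesgue) + ennreal b * (ennreal K * weight u I)"
        by (intro add_left_mono mult_left_mono Suc.IH[OF I']) auto
      also have "\<dots> = (\<integral>\<^sup>+x\<in>I. g x \<partial>lebesgue)"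
        using ab K by (simp add: g_int ennreal_mult mult.assoc)
      finally show "(\<integral>\<^sup>+x\<in>I. (h J u x * indicator (- ?E) x) \<partial>lebesgue) \<le> (\<integral>\<^sup>+x\<in>I. g x \<partial>lebesgue)" .
    qed measurable
    also have "\<dots> \<le> ennreal a * (ennreal G * weight u J) + ennreal (b * K) * (ennreal decay * weight u J)"
      unfolding g_int[OF Union_S_sets[OF J]]
      by (intro add_mono mult_left_mono dom U_sub weight_decay[OF J Union_S_sets[OF J] U_sub S_half[OF J]]) auto
    finally have on: "(\<integral>\<^sup>+x\<in>?U. (h J u x * indicator (- ?E) x) \<partial>lebesgue) \<le>
        ennreal a * (ennreal G * weight u J) + ennreal (b * K) * (ennreal decay * weight u J)" .
    have "(\<integral>\<^sup>+x\<in>J - ?E. h J u x \<partial>lebesgue) \<le>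
        (\<integral>\<^sup>+x. h J u x * indicator (J - ?U) x + h J u x * indicator (- ?E) x * indicator ?U x \<partial>lebesgue)"
      by (intro nn_integral_mono) (auto split: split_indicator)
    also have "\<dots> = (\<integral>\<^sup>+x\<in>J - ?U. h J u x \<partial>lebesgue) + (\<integral>\<^sup>+x\<in>?U. (h J u x * indicator (- ?E) x) \<partial>lebesgue)"
      by (rule nn_integral_add) measurable
    also have "\<dots> \<le> ennreal G * weight u J +
        (ennreal a * (ennreal G * weight u J) + ennreal (b * K) * (ennreal decay * weight u J))"
      by (rule add_mono[OF off on])
    also have "\<dots> = (ennreal G + ennreal a * ennreal G + ennreal (b * K) * ennreal decay) * weight u J"
      by (simp add: distrib_right mult.assoc add.assoc)
    also have "ennreal G + ennreal a * ennreal G + ennreal (b * K) * ennreal decay = ennreal ((a + 1) * G + t * K)"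
      using ab G K decay unfolding bt[symmetric] by (simp add: algebra_simps flip: ennreal_mult ennreal_plus)
    finally show ?case unfolding K(2) .
  qed simp
  have "(\<integral>\<^sup>+x\<in>J. h J u x \<partial>lebesgue) \<le> ennreal K * weight u J" if J: "J \<in> half_cubes" for J u
  proof -
    let ?N = "\<Inter>k. residual S k J" and ?D = "density lebesgue (h J u)"
    have "(\<integral>\<^sup>+x\<in>J. h J u x \<partial>lebesgue) = (\<integral>\<^sup>+x\<in>J - ?N. h J u x \<partial>lebesgue)"
      by (rule nn_integral_cong_AE) (use AE_not_in[OF residual_null[OF J]] in eventually_elim, auto split: split_indicator)
    also have "J - ?N = (\<Union>k. J - residual S k J)" by auto
    also have "(\<integral>\<^sup>+x\<in>(\<Union>k. J - residual S k J). h J u x \<partial>lebesgue) = emeasure ?D (\<Union>k. J - residual S k J)"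
      by (rule emeasure_density[symmetric]) (use half_cube_facts[OF J] residual_sets[OF J] in auto)
    also have "\<dots> = (SUP k. emeasure ?D (J - residual S k J))"
    proof (rule SUP_emeasure_incseq[symmetric])
      show "range (\<lambda>k. J - residual S k J) \<subseteq> sets ?D"
        using half_cube_facts[OF J] residual_sets[OF J] by auto
      show "incseq (\<lambda>k. J - residual S k J)"
        using residual_Suc_subset[OF J] by (intro incseq_SucI) blast
    qed
    also have "\<dots> \<le> ennreal K * weight u J"
    proof (rule SUP_least)
      fix k
      have "emeasure ?D (J - residual S k J) = (\<integral>\<^sup>+x\<in>J - residual S k J. h J u x \<partial>lebesgue)"
        by (rule emeasure_density) (use half_cube_facts[OF J] residual_sets[OF J] in auto)
      also have "\<dots> \<le> ennreal K * weight u J" by (rule step[OF J])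
      finally show "emeasure ?D (J - residual S k J) \<le> ennreal K * weight u J" .
    qed
    finally show ?thesis .
  qed
  then show ?thesis using that K(1) unfolding h_def by blast
qed

end

section \<open>The duality of the weighted oscillations\<close>

context reducing_pair
begin

lemma weighted_osc_bound_of_osc_bound:
  assumes B: "B \<in> borel_measurable lebesgue" "\<And>J. J \<in> half_cubes \<Longrightarrow> set_integrable lebesgue J B"
    and osc: "osc_bound V B c"
  shows "\<exists>K. weighted_osc_bound A p V B K"
proof -
  have "osc_bound V B (max c 1)" using osc by (rule osc_bound_mono) simp
  moreover have "0 < max c 1" by simp
  ultimately obtain K where K: "0 \<le> K" and
    JN: "\<And>J u. J \<in> half_cubes \<Longrightarrow>
      (\<integral>\<^sup>+x\<in>J. ennreal (norm (A x *v ((B x - mavg J B) *v u)) powr p) \<partial>lebesgue) \<le> ennreal K * weight u J"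
    using john_nirenberg[OF B, of "max c 1"] by blast
  note [measurable] = B(1)
  have "weighted_osc_bound A p V B (real CARD('n) powr p * real CARD('n) * K)"
    unfolding weighted_osc_bound_def
  proof
    fix J :: "(real^'d) set" assume J: "J \<in> half_cubes"
    have "(\<integral>\<^sup>+x\<in>J. ennreal (norm (A x ** (B x - mavg J B) ** matrix_inv (V J)) powr p) \<partial>lebesgue) \<le>
        ennreal (real CARD('n) powr p * real CARD('n) * (K * measure lebesgue J))"
    proof (rule set_nn_integral_matrix_le_columns)
      fix i
      let ?u = "matrix_inv (V J) *v axis i 1"
      have "(\<integral>\<^sup>+x\<in>J. ennreal (norm ((A x ** (B x - mavg J B) ** matrix_inv (V J)) *v axis i 1) powr p) \<partial>lebesgue)
          \<le> ennreal K * weight ?u J"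
        using JN[OF J, of ?u] by (simp add: matrix_vector_mul_assoc matrix_mul_assoc)
      also have "\<dots> \<le> ennreal K * ennreal (measure lebesgue J * norm (V J *v ?u) powr p)"
        unfolding weight_def by (intro mult_left_mono V_upper[OF J]) simp
      also have "\<dots> = ennreal (K * measure lebesgue J)"
        using K by (simp add: V_cancel[OF J] norm_axis_complex ennreal_mult)
      finally show "(\<integral>\<^sup>+x\<in>J. ennreal (norm ((A x ** (B x - mavg J B) ** matrix_inv (V J)) *v axis i 1) powr p) \<partial>lebesgue)
          \<le> ennreal (K * measure lebesgue J)" .
    qed (use p K half_cube_facts[OF J] in auto)
    then show "(\<integral>\<^sup>+x\<in>J. ennreal (norm (A x ** (B x - mavg J B) ** matrix_inv (V J)) powr p) \<partial>lebesgue) \<le>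
        ennreal (real CARD('n) powr p * real CARD('n) * K * measure lebesgue J)"
      by (simp add: mult.assoc)
  qed
  then show ?thesis by blast
qed

text \<open>Hoelder's inequality, after inserting \<open>A' A = 1\<close> behind \<open>V J\<close>: the factor \<open>V J A'\<close> is bounded in
  \<open>L\<^sup>q\<close> because its average is governed by \<open>V' J ** V J\<close>.\<close>

lemma osc_bound_of_weighted_osc_bound:
  assumes B [measurable]: "B \<in> borel_measurable lebesgue" and wosc: "weighted_osc_bound A p V B K"
  shows "\<exists>c. osc_bound V B c"
proof -
  interpret dual: reducing_pair A' A q p M r V' V by (rule dual)
  define K' where "K' = max K 0"
  define L where "L = real CARD('n) powr q * real CARD('n) * M powr q"
  have K': "0 \<le> K'" "weighted_osc_bound A p V B K'"
    using weighted_osc_bound_mono[OF wosc, of K'] by (auto simp: K'_def)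
  have L: "0 \<le> L" by (simp add: L_def)
  have "osc_bound V B (K' powr (1 / p) * L powr (1 / q))"
    unfolding osc_bound_def
  proof
    fix J :: "(real^'d) set" assume J: "J \<in> half_cubes"
    note J' = half_cube_facts[OF J]
    let ?m = "measure lebesgue J"
    let ?X = "\<lambda>x. norm (A x ** (B x - mavg J B) ** matrix_inv (V J))"
    have [measurable]: "J \<in> sets lebesgue" by (rule J'(1))
    have "AE x in lebesgue. norm (V J ** (B x - mavg J B) ** matrix_inv (V J)) \<le> ?X x * norm (A' x ** V J)"
      using dual.AA' A'_self
    proof eventually_elim
      case (elim x)
      have "V J ** (B x - mavg J B) ** matrix_inv (V J) =
          V J ** (A' x ** A x) ** (B x - mavg J B) ** matrix_inv (V J)" by (simp add: elim)
      also have "\<dots> = (V J ** A' x) ** (A x ** (B x - mavg J B) ** matrix_inv (V J))"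
        by (simp only: matrix_mul_assoc)
      also have "norm \<dots> \<le> norm (V J ** A' x) * ?X x" by (rule norm_matrix_mult_le)
      also have "norm (V J ** A' x) = norm (cadjoint (V J ** A' x))" by simp
      also have "cadjoint (V J ** A' x) = A' x ** V J" by (simp add: cadjoint_mult elim V_self[OF J])
      finally show ?case by (simp add: mult.commute)
    qed
    then have "AE x in lebesgue. ennreal (norm (V J ** (B x - mavg J B) ** matrix_inv (V J))) * indicator J x \<le>
        ennreal (?X x * norm (A' x ** V J)) * indicator J x"
      by eventually_elim (auto intro: ennreal_leI split: split_indicator)
    then have "(\<integral>\<^sup>+x\<in>J. ennreal (norm (V J ** (B x - mavg J B) ** matrix_inv (V J))) \<partial>lebesgue) \<le>
        (\<integral>\<^sup>+x\<in>J. ennreal (?X x * norm (A' x ** V J)) \<partial>lebesgue)"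
      by (rule nn_integral_mono_AE)
    also have "\<dots> \<le> ennreal ((K' * ?m) powr (1 / p) * (L * ?m) powr (1 / q))"
    proof (rule set_nn_integral_Holder)
      show "(\<integral>\<^sup>+x\<in>J. ennreal (?X x powr p) \<partial>lebesgue) \<le> ennreal (K' * ?m)"
        using K'(2) J by (simp add: weighted_osc_bound_def)
      have "(\<integral>\<^sup>+x\<in>J. ennreal (norm (A' x ** V J) powr q) \<partial>lebesgue) \<le>
          ennreal (real CARD('n) powr q * real CARD('n) * (?m * norm (V' J ** V J) powr q))"
        by (rule dual.matrix_weight_le[OF J])
      also have "\<dots> \<le> ennreal (real CARD('n) powr q * real CARD('n) * (?m * M powr q))"
        using q by (intro ennreal_leI mult_left_mono powr_mono2 dual.VV'[OF J]) auto
      also have "\<dots> = ennreal (L * ?m)" by (simp add: L_def mult_ac)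
      finally show "(\<integral>\<^sup>+x\<in>J. ennreal (norm (A' x ** V J) powr q) \<partial>lebesgue) \<le> ennreal (L * ?m)" .
    qed (use p q pq K' L in auto)
    also have "(K' * ?m) powr (1 / p) * (L * ?m) powr (1 / q) =
        K' powr (1 / p) * L powr (1 / q) * ?m powr (1 / p + 1 / q)"
      using J'(3) by (simp add: powr_mult powr_add)
    finally show "(\<integral>\<^sup>+x\<in>J. ennreal (norm (V J ** (B x - mavg J B) ** matrix_inv (V J))) \<partial>lebesgue)
        \<le> ennreal (K' powr (1 / p) * L powr (1 / q) * ?m)"
      using J'(3) by (simp add: pq)
  qed
  then show ?thesis by blast
qed

text \<open>Since \<open>V' J\<close> is comparable to the inverse of \<open>V J\<close>, conjugating \<open>B - m\<^sub>J B\<close> by \<open>V J\<close> and its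
  adjoint by \<open>V' J\<close> gives comparable norms: the unweighted oscillation does not see the difference
  between the two sides of the duality.\<close>

lemma dual_osc_bound:
  assumes B: "\<And>J. J \<in> half_cubes \<Longrightarrow> set_integrable lebesgue J B"
    and B_meas [measurable]: "B \<in> borel_measurable lebesgue"
    and osc: "osc_bound V B c"
  shows "\<exists>c. osc_bound V' (\<lambda>x. cadjoint (B x)) c"
proof -
  define C where "C = real CARD('n) * M"
  have C: "0 \<le> C" using M by (simp add: C_def)
  have "osc_bound V' (\<lambda>x. cadjoint (B x)) (C * c)"
    unfolding osc_bound_def
  proof
    fix J :: "(real^'d) set" assume J: "J \<in> half_cubes"
    note J' = half_cube_facts[OF J]
    have [measurable]: "J \<in> sets lebesgue" by (rule J'(1))
    have le: "norm (V' J ** (cadjoint (B x) - cadjoint (mavg J B)) ** matrix_inv (V' J)) \<le>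
        C * norm (V J ** (B x - mavg J B) ** matrix_inv (V J))" for x
    proof -
      let ?D = "B x - mavg J B"
      note inv_self = cadjoint_matrix_inv[OF V'[OF J]]
      have "norm (V' J ** (cadjoint (B x) - cadjoint (mavg J B)) ** matrix_inv (V' J)) =
          norm (cadjoint (V' J ** cadjoint ?D ** matrix_inv (V' J)))" by simp
      also have "cadjoint (V' J ** cadjoint ?D ** matrix_inv (V' J)) =
          matrix_inv (V' J) ** (matrix_inv (V J) ** V J) ** ?D ** (matrix_inv (V J) ** V J) ** V' J"
        by (simp add: cadjoint_mult V_self[OF J] inv_self V_inverse[OF J] matrix_mul_assoc
            del: cadjoint_simps(3))
      also have "\<dots> = (matrix_inv (V' J) ** matrix_inv (V J)) **
          ((V J ** ?D ** matrix_inv (V J)) ** (V J ** V' J))" by (simp only: matrix_mul_assoc)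
      also have "norm \<dots> \<le> norm (matrix_inv (V' J) ** matrix_inv (V J)) *
          (norm (V J ** ?D ** matrix_inv (V J)) * norm (V J ** V' J))"
        by (intro order_trans[OF norm_matrix_mult_le] mult_left_mono norm_matrix_mult_le) auto
      also have "\<dots> \<le> real CARD('n) * (norm (V J ** ?D ** matrix_inv (V J)) * M)"
        by (intro mult_mono norm_inverse_product_le[OF J] VV'[OF J]) auto
      finally show ?thesis by (simp add: C_def mult_ac)
    qed
    have "(\<integral>\<^sup>+x\<in>J. ennreal (norm (V' J ** (cadjoint (B x) - mavg J (\<lambda>x. cadjoint (B x))) ** matrix_inv (V' J))) \<partial>lebesgue)
        \<le> (\<integral>\<^sup>+x. ennreal C * (ennreal (norm (V J ** (B x - mavg J B) ** matrix_inv (V J))) * indicator J x) \<partial>lebesgue)"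
      unfolding mavg_cadjoint[OF B[OF J]]
    proof (rule nn_integral_mono)
      fix x
      show "ennreal (norm (V' J ** (cadjoint (B x) - cadjoint (mavg J B)) ** matrix_inv (V' J))) * indicator J x \<le>
          ennreal C * (ennreal (norm (V J ** (B x - mavg J B) ** matrix_inv (V J))) * indicator J x)"
        using ennreal_leI[OF le[of x]] C by (simp add: ennreal_mult split: split_indicator)
    qed
    also have "\<dots> = ennreal C * (\<integral>\<^sup>+x\<in>J. ennreal (norm (V J ** (B x - mavg J B) ** matrix_inv (V J))) \<partial>lebesgue)"
      by (rule nn_integral_cmult) measurable
    also have "\<dots> \<le> ennreal C * ennreal (c * measure lebesgue J)"
      using osc J by (intro mult_left_mono) (auto simp: osc_bound_def)
    also have "\<dots> = ennreal (C * c * measure lebesgue J)"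
      using C by (simp add: ennreal_mult' mult.assoc)
    finally show "(\<integral>\<^sup>+x\<in>J. ennreal (norm (V' J ** (cadjoint (B x) - mavg J (\<lambda>x. cadjoint (B x))) ** matrix_inv (V' J))) \<partial>lebesgue)
        \<le> ennreal (C * c * measure lebesgue J)" .
  qed
  then show ?thesis by blast
qed

theorem weighted_osc_bound_dual:
  assumes B: "B \<in> borel_measurable lebesgue" "\<And>J. J \<in> half_cubes \<Longrightarrow> set_integrable lebesgue J B"
    and wosc: "weighted_osc_bound A p V B K"
  shows "\<exists>K'. weighted_osc_bound A' q V' (\<lambda>x. cadjoint (B x)) K'"
proof -
  interpret dual: reducing_pair A' A q p M r V' V by (rule dual)
  obtain c where "osc_bound V B c" using osc_bound_of_weighted_osc_bound[OF B(1) wosc] by blast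
  then obtain c' where "osc_bound V' (\<lambda>x. cadjoint (B x)) c'"
    using dual_osc_bound[OF B(2) B(1)] by blast
  then show ?thesis
    by (rule dual.weighted_osc_bound_of_osc_bound[rotated -1])
      (use B set_integrable_cadjoint in auto)
qed

end

section \<open>Closed cubes and half-open cubes\<close>

lemma closure_half_cube:
  assumes "0 < l"
  shows "closure (half_cube a l) = cbox a (a + (\<chi> i. l))"
proof
  show "closure (half_cube a l) \<subseteq> cbox a (a + (\<chi> i. l))"
    by (rule closure_minimal[OF half_cube_between(2) closed_cbox])
  have "box a (a + (\<chi> i. l)) \<noteq> {}" using assms by (simp add: interval_ne_empty_cart)
  then have "cbox a (a + (\<chi> i. l)) = closure (box a (a + (\<chi> i. l)))" by (rule closure_box[symmetric])
  also have "\<dots> \<subseteq> closure (half_cube a l)" by (rule closure_mono[OF half_cube_between(1)])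
  finally show "cbox a (a + (\<chi> i. l)) \<subseteq> closure (half_cube a l)" .
qed

lemma cubes_eq_closures: "cubes = closure ` half_cubes"
proof (intro equalityI subsetI)
  fix I :: "(real^'d) set" assume "I \<in> cubes"
  then obtain a l where "0 < l" "I = cbox a (a + (\<chi> i. l))" by (auto simp: cubes_def)
  then have "I = closure (half_cube a l)" "half_cube a l \<in> half_cubes"
    by (auto simp: closure_half_cube half_cubes_def)
  then show "I \<in> closure ` half_cubes" by blast
next
  fix I :: "(real^'d) set" assume "I \<in> closure ` half_cubes"
  then obtain a l where "0 < l" "I = closure (half_cube a l)" by (auto simp: half_cubes_def)
  then show "I \<in> cubes" unfolding cubes_def using closure_half_cube[of l a] by blast
qed

context
  fixes J :: "(real^'d) set"
  assumes J: "J \<in> half_cubes"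
begin

lemma AE_half_cube_closure: "AE x in lebesgue. x \<in> closure J \<longleftrightarrow> x \<in> J"
proof -
  obtain a l where "0 < l" "J = half_cube a l" using J by (auto simp: half_cubes_def)
  then show ?thesis using AE_half_cube_iff[of a l] by (auto simp: closure_half_cube elim!: eventually_mono)
qed

lemma set_nn_integral_closure: "(\<integral>\<^sup>+x\<in>closure J. f x \<partial>lebesgue) = (\<integral>\<^sup>+x\<in>J. f x \<partial>lebesgue)"
  by (rule nn_integral_cong_AE) (use AE_half_cube_closure in eventually_elim, auto split: split_indicator)

lemma emeasure_closure: "emeasure lebesgue (closure J) = ennreal (measure lebesgue J)"
  unfolding half_cube_facts(2)[OF J, symmetric]
  by (rule emeasure_eq_AE[OF AE_half_cube_closure]) (use half_cube_facts(1)[OF J] in auto)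

lemma mavg_closure:
  fixes B :: "real^'d \<Rightarrow> complex^'n^'n"
  assumes "set_integrable lebesgue (closure J) B"
  shows "mavg (closure J) B = mavg J B"
proof -
  have "measure lebesgue (closure J) = measure lebesgue J"
    using emeasure_closure by (simp add: measure_def)
  moreover have "(LINT x:closure J|lebesgue. B x) = (LINT x:J|lebesgue. B x)"
    unfolding set_lebesgue_integral_def
  proof (rule integral_cong_AE)
    show meas: "(\<lambda>x. indicator (closure J) x *\<^sub>R B x) \<in> borel_measurable lebesgue"
      using assms by (simp add: set_integrable_def borel_measurable_integrable)
    have eq: "AE x in lebesgue. indicator (closure J) x *\<^sub>R B x = indicator J x *\<^sub>R B x"
      using AE_half_cube_closure by eventually_elim (auto split: split_indicator)
    show "(\<lambda>x. indicator J x *\<^sub>R B x) \<in> borel_measurable lebesgue"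
      by (rule borel_measurable_lebesgue_cong_AE[OF meas]) (rule eventually_mono[OF eq], rule sym)
    show "AE x in lebesgue. indicator (closure J) x *\<^sub>R B x = indicator J x *\<^sub>R B x" by (rule eq)
  qed
  ultimately show ?thesis by (simp add: mavg_def)
qed

lemma ennavg_closure: "ennavg (closure J) f * ennreal (measure lebesgue J) = (\<integral>\<^sup>+x\<in>J. f x \<partial>lebesgue)"
  unfolding ennavg_def emeasure_closure set_nn_integral_closure
  using half_cube_facts(3)[OF J]
  by (simp add: divide_ennreal_def mult.assoc inverse_ennreal flip: ennreal_mult)

lemma ennavg_closure_le_iff:
  assumes "0 \<le> X"
  shows "ennavg (closure J) f \<le> ennreal X \<longleftrightarrow>
    (\<integral>\<^sup>+x\<in>J. f x \<partial>lebesgue) \<le> ennreal (X * measure lebesgue J)"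
proof -
  have "ennreal (X * measure lebesgue J) = ennreal X * ennreal (measure lebesgue J)"
    using assms by (simp add: ennreal_mult)
  moreover have "a * ennreal (measure lebesgue J) \<le> b * ennreal (measure lebesgue J) \<longleftrightarrow> a \<le> b" for a b
    using half_cube_facts(3)[OF J] ennreal_mult_le_mult_iff[of "ennreal (measure lebesgue J)" a b]
    by (simp add: mult.commute)
  ultimately show ?thesis by (simp add: ennavg_closure[symmetric])
qed

end

lemma SUP_cubes_finite_iff:
  "(SUP I\<in>cubes. G I) < (\<infinity>::ennreal) \<longleftrightarrow> (\<exists>K\<ge>0. \<forall>J\<in>half_cubes. G (closure J) \<le> ennreal K)"
proof
  assume "(SUP I\<in>cubes. G I) < \<infinity>"
  then obtain K where "0 \<le> K" "(SUP I\<in>cubes. G I) = ennreal K"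
    by (cases "SUP I\<in>cubes. G I") auto
  then show "\<exists>K\<ge>0. \<forall>J\<in>half_cubes. G (closure J) \<le> ennreal K"
    by (metis SUP_upper cubes_eq_closures imageI)
next
  assume "\<exists>K\<ge>0. \<forall>J\<in>half_cubes. G (closure J) \<le> ennreal K"
  then obtain K where "\<forall>J\<in>half_cubes. G (closure J) \<le> ennreal K" by blast
  then have "(SUP I\<in>cubes. G I) \<le> ennreal K" unfolding cubes_eq_closures by (intro SUP_least) auto
  then show "(SUP I\<in>cubes. G I) < \<infinity>" by (simp add: le_less_trans)
qed

lemma locally_integrable_closure_half_cube:
  assumes "locally_integrable B" "J \<in> half_cubes"
  shows "set_integrable lebesgue (closure J) B" "set_integrable lebesgue J B"
proof -
  obtain a l where J: "0 < l" "J = half_cube a l" using assms(2) by (auto simp: half_cubes_def)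
  have "set_integrable lebesgue (cbox a (a + (\<chi> i. l))) B"
    by (rule assms(1)[unfolded locally_integrable_def, rule_format, OF compact_cbox])
  then show *: "set_integrable lebesgue (closure J) B"
    unfolding J(2) closure_half_cube[OF J(1)] .
  show "set_integrable lebesgue J B"
    by (rule set_integrable_subset[OF * half_cube_facts(1)[OF assms(2)] closure_subset])
qed

lemma locally_integrable_measurable:
  assumes "locally_integrable B"
  shows "B \<in> borel_measurable lebesgue"
proof (rule borel_measurable_LIMSEQ_metric)
  show "(\<lambda>x. indicator (cball 0 (real k)) x *\<^sub>R B x) \<in> borel_measurable lebesgue" for k
  proof -
    have "set_integrable lebesgue (cball 0 (real k)) B"
      by (rule assms[unfolded locally_integrable_def, rule_format, OF compact_cball])
    then show ?thesis by (simp add: set_integrable_def borel_measurable_integrable)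
  qed
  show "(\<lambda>k. indicator (cball 0 (real k)) x *\<^sub>R B x) \<longlonglongrightarrow> B x" for x
  proof (rule tendsto_eventually)
    obtain k0 :: nat where "norm x \<le> real k0" using real_arch_simple by blast
    then show "eventually (\<lambda>k. indicator (cball 0 (real k)) x *\<^sub>R B x = B x) sequentially"
      by (intro eventually_sequentiallyI[of k0]) (auto simp: indicator_def)
  qed
qed

lemma SUP_finite_iff_weighted_osc_bound:
  fixes A B :: "real^'d \<Rightarrow> complex^'n^'n"
  assumes p: "1 \<le> p" and [measurable]: "A \<in> borel_measurable lebesgue" and B: "locally_integrable B"
  shows "(SUP I\<in>cubes. ennavg I (\<lambda>x.
      ennreal (opnorm (A x ** (B x - mavg I B) ** matrix_inv (V I)) powr p))) < \<infinity> \<longleftrightarrow>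
    (\<exists>K. weighted_osc_bound A p (\<lambda>J. V (closure J)) B K)"
    (is "?lhs \<longleftrightarrow> ?rhs")
proof
  note [measurable] = locally_integrable_measurable[OF B]
  let ?T = "\<lambda>J x. A x ** (B x - mavg J B) ** matrix_inv (V (closure J))"
  have mavg: "mavg (closure J) B = mavg J B" if "J \<in> half_cubes" for J
    using that locally_integrable_closure_half_cube(1)[OF B that] by (rule mavg_closure)
  {
    assume ?lhs
    then obtain K where K: "0 \<le> K" "\<And>J. J \<in> half_cubes \<Longrightarrow> (\<integral>\<^sup>+x\<in>J. ennreal (opnorm (?T J x) powr p) \<partial>lebesgue)
        \<le> ennreal (K * measure lebesgue J)"
      unfolding SUP_cubes_finite_iff by (auto simp: ennavg_closure_le_iff mavg)
    let ?N = "real CARD('n) powr p"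
    have N: "0 < ?N" by simp
    have "weighted_osc_bound A p (\<lambda>J. V (closure J)) B (?N * K)"
      unfolding weighted_osc_bound_def
    proof
      fix J :: "(real^'d) set" assume J: "J \<in> half_cubes"
      note [measurable] = half_cube_facts(1)[OF J]
      have le: "norm T powr p \<le> ?N * opnorm T powr p" for T :: "complex^'n^'n"
        using p norm_le_card_opnorm[of T] by (simp add: powr_mono2 flip: powr_mult)
      have "ennreal (1 / ?N) * (\<integral>\<^sup>+x\<in>J. ennreal (norm (?T J x) powr p) \<partial>lebesgue) =
          (\<integral>\<^sup>+x. ennreal (1 / ?N) * (ennreal (norm (?T J x) powr p) * indicator J x) \<partial>lebesgue)"
        by (rule nn_integral_cmult[symmetric]) measurable
      also have "\<dots> \<le> (\<integral>\<^sup>+x\<in>J. ennreal (opnorm (?T J x) powr p) \<partial>lebesgue)"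
      proof (rule nn_integral_mono)
        fix x
        have "1 / ?N * norm (?T J x) powr p \<le> opnorm (?T J x) powr p"
          using le[of "?T J x"] N by (simp add: divide_le_eq mult.commute)
        then show "ennreal (1 / ?N) * (ennreal (norm (?T J x) powr p) * indicator J x) \<le>
            ennreal (opnorm (?T J x) powr p) * indicator J x"
          by (auto intro: ennreal_leI simp flip: ennreal_mult split: split_indicator)
      qed
      also have "\<dots> \<le> ennreal (K * measure lebesgue J)" by (rule K(2)[OF J])
      finally have "ennreal ?N * (ennreal (1 / ?N) * (\<integral>\<^sup>+x\<in>J. ennreal (norm (?T J x) powr p) \<partial>lebesgue)) \<le>
          ennreal ?N * ennreal (K * measure lebesgue J)" by (rule mult_left_mono) simp
      moreover have "ennreal ?N * ennreal (1 / ?N) = 1" using N by (simp flip: ennreal_mult)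
      ultimately show "(\<integral>\<^sup>+x\<in>J. ennreal (norm (?T J x) powr p) \<partial>lebesgue) \<le> ennreal (?N * K * measure lebesgue J)"
        using K(1) by (simp add: ennreal_mult mult.assoc flip: mult.assoc[of "ennreal ?N" "ennreal (1 / ?N)"])
    qed
    then show ?rhs by blast
  next
    assume ?rhs
    then obtain K0 where "weighted_osc_bound A p (\<lambda>J. V (closure J)) B K0" by blast
    then have K: "weighted_osc_bound A p (\<lambda>J. V (closure J)) B (max K0 0)"
      by (rule weighted_osc_bound_mono) simp
    show ?lhs
      unfolding SUP_cubes_finite_iff
    proof (intro exI[of _ "max K0 0"] conjI ballI)
      fix J :: "(real^'d) set" assume J: "J \<in> half_cubes"
      have "(\<integral>\<^sup>+x\<in>J. ennreal (opnorm (?T J x) powr p) \<partial>lebesgue) \<le>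
          (\<integral>\<^sup>+x\<in>J. ennreal (norm (?T J x) powr p) \<partial>lebesgue)"
        using p by (intro nn_integral_mono mult_right_mono ennreal_leI powr_mono2 opnorm_le_norm) auto
      also have "\<dots> \<le> ennreal (max K0 0 * measure lebesgue J)"
        using K J by (simp add: weighted_osc_bound_def)
      finally show "ennavg (closure J) (\<lambda>x. ennreal (opnorm (A x ** (B x - mavg (closure J) B) **
          matrix_inv (V (closure J))) powr p)) \<le> ennreal (max K0 0)"
        by (simp add: ennavg_closure_le_iff[OF J] mavg[OF J])
    qed simp
  }
qed

section \<open>Reducing operators of a matrix weight\<close>

lemma epowr_root_le:
  assumes "epowr x (1 / q) \<le> ennreal y" "0 \<le> y" "0 < q"
  shows "x \<le> ennreal (y powr q)"
proof (cases x)
  case (real t)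
  then have "t powr (1 / q) \<le> y" using assms by (simp add: epowr_def)
  then have "(t powr (1 / q)) powr q \<le> y powr q" using assms by (intro powr_mono2) auto
  then show ?thesis using real assms by (simp add: powr_powr ennreal_leI)
qed (use assms in \<open>simp add: epowr_def top_unique\<close>)

lemma powr_le_of_le_epowr:
  assumes le: "ennreal y \<le> ennreal c * epowr x (1 / q)" and "0 \<le> y" "0 < c" "0 < q" "0 < s"
  shows "ennreal (y powr s) \<le> ennreal (c powr s) * epowr x (s / q)"
proof (cases x)
  case (real t)
  then have "y \<le> c * t powr (1 / q)"
    using assms by (simp add: epowr_def flip: ennreal_mult)
  then have "y powr s \<le> (c * t powr (1 / q)) powr s" using assms by (intro powr_mono2) auto
  then show ?thesis using real assms
    by (simp add: epowr_def powr_mult powr_powr ennreal_leI flip: ennreal_mult)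
qed (use assms in \<open>simp add: epowr_def ennreal_mult_top\<close>)

lemma reducing_operator_bounds:
  fixes A :: "real^'d \<Rightarrow> complex^'n^'n"
  assumes R: "reducing_operator A q (closure J) R" and J: "J \<in> half_cubes" and q: "0 < q"
  shows "(\<integral>\<^sup>+x\<in>J. ennreal (norm (A x *v u) powr q) \<partial>lebesgue) \<le> ennreal (measure lebesgue J * norm (R *v u) powr q)"
    and "ennreal (measure lebesgue J * norm (R *v u) powr q) \<le>
      ennreal (sqrt (real CARD('n)) powr q) * (\<integral>\<^sup>+x\<in>J. ennreal (norm (A x *v u) powr q) \<partial>lebesgue)"
proof -
  let ?E = "ennavg (closure J) (\<lambda>x. ennreal (norm (A x *v u) powr q))"
  have 1: "epowr ?E (1 / q) \<le> ennreal (norm (R *v u))"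
    and 2: "ennreal (norm (R *v u)) \<le> ennreal (sqrt (real CARD('n))) * epowr ?E (1 / q)"
    using R by (simp_all add: reducing_operator_def avg_norm_def)
  have "?E \<le> ennreal (norm (R *v u) powr q)" by (rule epowr_root_le[OF 1]) (use q in auto)
  then show "(\<integral>\<^sup>+x\<in>J. ennreal (norm (A x *v u) powr q) \<partial>lebesgue) \<le> ennreal (measure lebesgue J * norm (R *v u) powr q)"
    by (subst (asm) ennavg_closure_le_iff[OF J]) (simp_all add: mult.commute)
  have "epowr ?E (q / q) = ?E"
    using q by (auto simp: epowr_def ennreal_enn2real_if less_top)
  then have "ennreal (norm (R *v u) powr q) \<le> ennreal (sqrt (real CARD('n)) powr q) * ?E"
    using powr_le_of_le_epowr[OF 2, of q] q by simp
  then have "ennreal (norm (R *v u) powr q) * ennreal (measure lebesgue J) \<le>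
      ennreal (sqrt (real CARD('n)) powr q) * ?E * ennreal (measure lebesgue J)" by (rule mult_right_mono) simp
  then show "ennreal (measure lebesgue J * norm (R *v u) powr q) \<le>
      ennreal (sqrt (real CARD('n)) powr q) * (\<integral>\<^sup>+x\<in>J. ennreal (norm (A x *v u) powr q) \<partial>lebesgue)"
    by (simp add: ennavg_closure[OF J] ennreal_mult mult.assoc mult.commute[of "measure lebesgue J"])
qed

text \<open>In the \<open>A\<^sub>p\<close> constant the inner average, over \<open>t\<close>, is up to constants \<open>|V' W\<^sup>1\<^sup>/\<^sup>p(x)|\<^sup>q\<close>; taking
  adjoints, this is the norm of \<open>W\<^sup>1\<^sup>/\<^sup>p(x) V'\<close>, and the outer average, over \<open>x\<close>, turns it
  into \<open>|V V'|\<^sup>p\<close>.\<close>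

lemma reducing_operators_product_bound:
  fixes W :: "real^'d \<Rightarrow> complex^'n^'n"
  assumes p: "1 < p" and W: "matrix_Ap p W"
    and V: "\<And>J. J \<in> half_cubes \<Longrightarrow> reducing_operator (\<lambda>x. mpow (W x) (1/p)) p (closure J) (V J)"
    and V': "\<And>J. J \<in> half_cubes \<Longrightarrow> reducing_operator (\<lambda>x. mpow (W x) (- 1/p)) (conj_exp p) (closure J) (V' J)"
  obtains M where "1 \<le> M" "\<And>J. J \<in> half_cubes \<Longrightarrow> norm (V J ** V' J) \<le> M"
proof -
  let ?q = "conj_exp p" and ?A = "\<lambda>x. mpow (W x) (1/p)" and ?A' = "\<lambda>x. mpow (W x) (- 1/p)"
  let ?n = "real CARD('n)"
  have q: "0 < ?q" using p by (simp add: conj_exp_def)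
  have pos: "AE x in lebesgue. pos_def (W x)" and W_meas: "W \<in> borel_measurable lebesgue"
    using W by (auto simp: matrix_Ap_def)
  have [measurable]: "?A \<in> borel_measurable lebesgue" by (rule borel_measurable_mpow[OF W_meas pos])
  obtain a where a: "0 \<le> a" "Ap_const p W = ennreal a"
    using W by (cases "Ap_const p W") (auto simp: matrix_Ap_def)
  define C where "C = sqrt ?n powr p"
  have C: "0 < C" by (simp add: C_def)
  define X where "X = ?n powr p * ?n * (C * a)"
  have bound: "norm (V J ** V' J) \<le> ?n * (C * X) powr (1 / p)" if J: "J \<in> half_cubes" for J
  proof -
    note J' = half_cube_facts[OF J]
    have [measurable]: "J \<in> sets lebesgue" by (rule J'(1))
    have V'_self: "cadjoint (V' J) = V' J" using V'[OF J] by (simp add: reducing_operator_def pos_def_def)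
    define H where "H x = ennavg (closure J) (\<lambda>t. ennreal (opnorm (?A x ** ?A' t) powr ?q))" for x
    have "ennavg (closure J) (\<lambda>x. epowr (H x) (p / ?q)) \<le> Ap_const p W"
      unfolding Ap_const_def H_def cubes_eq_closures by (rule SUP_upper) (use J in blast)
    then have H: "(\<integral>\<^sup>+x\<in>J. epowr (H x) (p / ?q) \<partial>lebesgue) \<le> ennreal (a * measure lebesgue J)"
      unfolding a(2) ennavg_closure_le_iff[OF J a(1)] .
    \<comment> \<open>The inner average is not shown to be measurable in \<open>x\<close>; the constant is therefore pulled
      out of the integral on the side of the norm.\<close>
    have col: "(\<integral>\<^sup>+x\<in>J. ennreal (norm ((V' J ** ?A x) *v axis i 1) powr p) \<partial>lebesgue) \<le>
        ennreal (C * a * measure lebesgue J)" for i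
    proof -
      have "AE x in lebesgue. ennreal (norm ((V' J ** ?A x) *v axis i 1) powr p) \<le> ennreal C * epowr (H x) (p / ?q)"
        using pos
      proof eventually_elim
        case (elim x)
        let ?v = "?A x *v axis i 1"
        have "ennavg (closure J) (\<lambda>t. ennreal (norm (?A' t *v ?v) powr ?q)) \<le> H x"
          unfolding H_def ennavg_def
        proof (intro divide_right_mono_ennreal nn_integral_mono_AE)
          show "AE t in lebesgue. ennreal (norm (?A' t *v ?v) powr ?q) * indicator (closure J) t \<le>
              ennreal (opnorm (?A x ** ?A' t) powr ?q) * indicator (closure J) t"
            using pos
          proof eventually_elim
            case (elim t)
            have "cadjoint (?A' t ** ?A x) = ?A x ** ?A' t"
              using \<open>pos_def (W x)\<close> elim by (simp add: cadjoint_mult cadjoint_mpow)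
            then have "opnorm (?A' t ** ?A x) = opnorm (?A x ** ?A' t)" by (metis opnorm_cadjoint)
            then have "norm (?A' t *v ?v) \<le> opnorm (?A x ** ?A' t)"
              using norm_le_opnorm[of "?A' t ** ?A x" "axis i 1"]
              by (simp add: norm_axis_complex matrix_vector_mul_assoc)
            then show ?case
              using q by (intro mult_right_mono ennreal_leI powr_mono2) auto
          qed
        qed
        then have "epowr (ennavg (closure J) (\<lambda>t. ennreal (norm (?A' t *v ?v) powr ?q))) (1 / ?q) \<le> epowr (H x) (1 / ?q)"
          using q by (auto simp: epowr_def top_unique less_top intro!: ennreal_leI powr_mono2 enn2real_mono)
        moreover have "ennreal (norm (V' J *v ?v)) \<le> ennreal (sqrt ?n) *
            epowr (ennavg (closure J) (\<lambda>t. ennreal (norm (?A' t *v ?v) powr ?q))) (1 / ?q)"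
          using V'[OF J] by (simp add: reducing_operator_def avg_norm_def)
        ultimately have "ennreal (norm (V' J *v ?v)) \<le> ennreal (sqrt ?n) * epowr (H x) (1 / ?q)"
          by (meson mult_left_mono order_trans zero_le)
        from powr_le_of_le_epowr[OF this, of p] show ?case
          using p q by (simp add: C_def matrix_vector_mul_assoc)
      qed
      then have "AE x in lebesgue. ennreal (1 / C) * (ennreal (norm ((V' J ** ?A x) *v axis i 1) powr p) * indicator J x) \<le>
          epowr (H x) (p / ?q) * indicator J x"
      proof eventually_elim
        case (elim x)
        have "ennreal (1 / C) * ennreal (norm ((V' J ** ?A x) *v axis i 1) powr p) \<le>
            ennreal (1 / C) * (ennreal C * epowr (H x) (p / ?q))"
          by (rule mult_left_mono[OF elim]) simp
        also have "\<dots> = epowr (H x) (p / ?q)"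
          using C by (simp add: mult.assoc[symmetric] flip: ennreal_mult)
        finally show ?case by (auto split: split_indicator)
      qed
      then have "(\<integral>\<^sup>+x. ennreal (1 / C) * (ennreal (norm ((V' J ** ?A x) *v axis i 1) powr p) * indicator J x) \<partial>lebesgue)
          \<le> ennreal (a * measure lebesgue J)"
        by (rule order_trans[OF nn_integral_mono_AE H])
      then have "ennreal (1 / C) * (\<integral>\<^sup>+x\<in>J. ennreal (norm ((V' J ** ?A x) *v axis i 1) powr p) \<partial>lebesgue)
          \<le> ennreal (a * measure lebesgue J)"
        by (subst (asm) nn_integral_cmult) measurable
      then have "ennreal C * (ennreal (1 / C) * (\<integral>\<^sup>+x\<in>J. ennreal (norm ((V' J ** ?A x) *v axis i 1) powr p) \<partial>lebesgue))
          \<le> ennreal C * ennreal (a * measure lebesgue J)" by (rule mult_left_mono) simp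
      moreover have "ennreal C * ennreal (1 / C) = 1" using C by (simp flip: ennreal_mult)
      ultimately show ?thesis
        using C a(1) by (simp add: mult.assoc[symmetric]) (simp add: mult.assoc flip: ennreal_mult)
    qed
    have "(\<integral>\<^sup>+x\<in>J. ennreal (norm (V' J ** ?A x) powr p) \<partial>lebesgue) \<le>
        ennreal (?n powr p * ?n * (C * a * measure lebesgue J))"
      by (rule set_nn_integral_matrix_le_columns) (use p C a col in auto)
    then have total: "(\<integral>\<^sup>+x\<in>J. ennreal (norm (V' J ** ?A x) powr p) \<partial>lebesgue) \<le> ennreal (X * measure lebesgue J)"
      by (simp add: X_def mult_ac)
    have "norm ((V J ** V' J) *v axis i 1) \<le> (C * X) powr (1 / p)" for i
    proof -
      let ?w = "V' J *v axis i 1"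
      have "AE x in lebesgue. ennreal (norm (?A x *v ?w) powr p) * indicator J x \<le>
          ennreal (norm (V' J ** ?A x) powr p) * indicator J x"
        using pos
      proof eventually_elim
        case (elim x)
        have "norm (?A x *v ?w) \<le> norm (?A x ** V' J)"
          using norm_matrix_vector_le[of "?A x ** V' J" "axis i 1"]
          by (simp add: norm_axis_complex matrix_vector_mul_assoc)
        also have "?A x ** V' J = cadjoint (V' J ** ?A x)"
          using elim by (simp add: cadjoint_mult cadjoint_mpow V'_self)
        finally have "norm (?A x *v ?w) \<le> norm (V' J ** ?A x)" by simp
        then show ?case using p by (intro mult_right_mono ennreal_leI powr_mono2) auto
      qed
      then have le: "(\<integral>\<^sup>+x\<in>J. ennreal (norm (?A x *v ?w) powr p) \<partial>lebesgue) \<le> ennreal (X * measure lebesgue J)"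
        by (rule order_trans[OF nn_integral_mono_AE total])
      have "ennreal (measure lebesgue J * norm (V J *v ?w) powr p) \<le>
          ennreal C * (\<integral>\<^sup>+x\<in>J. ennreal (norm (?A x *v ?w) powr p) \<partial>lebesgue)"
        unfolding C_def by (rule reducing_operator_bounds(2)[OF V[OF J] J]) (use p in simp)
      also have "\<dots> \<le> ennreal C * ennreal (X * measure lebesgue J)" by (rule mult_left_mono[OF le]) simp
      finally have "norm (V J *v ?w) powr p \<le> C * X"
        using C a(1) J'(3) by (simp add: X_def mult_ac flip: ennreal_mult)
      then have "(norm (V J *v ?w) powr p) powr (1 / p) \<le> (C * X) powr (1 / p)"
        using p by (intro powr_mono2) auto
      then show ?thesis using p by (simp add: powr_powr matrix_vector_mul_assoc)
    qed
    then have "(\<Sum>i\<in>UNIV. norm ((V J ** V' J) *v axis i 1)) \<le> of_nat CARD('n) * (C * X) powr (1 / p)"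
      by (intro sum_bounded_above)
    then show ?thesis using norm_matrix_le_columns[of "V J ** V' J"] by linarith
  qed
  show ?thesis
    by (rule that[of "max 1 (?n * (C * X) powr (1 / p))"]) (use bound in \<open>auto simp: le_max_iff_disj\<close>)
qed

lemma weight_reducing_pair:
  fixes W :: "real^'d \<Rightarrow> complex^'n^'n"
  assumes p: "1 < p" and W: "matrix_Ap p W"
    and V: "\<And>J. J \<in> half_cubes \<Longrightarrow> reducing_operator (\<lambda>x. mpow (W x) (1/p)) p (closure J) (V J)"
    and V': "\<And>J. J \<in> half_cubes \<Longrightarrow> reducing_operator (\<lambda>x. mpow (W x) (- 1/p)) (conj_exp p) (closure J) (V' J)"
  shows "\<exists>M r. reducing_pair (\<lambda>x. mpow (W x) (1/p)) (\<lambda>x. mpow (W x) (- 1/p)) p (conj_exp p) M r V V'"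
proof -
  let ?q = "conj_exp p" and ?c = "sqrt (real CARD('n))"
  have q: "1 < ?q" and pq: "1 / p + 1 / ?q = 1" using p by (simp_all add: conj_exp_def field_simps)
  have pos: "AE x in lebesgue. pos_def (W x)" and W_meas: "W \<in> borel_measurable lebesgue"
    using W by (auto simp: matrix_Ap_def)
  obtain M where M: "1 \<le> M" "\<And>J. J \<in> half_cubes \<Longrightarrow> norm (V J ** V' J) \<le> M"
    using reducing_operators_product_bound[where V = V and V' = V', OF p W V V'] by blast
  define r where "r = max (?c powr p) (?c powr ?q)"
  have "reducing_pair (\<lambda>x. mpow (W x) (1/p)) (\<lambda>x. mpow (W x) (- 1/p)) p ?q M r V V'"
  proof
    show "AE x in lebesgue. cadjoint (mpow (W x) (1/p)) = mpow (W x) (1/p)"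
      "AE x in lebesgue. cadjoint (mpow (W x) (- 1/p)) = mpow (W x) (- 1/p)"
      using pos by (auto elim!: eventually_mono simp: cadjoint_mpow)
    show "AE x in lebesgue. mpow (W x) (1/p) ** mpow (W x) (- 1/p) = mat 1"
      using pos by eventually_elim (use mpow_mult_minus[where s = "1/p"] in simp)
    show "pos_def (V J)" "pos_def (V' J)" if "J \<in> half_cubes" for J
      using V[OF that] V'[OF that] by (simp_all add: reducing_operator_def)
    show "0 \<le> r" by (simp add: r_def le_max_iff_disj)
    fix J :: "(real^'d) set" and u assume J: "J \<in> half_cubes"
    have lower: "a \<le> ennreal r * b" if "a \<le> ennreal c * b" "c \<le> r" for a b c
      using that by (meson ennreal_leI mult_right_mono order_trans zero_le)
    show "(\<integral>\<^sup>+x\<in>J. ennreal (norm (mpow (W x) (1/p) *v u) powr p) \<partial>lebesgue) \<le>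
        ennreal (measure lebesgue J * norm (V J *v u) powr p)"
      using reducing_operator_bounds(1)[OF V[OF J] J] p by simp
    show "(\<integral>\<^sup>+x\<in>J. ennreal (norm (mpow (W x) (- 1/p) *v u) powr ?q) \<partial>lebesgue) \<le>
        ennreal (measure lebesgue J * norm (V' J *v u) powr ?q)"
      using reducing_operator_bounds(1)[OF V'[OF J] J] q by simp
    show "ennreal (measure lebesgue J * norm (V J *v u) powr p) \<le>
        ennreal r * (\<integral>\<^sup>+x\<in>J. ennreal (norm (mpow (W x) (1/p) *v u) powr p) \<partial>lebesgue)"
      by (rule lower, rule reducing_operator_bounds(2)[OF V[OF J] J]) (use p in \<open>auto simp: r_def\<close>)
    show "ennreal (measure lebesgue J * norm (V' J *v u) powr ?q) \<le>
        ennreal r * (\<integral>\<^sup>+x\<in>J. ennreal (norm (mpow (W x) (- 1/p) *v u) powr ?q) \<partial>lebesgue)"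
      by (rule lower, rule reducing_operator_bounds(2)[OF V'[OF J] J]) (use q in \<open>auto simp: r_def\<close>)
  qed (fact p q pq M borel_measurable_mpow[OF W_meas pos])+
  then show ?thesis by blast
qed

lemma locally_integrable_cadjoint:
  "locally_integrable B \<Longrightarrow> locally_integrable (\<lambda>x. cadjoint (B x))"
  unfolding locally_integrable_def using set_integrable_cadjoint by blast

section \<open>Equivalence of the two conditions\<close>

theorem corollary1p5:
  fixes p :: real
    and W B :: "real^'d \<Rightarrow> complex^'n^'n"
    and V V' :: "(real^'d) set \<Rightarrow> complex^'n^'n"
    and primal :: bool
  assumes "1 < p"
    and "matrix_Ap p W"
    and "\<And>I. I \<in> cubes \<Longrightarrow> reducing_operator (\<lambda>x. mpow (W x) (1/p)) p I (V I)"
    and "\<And>I. I \<in> cubes \<Longrightarrow> reducing_operator (\<lambda>x. mpow (W x) (- 1/p)) (conj_exp p) I (V' I)"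
    and "locally_integrable B"
  shows "B \<in> BMO_W primal p W V V' \<longleftrightarrow>
    (SUP I\<in>cubes. ennavg I (\<lambda>x.
      ennreal (opnorm (mpow (W x) (1/p) ** (B x - mavg I B) ** matrix_inv (V I)) powr p))) < \<infinity> \<and>
    (SUP I\<in>cubes. ennavg I (\<lambda>x.
      ennreal (opnorm (mpow (W x) (- 1/p) **
          (cadjoint (B x) - mavg I (\<lambda>y. cadjoint (B y))) ** matrix_inv (V' I)) powr conj_exp p))) < \<infinity>"
proof -
  let ?A = "\<lambda>x. mpow (W x) (1/p)" and ?A' = "\<lambda>x. mpow (W x) (- 1/p)" and ?q = "conj_exp p"
  let ?V = "\<lambda>J. V (closure J)" and ?V' = "\<lambda>J. V' (closure J)"
  let ?B' = "\<lambda>x. cadjoint (B x)"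
  note B = assms(5) and B' = locally_integrable_cadjoint[OF assms(5)]
  have "closure J \<in> cubes" if "J \<in> half_cubes" for J using that by (simp add: cubes_eq_closures)
  then obtain M r where "reducing_pair ?A ?A' p ?q M r ?V ?V'"
    using weight_reducing_pair[OF assms(1,2), of ?V ?V'] assms(3,4) by blast
  then interpret reducing_pair ?A ?A' p ?q M r ?V ?V' .
  interpret dual: reducing_pair ?A' ?A ?q p M r ?V' ?V by (rule dual)
  have primal_iff: "bmo_cond p W V B \<longleftrightarrow> (\<exists>K. weighted_osc_bound ?A p ?V B K)"
    unfolding bmo_cond_def using p by (intro SUP_finite_iff_weighted_osc_bound A_meas B) simp
  have dual_iff: "bmo_dual_cond p W V' B \<longleftrightarrow> (\<exists>K. weighted_osc_bound ?A' ?q ?V' ?B' K)"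
    unfolding bmo_dual_cond_def using q by (intro SUP_finite_iff_weighted_osc_bound A'_meas B') simp
  have "bmo_cond p W V B \<longleftrightarrow> bmo_dual_cond p W V' B"
    unfolding primal_iff dual_iff
  proof
    assume "\<exists>K. weighted_osc_bound ?A p ?V B K"
    then show "\<exists>K. weighted_osc_bound ?A' ?q ?V' ?B' K"
      using weighted_osc_bound_dual[OF locally_integrable_measurable[OF B]
          locally_integrable_closure_half_cube(2)[OF B]] by blast
  next
    assume "\<exists>K. weighted_osc_bound ?A' ?q ?V' ?B' K"
    then have "\<exists>K. weighted_osc_bound ?A p ?V (\<lambda>x. cadjoint (?B' x)) K"
      using dual.weighted_osc_bound_dual[OF locally_integrable_measurable[OF B']
          locally_integrable_closure_half_cube(2)[OF B']] by blast
    then show "\<exists>K. weighted_osc_bound ?A p ?V B K" by simp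
  qed
  then have "B \<in> BMO_W primal p W V V' \<longleftrightarrow> bmo_cond p W V B \<and> bmo_dual_cond p W V' B"
    using B by (auto simp: BMO_W_def)
  then show ?thesis unfolding bmo_cond_def bmo_dual_cond_def .
qed

end
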